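(* Consider the setting of the context, in case (Z) (zero sets) or in case (C) (critical points). Let $\mathcal{O}$ be a non-empty open subset of $\Omega$ and let $Z_R=f_R^{-1}(0)$. For all $p\in\mathbb{N}^*$, if Reg$(4p-1)$, ScL$(4p-1)$, DC$(4p-1,2)$ and, in case (Z), ND$(4p-1)$ (resp. in case (C), $\nabla$-ND$(4p-1)$) hold, then, as $R\to+\infty$, $$\mathbb{P}\left(\tfrac1RZ_R\cap\mathcal{O}=\emptyset\right)=O(R^{-pd}).$$
   Context: Setting: $d\geq1$, $k\in\{1,\dots,d\}$; $f:\mathbb{R}^d\to\mathbb{R}^k$ is a centered stationary Gaussian field; $U\subset\mathbb{R}^d$ is convex open, $\Omega\subset U$ non-empty open with $\inf\{\|y-x\|\mid x\in\Omega,y\notin U\}>0$ (with $\inf\emptyset=+\infty$); $\mathcal{R}\subset(0,+\infty)$ is unbounded and limits $R\to+\infty$ are along $R\in\mathcal{R}$; for $R\in\mathcal{R}$, $f_R:RU\to\mathbb{R}^k$ is a centered Gaussian field. Case (Z): no further assumption. Case (C): $k=d$, $f=\nabla h$ with $h:\mathbb{R}^d\to\mathbb{R}$ a centered stationary Gaussian field, and $f_R=\nabla h_R$ with $h_R:RU\to\mathbb{R}$ centered Gaussian fields. $r(x,y)=\mathbb{E}[f(x)\,{}^tf(y)]$ and $r_R(x,y)=\mathbb{E}[f_R(x)\,{}^tf_R(y)]$. Hypotheses ($q\in\mathbb{N}$, $s\in[1,+\infty]$; $\partial^{\alpha,\beta}$ is the partial derivative on $\mathbb{R}^d\times\mathbb{R}^d$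 with multi-index $(\alpha,\beta)$). Reg$(q)$: $f$ and all $f_R$ are of class $\mathcal{C}^q$. ND$(q)$: for any $l\in\{1,\dots,q+1\}$, positive integers $m_1,\dots,m_l$ with $\sum m_i=q+1$, and pairwise distinct $x_1,\dots,x_l\in\mathbb{R}^d$, the Gaussian vector $(\partial^\alpha f(x_i))_{i,|\alpha|<m_i}$ is non-degenerate. $\nabla$-ND$(q)$: same with the vector $(\partial^\alpha h(x_i))_{i,\,0<|\alpha|\leq m_i}$. ScL$(q)$: for every non-empty compact $\Gamma\subset\mathbb{R}^d$, $\sup_{|\alpha|,|\beta|\leq q}\sup_{x\in\Omega}\sup_{w,z\in\Gamma}\|\partial^{\alpha,\beta}r_R(Rx+w,Rx+z)-\partial^{\alpha,\beta}r(w,z)\|\to0$. DC$(q,s)$: there exist $\omega>0$ and an even bounded $g:\mathbb{R}^d\to[0,+\infty)$ with $g\to0$ at infinity, $g_\omega:x\mapsto\sup_{\|y\|\leq\omega}g(x+y)$ in $L^s(\mathbb{R}^d)$, and $\max_{|\alpha|,|\beta|\leq q}\|\partial^{\alpha,\beta}r_R(x,y)\|\leq g(y-x)$ for all $R\in\mathcal{R}$, $x,y\in RU$. *)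

theory Defs
  imports "HOL-Probability.Probability" "HOL-Library.Landau_Symbols"
begin

section \<open>Partial derivatives and functions of class \<open>C\<^sup>q\<close>\<close>

definition partial_deriv ::
  "'d::finite \<Rightarrow> (real^'d \<Rightarrow> 'b::real_normed_vector) \<Rightarrow> real^'d \<Rightarrow> 'b" where
  "partial_deriv j u x = vector_derivative (\<lambda>t. u (x + t *\<^sub>R axis j 1)) (at 0)"

primrec iterated_partial ::
  "'d::finite list \<Rightarrow> (real^'d \<Rightarrow> 'b::real_normed_vector) \<Rightarrow> real^'d \<Rightarrow> 'b" where
  "iterated_partial [] u = u"
| "iterated_partial (j # js) u = partial_deriv j (iterated_partial js u)"

definition class_C ::
  "nat \<Rightarrow> (real^'d::finite) set \<Rightarrow> (real^'d \<Rightarrow> 'b::real_normed_vector) \<Rightarrow> bool" where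
  "class_C q S u \<longleftrightarrow>
     (\<forall>js. length js \<le> q \<longrightarrow> continuous_on S (iterated_partial js u)) \<and>
     (\<forall>js j x. length js < q \<and> x \<in> S \<longrightarrow>
        (\<lambda>t. iterated_partial js u (x + t *\<^sub>R axis j 1)) differentiable (at (0::real)))"

text \<open>A multi-index is a function \<open>\<alpha> :: 'd \<Rightarrow> nat\<close>, of length \<open>|\<alpha>| = sum \<alpha> UNIV\<close>.\<close>

abbreviation mi_length :: "('d::finite \<Rightarrow> nat) \<Rightarrow> nat" where
  "mi_length \<alpha> \<equiv> sum \<alpha> UNIV"

text \<open>The derivative \<open>\<partial>\<^sup>\<alpha>\<close> differentiates \<open>\<alpha> j\<close> times in each direction \<open>j\<close>. The order in which this
  is done is left unspecified; by Schwarz's theorem it is irrelevant wherever the derivatives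
  involved are continuous.\<close>

definition mi_deriv ::
  "('d::finite \<Rightarrow> nat) \<Rightarrow> (real^'d \<Rightarrow> 'b::real_normed_vector) \<Rightarrow> real^'d \<Rightarrow> 'b" where
  "mi_deriv \<alpha> = iterated_partial (SOME js. \<forall>j. count_list js j = \<alpha> j)"

definition mi_deriv2 ::
  "('d::finite \<Rightarrow> nat) \<Rightarrow> ('d \<Rightarrow> nat) \<Rightarrow> (real^'d \<Rightarrow> real^'d \<Rightarrow> 'b::real_normed_vector)
     \<Rightarrow> real^'d \<Rightarrow> real^'d \<Rightarrow> 'b" where
  "mi_deriv2 \<alpha> \<beta> r x y = mi_deriv \<alpha> (\<lambda>x'. mi_deriv \<beta> (r x') y) x"


section \<open>Gaussian fields\<close>

text \<open>Fields are written with the sample point first: \<open>X \<omega> x\<close>. Degenerate (zero) variables count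
  as Gaussian.\<close>

definition centered_normal :: "'w measure \<Rightarrow> ('w \<Rightarrow> real) \<Rightarrow> bool" where
  "centered_normal M Y \<longleftrightarrow> Y \<in> borel_measurable M \<and>
     ((AE \<omega> in M. Y \<omega> = 0) \<or>
      (\<exists>\<sigma>>0. distributed M lborel Y (\<lambda>t. ennreal (normal_density 0 \<sigma> t))))"

definition centered_gaussian_field ::
  "'w measure \<Rightarrow> 'a set \<Rightarrow> ('w \<Rightarrow> 'a \<Rightarrow> 'b::euclidean_space) \<Rightarrow> bool" where
  "centered_gaussian_field M S X \<longleftrightarrow>
     (\<forall>x\<in>S. (\<lambda>\<omega>. X \<omega> x) \<in> borel_measurable M) \<and>
     (\<forall>T a. finite T \<and> T \<subseteq> S \<longrightarrow> centered_normal M (\<lambda>\<omega>. \<Sum>x\<in>T. a x \<bullet> X \<omega> x))"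

definition stationary_field ::
  "'w measure \<Rightarrow> ('w \<Rightarrow> 'a::ab_group_add \<Rightarrow> 'b::euclidean_space) \<Rightarrow> bool" where
  "stationary_field M X \<longleftrightarrow>
     (\<forall>t T. finite T \<longrightarrow>
        distr M (Pi\<^sub>M T (\<lambda>_. borel)) (\<lambda>\<omega>. \<lambda>x\<in>T. X \<omega> (x + t)) =
        distr M (Pi\<^sub>M T (\<lambda>_. borel)) (\<lambda>\<omega>. \<lambda>x\<in>T. X \<omega> x))"

text \<open>The matrix-valued kernel \<open>(x, y) \<mapsto> E[X(x) X(y)\<^sup>T]\<close> of a centered field.\<close>

definition cov_kernel ::
  "'w measure \<Rightarrow> ('w \<Rightarrow> 'a \<Rightarrow> real^'k::finite) \<Rightarrow> 'a \<Rightarrow> 'a \<Rightarrow> real^'k^'k" where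
  "cov_kernel M X x y = (\<integral>\<omega>. (\<chi> i j. X \<omega> x $ i * X \<omega> y $ j) \<partial>M)"

definition covar :: "'w measure \<Rightarrow> ('w \<Rightarrow> real) \<Rightarrow> ('w \<Rightarrow> real) \<Rightarrow> real" where
  "covar M Y Z = (\<integral>\<omega>. (Y \<omega> - (\<integral>\<omega>'. Y \<omega>' \<partial>M)) * (Z \<omega> - (\<integral>\<omega>'. Z \<omega>' \<partial>M)) \<partial>M)"

text \<open>Non-degeneracy of the random vector \<open>(Y i)\<close>, \<open>i \<in> I\<close>, with \<open>I\<close> finite: its variance matrix is
  positive definite.\<close>

definition nondegenerate_vector :: "'w measure \<Rightarrow> 'i set \<Rightarrow> ('i \<Rightarrow> 'w \<Rightarrow> real) \<Rightarrow> bool" where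
  "nondegenerate_vector M I Y \<longleftrightarrow>
     (\<forall>a. (\<exists>i\<in>I. a i \<noteq> 0) \<longrightarrow> 0 < (\<Sum>i\<in>I. \<Sum>j\<in>I. a i * covar M (Y i) (Y j) * a j))"


section \<open>The hypotheses\<close>

text \<open>The field \<open>f\<close> lives on the probability space \<open>M\<close> and, for \<open>R \<in> \<R>\<close>, the field \<open>F R\<close> lives on
  \<open>N R\<close> and is indexed by \<open>R U\<close>; the values of \<open>F R \<omega>\<close> outside \<open>R U\<close> play no role.\<close>

abbreviation dilate :: "real \<Rightarrow> 'a::real_vector set \<Rightarrow> 'a set" where
  "dilate R S \<equiv> (\<lambda>x. R *\<^sub>R x) ` S"

definition to_infinity_along :: "real set \<Rightarrow> real filter" where
  "to_infinity_along \<R> = inf at_top (principal \<R>)"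

definition Reg ::
  "nat \<Rightarrow> 'w measure \<Rightarrow> ('w \<Rightarrow> real^'d::finite \<Rightarrow> real^'k::finite) \<Rightarrow> (real^'d) set \<Rightarrow> real set \<Rightarrow>
   (real \<Rightarrow> 'v measure) \<Rightarrow> (real \<Rightarrow> 'v \<Rightarrow> real^'d \<Rightarrow> real^'k) \<Rightarrow> bool" where
  "Reg q M f U \<R> N F \<longleftrightarrow>
     (\<forall>\<omega>\<in>space M. class_C q UNIV (f \<omega>)) \<and>
     (\<forall>R\<in>\<R>. \<forall>\<omega>\<in>space (N R). class_C q (dilate R U) (F R \<omega>))"

definition ND ::
  "nat \<Rightarrow> 'w measure \<Rightarrow> ('w \<Rightarrow> real^'d::finite \<Rightarrow> real^'k::finite) \<Rightarrow> bool" where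
  "ND q M f \<longleftrightarrow>
     (\<forall>l\<in>{1..q+1}. \<forall>(m::nat \<Rightarrow> nat) (x::nat \<Rightarrow> real^'d).
        (\<forall>i<l. 0 < m i) \<and> (\<Sum>i<l. m i) = q + 1 \<and> inj_on x {..<l} \<longrightarrow>
        nondegenerate_vector M {(i, \<alpha>, c::'k). i < l \<and> mi_length \<alpha> < m i}
          (\<lambda>(i, \<alpha>, c) \<omega>. mi_deriv \<alpha> (f \<omega>) (x i) $ c))"

definition grad_ND :: "nat \<Rightarrow> 'w measure \<Rightarrow> ('w \<Rightarrow> real^'d::finite \<Rightarrow> real) \<Rightarrow> bool" where
  "grad_ND q M h \<longleftrightarrow>
     (\<forall>l\<in>{1..q+1}. \<forall>(m::nat \<Rightarrow> nat) (x::nat \<Rightarrow> real^'d).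
        (\<forall>i<l. 0 < m i) \<and> (\<Sum>i<l. m i) = q + 1 \<and> inj_on x {..<l} \<longrightarrow>
        nondegenerate_vector M {(i, \<alpha>). i < l \<and> 0 < mi_length \<alpha> \<and> mi_length \<alpha> \<le> m i}
          (\<lambda>(i, \<alpha>) \<omega>. mi_deriv \<alpha> (h \<omega>) (x i)))"

text \<open>For fixed \<open>\<Gamma>\<close>, the points \<open>R x + w\<close> and \<open>R x + z\<close> below lie in \<open>R U\<close> once \<open>R\<close> is large.\<close>

definition ScL ::
  "nat \<Rightarrow> 'w measure \<Rightarrow> ('w \<Rightarrow> real^'d::finite \<Rightarrow> real^'k::finite) \<Rightarrow> (real^'d) set \<Rightarrow> real set \<Rightarrow>
   (real \<Rightarrow> 'v measure) \<Rightarrow> (real \<Rightarrow> 'v \<Rightarrow> real^'d \<Rightarrow> real^'k) \<Rightarrow> bool" where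
  "ScL q M f \<Omega> \<R> N F \<longleftrightarrow>
     (\<forall>\<Gamma>. compact \<Gamma> \<and> \<Gamma> \<noteq> {} \<longrightarrow>
       ((\<lambda>R. SUP \<alpha>\<in>{\<alpha>. mi_length \<alpha> \<le> q}. SUP \<beta>\<in>{\<beta>. mi_length \<beta> \<le> q}. SUP x\<in>\<Omega>. SUP w\<in>\<Gamma>. SUP z\<in>\<Gamma>.
          ennreal (norm (mi_deriv2 \<alpha> \<beta> (cov_kernel (N R) (F R)) (R *\<^sub>R x + w) (R *\<^sub>R x + z)
                       - mi_deriv2 \<alpha> \<beta> (cov_kernel M f) w z)))
        \<longlongrightarrow> 0) (to_infinity_along \<R>))"

definition in_Lp :: "ennreal \<Rightarrow> ('a::euclidean_space \<Rightarrow> real) \<Rightarrow> bool" where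
  "in_Lp s u \<longleftrightarrow> u \<in> borel_measurable lebesgue \<and>
     (if s = \<infinity> then \<exists>C. AE x in lebesgue. \<bar>u x\<bar> \<le> C
      else integrable lebesgue (\<lambda>x. \<bar>u x\<bar> powr enn2real s))"

definition DC ::
  "nat \<Rightarrow> ennreal \<Rightarrow> (real^'d::finite) set \<Rightarrow> real set \<Rightarrow>
   (real \<Rightarrow> 'v measure) \<Rightarrow> (real \<Rightarrow> 'v \<Rightarrow> real^'d \<Rightarrow> real^'k::finite) \<Rightarrow> bool" where
  "DC q s U \<R> N F \<longleftrightarrow>
     (\<exists>\<omega>>0. \<exists>g :: real^'d \<Rightarrow> real.
        (\<forall>x. 0 \<le> g x) \<and> (\<forall>x. g (- x) = g x) \<and> bounded (range g) \<and>
        (g \<longlongrightarrow> 0) at_infinity \<and>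
        in_Lp s (\<lambda>x. SUP y\<in>cball 0 \<omega>. g (x + y)) \<and>
        (\<forall>R\<in>\<R>. \<forall>x\<in>dilate R U. \<forall>y\<in>dilate R U. \<forall>\<alpha> \<beta>.
           mi_length \<alpha> \<le> q \<and> mi_length \<beta> \<le> q \<longrightarrow>
           norm (mi_deriv2 \<alpha> \<beta> (cov_kernel (N R) (F R)) x y) \<le> g (y - x)))"

definition zero_set :: "(real^'d::finite) set \<Rightarrow> (real^'d \<Rightarrow> real^'k::finite) \<Rightarrow> (real^'d) set" where
  "zero_set S u = {x \<in> S. u x = 0}"

definition hole_prob ::
  "(real \<Rightarrow> 'v measure) \<Rightarrow> (real \<Rightarrow> 'v \<Rightarrow> real^'d::finite \<Rightarrow> real^'k::finite) \<Rightarrow> (real^'d) set \<Rightarrow>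
   (real^'d) set \<Rightarrow> real \<Rightarrow> real" where
  "hole_prob N F U A R =
     measure (N R) {\<omega> \<in> space (N R). dilate (1 / R) (zero_set (dilate R U) (F R \<omega>)) \<inter> A = {}}"

end

theory Submission
  imports Defs
begin

text \<open>The hole probability decays faster than any power of \<open>R\<close>, and this can be seen without
  Kac-Rice formulas or moments of the zero set. Put \<open>\<rho> = R\<^sup>-\<^sup>\<eta>\<close> with a small \<open>\<eta> > 0\<close>. If the
  value and some first partial derivatives of the field at \<open>x\<close> are within \<open>c \<rho>\<close> of those of
  an affine map with zero at the centre of a cube with corner \<open>x\<close> and side \<open>\<rho>\<close>, and if the
  increments of the field over dyadic points of the cube are nearly linear, then Brouwer's theorem
  yields a zero in the cube. Dyadic chaining makes the increment condition fail with probability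
  \<open>O(\<rho>\<^sup>m)\<close> for every \<open>m\<close>, whereas the condition at \<open>x\<close> holds with probability at least a power of
  \<open>\<rho>\<close>, by non-degeneracy. As the envelope \<open>g\<^sub>\<omega>\<close> is square integrable, one can choose
  \<open>R\<^sup>a\<close> points of the dilated region with pairwise covariances at most \<open>R\<^sup>-\<^sup>2\<^sup>a\<close>. Gram-Schmidt
  at each point followed by the addition of a Gaussian noise far smaller than \<open>\<rho>\<close>, designed to
  cancel all remaining covariances, makes the conditions at these points independent, so
  that they all fail with probability at most \<open>exp (- R\<^sup>b)\<close> for some \<open>b > 0\<close>. The covariances
  of the derivatives are the derivatives of the covariance kernel, because pointwise limits of
  centered Gaussian variables are limits in \<open>L\<^sup>2\<close>.\<close>

section \<open>Centered normal variables\<close>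

text \<open>Small covariances between a number of points that itself grows as a power of the scale
  do not make the points independent; this is why noise is added. The scales are powers of T, where
  T^(6h) = R, \<open>h = card J + 3\<close> and rho = 1/T. One point succeeds with probability of
  order T^(-card J), so about T^h independent trials fail with probability at most exp(-const * T).
  The noise has variance O(T^(-h)), below the squared tolerance of order T^(-2). The regions
  forbidden by points already chosen have total volume O(T^(5h)), which fits into R^d. Suprema of
  paths are not accessible: the hypotheses bound covariances and so control derivatives only in mean
  square. Hence chaining acts on increments, with thresholds (3/4)^l: summable over the levels, yet
  larger than the standard deviations 2^(-l) by a geometric factor, so that a high moment outweighs
  the growing number of dyadic points. Both cases share one argument with a set \<open>J\<close> of
  jet indices. For a gradient the Jacobian is symmetric, so the full jet is degenerate and
  \<open>J\<close> keeps one entry from each pair of equal ones.\<close>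

lemma char_distr:
  assumes "Y \<in> borel_measurable M"
  shows "char (distr M borel Y) t = (CLINT \<omega>|M. iexp (t * Y \<omega>))"
  unfolding char_def using assms by (subst integral_distr) auto

lemma normal_char:
  assumes M: "prob_space M" and \<sigma>: "0 < \<sigma>"
    and D: "distributed M lborel Y (\<lambda>t. ennreal (normal_density 0 \<sigma> t))"
  shows "(CLINT \<omega>|M. iexp (t * Y \<omega>)) = exp (- (\<sigma>\<^sup>2 * t\<^sup>2 / 2))"
proof -
  interpret prob_space M by fact
  have "distributed M lborel (\<lambda>x. (Y x - 0) / \<sigma>) std_normal_density"
    using normal_standard_normal_convert[OF \<sigma>] D by blast
  then have d: "distr M lborel (\<lambda>x. Y x / \<sigma>) = density lborel std_normal_density"
    by (simp add: distributed_def)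
  have Y[measurable]: "Y \<in> borel_measurable M" using D by (simp add: distributed_def)
  have "distr M borel (\<lambda>x. Y x / \<sigma>) = distr M lborel (\<lambda>x. Y x / \<sigma>)"
    by (rule distr_cong) auto
  with d have e: "distr M borel (\<lambda>x. Y x / \<sigma>) = std_normal_distribution" by simp
  have "(CLINT \<omega>|M. iexp (t * Y \<omega>)) = (CLINT \<omega>|M. iexp ((t * \<sigma>) * (Y \<omega> / \<sigma>)))"
    using \<sigma> by simp
  also have "\<dots> = char (distr M borel (\<lambda>x. Y x / \<sigma>)) (t * \<sigma>)"
    by (rule char_distr[symmetric]) measurable
  also have "\<dots> = exp (- (\<sigma>\<^sup>2 * t\<^sup>2 / 2))"
    unfolding e char_std_normal_distribution by (simp add: power_mult_distrib mult.commute)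
  finally show ?thesis .
qed

lemma normal_moment:
  assumes M: "prob_space M" and \<sigma>: "0 < \<sigma>"
    and D: "distributed M lborel Y (\<lambda>t. ennreal (normal_density 0 \<sigma> t))"
  shows "integrable M (\<lambda>\<omega>. Y \<omega> ^ k)" "(\<integral>\<omega>. Y \<omega> \<partial>M) = 0"
    "(\<integral>\<omega>. Y \<omega> ^ (2 * m) \<partial>M) = fact (2 * m) / (2 ^ m * fact m) * (\<sigma>\<^sup>2) ^ m"
proof -
  interpret prob_space M by fact
  have D': "distributed M lborel Y (\<lambda>t. ennreal (normal_density 0 \<sigma> t))" by fact
  have "integrable lborel (\<lambda>x. normal_density 0 \<sigma> x * x ^ k)"
    using integrable_normal_moment[OF \<sigma>, of 0 k] by simp
  then show "integrable M (\<lambda>\<omega>. Y \<omega> ^ k)"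
    using distributed_integrable[OF D', of "\<lambda>x. x ^ k"] by simp
  show "(\<integral>\<omega>. Y \<omega> \<partial>M) = 0"
    using distributed_integral[OF D', of "\<lambda>x. x"] integral_normal_moment_odd[OF \<sigma>, of 0 0] by simp
  show "(\<integral>\<omega>. Y \<omega> ^ (2 * m) \<partial>M) = fact (2 * m) / (2 ^ m * fact m) * (\<sigma>\<^sup>2) ^ m"
    using distributed_integral[OF D', of "\<lambda>x. x ^ (2 * m)"] integral_normal_moment_even[OF \<sigma>, of 0 m] \<sigma>
    by (simp add: field_simps)
qed

text \<open>Everything is expressed through the variance instead of a parameter sigma, so that the
  zero variable, which counts as normal, obeys the same formulas.\<close>

lemma
  assumes M: "prob_space M" and Y: "centered_normal M Y"
  shows centered_normal_integrable_power: "integrable M (\<lambda>\<omega>. Y \<omega> ^ k)"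
    and centered_normal_mean: "(\<integral>\<omega>. Y \<omega> \<partial>M) = 0"
    and centered_normal_moment_even:
      "(\<integral>\<omega>. Y \<omega> ^ (2 * m) \<partial>M) = fact (2 * m) / (2 ^ m * fact m) * (\<integral>\<omega>. (Y \<omega>)\<^sup>2 \<partial>M) ^ m"
    and centered_normal_char:
      "(CLINT \<omega>|M. iexp (t * Y \<omega>)) = exp (- ((\<integral>\<omega>. (Y \<omega>)\<^sup>2 \<partial>M) * t\<^sup>2 / 2))"
proof -
  interpret prob_space M by fact
  have Ym[measurable]: "Y \<in> borel_measurable M" using Y by (simp add: centered_normal_def)
  consider (0) "AE \<omega> in M. Y \<omega> = 0" |
    (N) \<sigma> where "\<sigma> > 0" "distributed M lborel Y (\<lambda>t. ennreal (normal_density 0 \<sigma> t))"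
    using Y by (auto simp: centered_normal_def)
  then have "integrable M (\<lambda>\<omega>. Y \<omega> ^ k) \<and> (\<integral>\<omega>. Y \<omega> \<partial>M) = 0
    \<and> (\<integral>\<omega>. Y \<omega> ^ (2 * m) \<partial>M) = fact (2 * m) / (2 ^ m * fact m) * (\<integral>\<omega>. (Y \<omega>)\<^sup>2 \<partial>M) ^ m
    \<and> (CLINT \<omega>|M. iexp (t * Y \<omega>)) = exp (- ((\<integral>\<omega>. (Y \<omega>)\<^sup>2 \<partial>M) * t\<^sup>2 / 2))"
  proof cases
    case 0
    have c: "(\<integral>\<omega>. Y \<omega> ^ j \<partial>M) = (\<integral>\<omega>. 0 ^ j \<partial>M)" for j :: nat
      by (rule integral_cong_AE) (use 0 in auto)
    have i: "integrable M (\<lambda>\<omega>. Y \<omega> ^ k) = integrable M (\<lambda>\<omega>. 0 ^ k :: real)"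
      by (rule integrable_cong_AE) (use 0 in auto)
    have e: "(CLINT \<omega>|M. iexp (t * Y \<omega>)) = (CLINT \<omega>|M. 1)"
      by (rule integral_cong_AE) (use 0 in auto)
    show ?thesis
      using c[of 1] c[of 2] c[of "2 * m"] i e by (cases m) (auto simp: prob_space)
  next
    case N
    have s: "(\<integral>\<omega>. (Y \<omega>)\<^sup>2 \<partial>M) = \<sigma>\<^sup>2"
      using normal_moment(3)[OF M N, of 1] by (simp add: fact_numeral)
    show ?thesis
      unfolding s using normal_moment[OF M N] normal_char[OF M N] by blast
  qed
  then show "integrable M (\<lambda>\<omega>. Y \<omega> ^ k)" "(\<integral>\<omega>. Y \<omega> \<partial>M) = 0"
    "(\<integral>\<omega>. Y \<omega> ^ (2 * m) \<partial>M) = fact (2 * m) / (2 ^ m * fact m) * (\<integral>\<omega>. (Y \<omega>)\<^sup>2 \<partial>M) ^ m"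
    "(CLINT \<omega>|M. iexp (t * Y \<omega>)) = exp (- ((\<integral>\<omega>. (Y \<omega>)\<^sup>2 \<partial>M) * t\<^sup>2 / 2))"
    by blast+
qed

text \<open>By Levy uniqueness a Gaussian characteristic function determines the law. For v = 0 the
  law is the Dirac mass at 0; otherwise the variable is rescaled to a standard normal one.\<close>

lemma centered_normalI_char:
  assumes M: "prob_space M" and Y[measurable]: "Y \<in> borel_measurable M"
    and v: "0 \<le> v" and ch: "\<And>t. (CLINT \<omega>|M. iexp (t * Y \<omega>)) = exp (- (v * t\<^sup>2 / 2))"
  shows "centered_normal M Y"
proof -
  interpret prob_space M by fact
  show ?thesis
  proof (cases "v = 0")
    case True
    have d0: "distr M borel Y = return borel 0"
    proof (rule Levy_uniqueness)
      show "real_distribution (distr M borel Y)" by (rule real_distribution_distr) fact+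
      show "real_distribution (return borel 0)"
        by (intro real_distribution.intro prob_space_return) (auto simp: real_distribution_axioms_def)
      show "char (distr M borel Y) = char (return borel 0)"
        unfolding fun_eq_iff char_distr[OF Y] ch using True by (simp add: char_def integral_return)
    qed
    have "AE x in distr M borel Y. x = 0" unfolding d0 by (subst AE_return) auto
    then have "AE \<omega> in M. Y \<omega> = 0" by (rule AE_distrD[OF Y])
    then show ?thesis by (simp add: centered_normal_def)
  next
    case False
    define \<sigma> where "\<sigma> = sqrt v"
    have \<sigma>: "\<sigma> > 0" "\<sigma>\<^sup>2 = v" using v False by (auto simp: \<sigma>_def)
    have "distr M borel (\<lambda>x. Y x / \<sigma>) = std_normal_distribution"
    proof (rule Levy_uniqueness)
      show "real_distribution (distr M borel (\<lambda>x. Y x / \<sigma>))"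
        by (rule real_distribution_distr) measurable
      show "real_distribution std_normal_distribution" by (rule real_dist_normal_dist)
      show "char (distr M borel (\<lambda>x. Y x / \<sigma>)) = char std_normal_distribution"
      proof
        fix t
        have "char (distr M borel (\<lambda>x. Y x / \<sigma>)) t = (CLINT \<omega>|M. iexp ((t / \<sigma>) * Y \<omega>))"
          by (subst char_distr) auto
        also have "\<dots> = char std_normal_distribution t"
          unfolding ch char_std_normal_distribution using \<sigma> False
          by (simp add: power_divide)
        finally show "char (distr M borel (\<lambda>x. Y x / \<sigma>)) t = char std_normal_distribution t" .
      qed
    qed
    moreover have "distr M borel (\<lambda>x. Y x / \<sigma>) = distr M lborel (\<lambda>x. Y x / \<sigma>)"
      by (rule distr_cong) auto
    ultimately have "distributed M lborel (\<lambda>x. (Y x - 0) / \<sigma>) std_normal_density"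
      by (simp add: distributed_def)
    then have "distributed M lborel Y (\<lambda>t. ennreal (normal_density 0 \<sigma> t))"
      using normal_standard_normal_convert[OF \<sigma>(1), of Y 0] by blast
    then show ?thesis using \<sigma>(1) by (auto simp: centered_normal_def)
  qed
qed

lemma centered_normal_measurable: "centered_normal M Y \<Longrightarrow> Y \<in> borel_measurable M"
  by (simp add: centered_normal_def)

lemma centered_normal_integrable_mult:
  assumes M: "prob_space M" and Y: "centered_normal M Y" and Z: "centered_normal M Z"
  shows "integrable M (\<lambda>\<omega>. Y \<omega> * Z \<omega>)"
proof (rule Bochner_Integration.integrable_bound)
  note [measurable] = centered_normal_measurable[OF Y] centered_normal_measurable[OF Z]
  show "integrable M (\<lambda>\<omega>. (Y \<omega>)\<^sup>2 + (Z \<omega>)\<^sup>2)"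
    using centered_normal_integrable_power[OF M Y, of 2] centered_normal_integrable_power[OF M Z, of 2]
    by simp
  show "(\<lambda>\<omega>. Y \<omega> * Z \<omega>) \<in> borel_measurable M" by measurable
  have "\<bar>a * b\<bar> \<le> a\<^sup>2 + b\<^sup>2" for a b :: real
    using sum_squares_bound[of a b] sum_squares_bound[of "-a" b]
      zero_le_power2[of a] zero_le_power2[of b] unfolding abs_le_iff by (auto; linarith)
  then show "AE \<omega> in M. norm (Y \<omega> * Z \<omega>) \<le> norm ((Y \<omega>)\<^sup>2 + (Z \<omega>)\<^sup>2)" by simp
qed

text \<open>The 2m-th moment of a standard normal variable, that is (2m-1)!!.\<close>

definition normal_tail_const :: "nat \<Rightarrow> real" where
  "normal_tail_const m = fact (2 * m) / (2 ^ m * fact m)"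

lemma normal_tail_const_pos: "0 < normal_tail_const m"
  by (simp add: normal_tail_const_def)

text \<open>Markov's inequality for the power 2m. A polynomial tail suffices because
  \<open>m\<close> can be chosen after the power of R that is to be beaten.\<close>

lemma centered_normal_tail:
  assumes M: "prob_space M" and Y: "centered_normal M Y" and t: "0 < t"
    and v: "(\<integral>\<omega>. (Y \<omega>)\<^sup>2 \<partial>M) \<le> v"
  shows "measure M {\<omega> \<in> space M. t \<le> \<bar>Y \<omega>\<bar>} \<le> normal_tail_const m * (v / t\<^sup>2) ^ m"
proof -
  interpret prob_space M by fact
  note [measurable] = centered_normal_measurable[OF Y]
  have "measure M {\<omega> \<in> space M. t \<le> \<bar>Y \<omega>\<bar>} \<le> measure M {\<omega> \<in> space M. t ^ (2 * m) \<le> Y \<omega> ^ (2 * m)}"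
  proof (rule finite_measure_mono)
    show "{\<omega> \<in> space M. t \<le> \<bar>Y \<omega>\<bar>} \<subseteq> {\<omega> \<in> space M. t ^ (2 * m) \<le> Y \<omega> ^ (2 * m)}"
    proof clarify
      fix \<omega> assume "t \<le> \<bar>Y \<omega>\<bar>"
      then have "t ^ (2 * m) \<le> \<bar>Y \<omega>\<bar> ^ (2 * m)" using t by (intro power_mono) auto
      then show "t ^ (2 * m) \<le> Y \<omega> ^ (2 * m)" by (simp add: power_even_abs)
    qed
  qed measurable
  also have "\<dots> \<le> (\<integral>\<omega>. Y \<omega> ^ (2 * m) \<partial>M) / t ^ (2 * m)"
    by (rule integral_Markov_inequality_measure[where A="{}"])
      (use t centered_normal_integrable_power[OF M Y] in \<open>auto intro!: AE_I2 zero_le_even_power\<close>)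
  also have "\<dots> = normal_tail_const m * ((\<integral>\<omega>. (Y \<omega>)\<^sup>2 \<partial>M) / t\<^sup>2) ^ m"
    unfolding centered_normal_moment_even[OF M Y] normal_tail_const_def
    by (simp add: power_divide power_mult)
  also have "\<dots> \<le> normal_tail_const m * (v / t\<^sup>2) ^ m"
    by (intro mult_left_mono power_mono divide_right_mono v less_imp_le[OF normal_tail_const_pos])
      (use t in \<open>auto intro!: divide_nonneg_pos\<close>)
  finally show ?thesis .
qed

text \<open>The variance range [1, 2] is that of a standardised variable with an independent noise
  of variance at most 1 added.\<close>

lemma centered_normal_window:
  assumes M: "prob_space M" and Y: "centered_normal M Y"
    and v: "1 \<le> (\<integral>\<omega>. (Y \<omega>)\<^sup>2 \<partial>M)" "(\<integral>\<omega>. (Y \<omega>)\<^sup>2 \<partial>M) \<le> 2"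
    and q: "\<bar>q\<bar> \<le> K" and e: "0 < \<epsilon>" "\<epsilon> \<le> 1"
  shows "\<epsilon> * exp (- ((K + 1)\<^sup>2)) / 4 \<le> measure M {\<omega> \<in> space M. \<bar>Y \<omega> - q\<bar> \<le> \<epsilon>}"
proof -
  interpret prob_space M by fact
  note [measurable] = centered_normal_measurable[OF Y]
  have "\<not> (AE \<omega> in M. Y \<omega> = 0)"
  proof
    assume "AE \<omega> in M. Y \<omega> = 0"
    then have "(\<integral>\<omega>. (Y \<omega>)\<^sup>2 \<partial>M) = (\<integral>\<omega>. 0 \<partial>M)" by (intro integral_cong_AE) auto
    with v show False by simp
  qed
  then obtain \<sigma> where \<sigma>: "\<sigma> > 0" and D: "distributed M lborel Y (\<lambda>t. ennreal (normal_density 0 \<sigma> t))"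
    using Y by (auto simp: centered_normal_def)
  have s: "(\<integral>\<omega>. (Y \<omega>)\<^sup>2 \<partial>M) = \<sigma>\<^sup>2"
    using normal_moment(3)[OF M \<sigma> D, of 1] by (simp add: fact_numeral)
  \<comment> \<open>\<open>2 * c\<close> bounds the density from below on the window: there |x| is
    at most K + 1, and the variance bounds give sqrt (2 pi sigma^2) at most 4 and an exponent at
    least -(K + 1)^2.\<close>
  define c where "c = exp (- ((K + 1)\<^sup>2)) / 8"
  have lb: "2 * c \<le> normal_density 0 \<sigma> x" if x: "x \<in> {q - \<epsilon>..q + \<epsilon>}" for x
  proof -
    have "\<bar>x\<bar> \<le> K + 1" using x q e by auto
    then have "x\<^sup>2 \<le> (K + 1)\<^sup>2" by (metis abs_ge_zero power2_abs power_mono)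
    then have "x\<^sup>2 / (2 * \<sigma>\<^sup>2) \<le> (K + 1)\<^sup>2 / 1"
      using v s by (intro frac_le) auto
    then have 1: "exp (- ((K + 1)\<^sup>2)) \<le> exp (- x\<^sup>2 / (2 * \<sigma>\<^sup>2))" by simp
    have "sqrt (2 * pi * \<sigma>\<^sup>2) \<le> sqrt (4\<^sup>2)"
    proof (rule real_sqrt_le_mono)
      have "pi * \<sigma>\<^sup>2 \<le> 4 * 2" using v s pi_less_4 by (intro mult_mono) auto
      then show "2 * pi * \<sigma>\<^sup>2 \<le> 4\<^sup>2" by simp
    qed
    then have 2: "1 / 4 \<le> 1 / sqrt (2 * pi * \<sigma>\<^sup>2)" using \<sigma> by (intro frac_le) auto
    have "1 / 4 * exp (- ((K + 1)\<^sup>2)) \<le> 1 / sqrt (2 * pi * \<sigma>\<^sup>2) * exp (- x\<^sup>2 / (2 * \<sigma>\<^sup>2))"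
      by (rule mult_mono[OF 2 1]) auto
    then show ?thesis by (simp add: c_def normal_density_def)
  qed
  have "ennreal (2 * c * (2 * \<epsilon>)) = (\<integral>\<^sup>+x. ennreal (2 * c) * indicator {q - \<epsilon>..q + \<epsilon>} x \<partial>lborel)"
    using e by (simp add: nn_integral_cmult_indicator c_def ennreal_mult[symmetric])
  also have "\<dots> \<le> (\<integral>\<^sup>+x. ennreal (normal_density 0 \<sigma> x) * indicator {q - \<epsilon>..q + \<epsilon>} x \<partial>lborel)"
    by (intro nn_integral_mono) (auto intro!: ennreal_leI lb split: split_indicator)
  also have "\<dots> = emeasure M (Y -` {q - \<epsilon>..q + \<epsilon>} \<inter> space M)"
    using distributed_emeasure[OF D, of "{q - \<epsilon>..q + \<epsilon>}"] by simp
  also have "Y -` {q - \<epsilon>..q + \<epsilon>} \<inter> space M = {\<omega> \<in> space M. \<bar>Y \<omega> - q\<bar> \<le> \<epsilon>}" by auto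
  finally have "2 * c * (2 * \<epsilon>) \<le> measure M {\<omega> \<in> space M. \<bar>Y \<omega> - q\<bar> \<le> \<epsilon>}"
    using e by (simp add: emeasure_eq_measure c_def)
  moreover have "\<epsilon> * exp (- ((K + 1)\<^sup>2)) / 4 \<le> 2 * c * (2 * \<epsilon>)" 
  proof -
    have "2 * c * (2 * \<epsilon>) = \<epsilon> * exp (- ((K + 1)\<^sup>2)) / 4 + \<epsilon> * exp (- ((K + 1)\<^sup>2)) / 4" by (simp add: c_def)
    moreover have "0 \<le> \<epsilon> * exp (- ((K + 1)\<^sup>2)) / 4" using e by simp
    ultimately show ?thesis by linarith
  qed
  ultimately show ?thesis by linarith
qed

text \<open>The characteristic functions converge by dominated convergence, and the variances are
  recovered from them by a logarithm at one suitable point. Pointwise convergence of Gaussian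
  variables therefore already implies convergence of second moments.\<close>

lemma centered_normal_limit:
  assumes M: "prob_space M" and X: "\<And>n. centered_normal M (X n)"
    and lim: "\<And>\<omega>. \<omega> \<in> space M \<Longrightarrow> (\<lambda>n. X n \<omega>) \<longlonglongrightarrow> Y \<omega>"
  shows "centered_normal M Y" "(\<lambda>n. \<integral>\<omega>. (X n \<omega>)\<^sup>2 \<partial>M) \<longlonglongrightarrow> (\<integral>\<omega>. (Y \<omega>)\<^sup>2 \<partial>M)"
proof -
  interpret prob_space M by fact
  note [measurable] = centered_normal_measurable[OF X]
  have Y[measurable]: "Y \<in> borel_measurable M"
    by (rule borel_measurable_LIMSEQ_real[OF lim]) auto
  interpret D: real_distribution "distr M borel Y" by (rule real_distribution_distr) fact+
  define v where "v n = (\<integral>\<omega>. (X n \<omega>)\<^sup>2 \<partial>M)" for n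
  define \<phi> where "\<phi> t = (CLINT \<omega>|M. iexp (t * Y \<omega>))" for t
  have v0: "0 \<le> v n" for n by (simp add: v_def)
  have conv: "(\<lambda>n. complex_of_real (exp (- (v n * t\<^sup>2 / 2)))) \<longlonglongrightarrow> \<phi> t" for t
  proof -
    have "(\<lambda>n. CLINT \<omega>|M. iexp (t * X n \<omega>)) \<longlonglongrightarrow> \<phi> t"
      unfolding \<phi>_def
      by (rule integral_dominated_convergence[where w="\<lambda>_. 1"])
        (auto intro!: AE_I2 tendsto_intros lim)
    then show ?thesis unfolding centered_normal_char[OF M X] v_def .
  qed
  \<comment> \<open>Continuity at 0 of the limiting characteristic function yields a point s > 0
    where it does not vanish. This excludes variances escaping to infinity and makes the logarithm
    legitimate.\<close>
  have "isCont (char (distr M borel Y)) 0" by (rule D.isCont_char)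
  then have "\<forall>\<^sub>F t in at 0. dist (char (distr M borel Y) t) (char (distr M borel Y) 0) < 1"
    by (intro tendstoD) (auto simp: isCont_def)
  then obtain d where d: "d > 0" "\<And>t. t \<noteq> 0 \<Longrightarrow> dist t 0 < d \<Longrightarrow> dist (char (distr M borel Y) t) (char (distr M borel Y) 0) < 1"
    by (auto simp: eventually_at)
  define s where "s = d / 2"
  have s: "s > 0" and "dist (\<phi> s) 1 < 1"
    using d(1) d(2)[of s] by (auto simp: s_def \<phi>_def char_distr D.char_zero)
  then have nz: "\<phi> s \<noteq> 0" by auto
  have cr: "(\<lambda>n. exp (- (v n * t\<^sup>2 / 2))) \<longlonglongrightarrow> Re (\<phi> t)" for t
    using tendsto_Re[OF conv[of t]] by simp
  have im: "Im (\<phi> t) = 0" for t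
    using tendsto_Im[OF conv[of t]] by (simp add: LIMSEQ_const_iff)
  have "Re (\<phi> s) \<noteq> 0" using nz im[of s] by (simp add: complex_eq_iff)
  moreover have "Re (\<phi> s) \<ge> 0" by (rule LIMSEQ_le_const[OF cr]) auto
  ultimately have pos: "Re (\<phi> s) > 0" by simp
  have "(\<lambda>n. ln (exp (- (v n * s\<^sup>2 / 2)))) \<longlonglongrightarrow> ln (Re (\<phi> s))"
    by (rule tendsto_ln[OF cr]) (use pos in auto)
  then have "(\<lambda>n. (- (2 / s\<^sup>2)) * ln (exp (- (v n * s\<^sup>2 / 2)))) \<longlonglongrightarrow> (- (2 / s\<^sup>2)) * ln (Re (\<phi> s))"
    by (rule tendsto_mult_left)
  moreover have "(- (2 / s\<^sup>2)) * ln (exp (- (v n * s\<^sup>2 / 2))) = v n" for n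
    using s by (simp add: field_simps)
  ultimately obtain w where vl: "v \<longlonglongrightarrow> w" by auto
  have w0: "0 \<le> w" by (rule LIMSEQ_le_const[OF vl]) (use v0 in auto)
  have ch: "\<phi> t = exp (- (w * t\<^sup>2 / 2))" for t
  proof (rule LIMSEQ_unique[OF conv])
    show "(\<lambda>n. complex_of_real (exp (- (v n * t\<^sup>2 / 2)))) \<longlonglongrightarrow> complex_of_real (exp (- (w * t\<^sup>2 / 2)))"
      by (rule tendsto_of_real[OF tendsto_exp[OF tendsto_minus[OF tendsto_divide[OF
        tendsto_mult[OF vl tendsto_const] tendsto_const]]]]) simp
  qed
  show Yn: "centered_normal M Y"
    by (rule centered_normalI_char[OF M Y w0]) (rule ch[unfolded \<phi>_def])
  have "complex_of_real (exp (- ((\<integral>\<omega>. (Y \<omega>)\<^sup>2 \<partial>M) * 1\<^sup>2 / 2))) = complex_of_real (exp (- (w * 1\<^sup>2 / 2)))"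
    by (rule trans[OF sym[OF centered_normal_char[OF M Yn]] ch[unfolded \<phi>_def]])
  then have "(\<integral>\<omega>. (Y \<omega>)\<^sup>2 \<partial>M) = w" unfolding of_real_eq_iff by simp
  with vl show "(\<lambda>n. \<integral>\<omega>. (X n \<omega>)\<^sup>2 \<partial>M) \<longlonglongrightarrow> (\<integral>\<omega>. (Y \<omega>)\<^sup>2 \<partial>M)" by (simp add: v_def[abs_def])
qed

section \<open>Independence from characteristic functions\<close>

text \<open>Divided by its mean, \<open>u\<close> is a probability density. The hypothesis says that
  \<open>X\<close> has the same characteristic function under the tilted measure, hence the same law
  by Levy uniqueness.\<close>

lemma integral_indicator_eq_if_char_factorizes_pos:
  fixes u :: "'w \<Rightarrow> real"
  assumes M: "prob_space M" and X[measurable]: "X \<in> borel_measurable M"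
    and u[measurable]: "u \<in> borel_measurable M" and b: "\<And>\<omega>. 1 \<le> u \<omega>" "\<And>\<omega>. u \<omega> \<le> c"
    and ch: "\<And>t. (CLINT \<omega>|M. u \<omega> * iexp (t * X \<omega>)) = (\<integral>\<omega>. u \<omega> \<partial>M) * (CLINT \<omega>|M. iexp (t * X \<omega>))"
    and B[measurable]: "B \<in> sets borel"
  shows "(\<integral>\<omega>. u \<omega> * indicator B (X \<omega>) \<partial>M) = (\<integral>\<omega>. u \<omega> \<partial>M) * measure M (X -` B \<inter> space M)"
proof -
  interpret prob_space M by fact
  have iu: "integrable M u"
  proof (rule integrable_const_bound[where B=c])
    show "AE \<omega> in M. norm (u \<omega>) \<le> c"
      using b by (auto intro!: AE_I2 simp: abs_le_iff) (smt (verit) b)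
  qed simp
  define m where "m = (\<integral>\<omega>. u \<omega> \<partial>M)"
  have "(\<integral>\<omega>. 1 \<partial>M) \<le> m" unfolding m_def by (rule integral_mono) (use iu b in auto)
  then have m: "m > 0" by (simp add: prob_space)
  have unn: "0 \<le> u \<omega>" for \<omega> using b(1)[of \<omega>] by linarith
  define N where "N = density M (\<lambda>\<omega>. ennreal (u \<omega> / m))"
  have N: "prob_space N"
  proof
    have "emeasure N (space N) = (\<integral>\<^sup>+\<omega>. ennreal (u \<omega> / m) \<partial>M)"
      by (simp add: N_def emeasure_density cong: nn_integral_cong)
    also have "\<dots> = ennreal (\<integral>\<omega>. u \<omega> / m \<partial>M)"
      using iu m unn by (intro nn_integral_eq_integral) auto
    also have "\<dots> = 1" using m by (simp add: m_def)
    finally show "emeasure N (space N) = 1" .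
  qed
  interpret N: prob_space N by fact
  have XN[measurable]: "X \<in> borel_measurable N" by (simp add: N_def)
  have eq: "distr N borel X = distr M borel X"
  proof (rule Levy_uniqueness)
    show "char (distr N borel X) = char (distr M borel X)"
    proof
      fix t
      have "char (distr N borel X) t = (CLINT \<omega>|M. (u \<omega> / m) *\<^sub>R iexp (t * X \<omega>))"
        
        unfolding char_distr[OF XN] unfolding N_def using m unn by (subst integral_density) auto
      also have "\<dots> = (CLINT \<omega>|M. (1 / m) * (u \<omega> * iexp (t * X \<omega>)))"
        by (simp add: scaleR_conv_of_real)
      also have "\<dots> = (1 / m) * (CLINT \<omega>|M. u \<omega> * iexp (t * X \<omega>))"
        by (rule integral_mult_right_zero)
      also have "\<dots> = char (distr M borel X) t"
        unfolding ch char_distr[OF X] using m by (simp add: m_def[symmetric])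
      finally show "char (distr N borel X) t = char (distr M borel X) t" .
    qed
  qed (auto intro!: real_distribution_distr N.real_distribution_distr)
  have "measure M (X -` B \<inter> space M) = measure (distr N borel X) B"
    unfolding eq by (simp add: measure_distr)
  also have "\<dots> = (\<integral>x. indicator B x \<partial>distr N borel X)" by simp
  also have "\<dots> = (\<integral>\<omega>. indicator B (X \<omega>) \<partial>N)" by (rule integral_distr) auto
  also have "\<dots> = (\<integral>\<omega>. (u \<omega> / m) *\<^sub>R indicator B (X \<omega>) \<partial>M)"
    unfolding N_def using m unn by (subst integral_density) auto
  also have "\<dots> = (\<integral>\<omega>. u \<omega> * indicator B (X \<omega>) \<partial>M) / m" by simp
  finally show ?thesis using m by (simp add: m_def field_simps)
qed

text \<open>Adding the constant c + 1 makes the weight at least 1, and both sides of the claim are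
  affine in the weight.\<close>

lemma integral_indicator_eq_if_char_factorizes_real:
  fixes u :: "'w \<Rightarrow> real"
  assumes M: "prob_space M" and X[measurable]: "X \<in> borel_measurable M"
    and u[measurable]: "u \<in> borel_measurable M" and b: "\<And>\<omega>. \<bar>u \<omega>\<bar> \<le> c"
    and ch: "\<And>t. (CLINT \<omega>|M. u \<omega> * iexp (t * X \<omega>)) = (\<integral>\<omega>. u \<omega> \<partial>M) * (CLINT \<omega>|M. iexp (t * X \<omega>))"
    and B[measurable]: "B \<in> sets borel"
  shows "(\<integral>\<omega>. u \<omega> * indicator B (X \<omega>) \<partial>M) = (\<integral>\<omega>. u \<omega> \<partial>M) * measure M (X -` B \<inter> space M)"
proof -
  interpret prob_space M by fact
  have iu: "integrable M u"
    by (rule integrable_const_bound[where B=c]) (auto intro!: AE_I2 b)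
  have ie: "integrable M (\<lambda>\<omega>. u \<omega> * iexp (t * X \<omega>))" for t
    by (rule integrable_const_bound[where B=c]) (auto intro!: AE_I2 b simp: norm_mult)
  have ie': "integrable M (\<lambda>\<omega>. iexp (t * X \<omega>))" for t
    by (rule integrable_const_bound[where B=1]) (auto intro!: AE_I2)
  have ii: "integrable M (\<lambda>\<omega>. u \<omega> * indicator B (X \<omega>))"
    by (rule integrable_const_bound[where B=c])
      (auto intro!: AE_I2 b simp: abs_mult split: split_indicator, meson b abs_ge_zero order_trans)
  have iX: "(\<integral>\<omega>. indicator B (X \<omega>) \<partial>M) = measure M (X -` B \<inter> space M)"
  proof -
    have "(\<integral>\<omega>. indicator B (X \<omega>) \<partial>M) = (\<integral>\<omega>. indicator (X -` B \<inter> space M) \<omega> \<partial>M)"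
      by (rule Bochner_Integration.integral_cong) (auto split: split_indicator)
    also have "\<dots> = measure M (X -` B \<inter> space M)" by simp
    finally show ?thesis .
  qed
  have ib: "integrable M (\<lambda>\<omega>. indicator B (X \<omega>) :: real)"
    by (rule integrable_const_bound[where B=1]) (auto intro!: AE_I2 split: split_indicator)
  define k where "k = c + 1"
  have "(\<integral>\<omega>. (u \<omega> + k) * indicator B (X \<omega>) \<partial>M) = (\<integral>\<omega>. u \<omega> + k \<partial>M) * measure M (X -` B \<inter> space M)"
  proof (rule integral_indicator_eq_if_char_factorizes_pos[OF M X])
    show "1 \<le> u \<omega> + k" "u \<omega> + k \<le> c + k" for \<omega>
      using b[of \<omega>] by (auto simp: k_def)
    fix t
    have "(CLINT \<omega>|M. (u \<omega> + k) * iexp (t * X \<omega>)) = (CLINT \<omega>|M. u \<omega> * iexp (t * X \<omega>) + k * iexp (t * X \<omega>))"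
      by (simp add: distrib_right)
    also have "\<dots> = (CLINT \<omega>|M. u \<omega> * iexp (t * X \<omega>)) + (CLINT \<omega>|M. k * iexp (t * X \<omega>))"
      by (rule Bochner_Integration.integral_add[OF ie integrable_mult_right[OF ie']])
    also have "\<dots> = ((\<integral>\<omega>. u \<omega> \<partial>M) + k) * (CLINT \<omega>|M. iexp (t * X \<omega>))"
      unfolding ch integral_mult_right_zero by (simp only: distrib_right of_real_add)
    also have "(\<integral>\<omega>. u \<omega> \<partial>M) + k = (\<integral>\<omega>. u \<omega> + k \<partial>M)" using iu by (simp add: prob_space)
    finally show "(CLINT \<omega>|M. (u \<omega> + k) * iexp (t * X \<omega>)) = (\<integral>\<omega>. u \<omega> + k \<partial>M) * (CLINT \<omega>|M. iexp (t * X \<omega>))" .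
  qed auto
  moreover have "(\<integral>\<omega>. (u \<omega> + k) * indicator B (X \<omega>) \<partial>M) = (\<integral>\<omega>. u \<omega> * indicator B (X \<omega>) \<partial>M) + k * measure M (X -` B \<inter> space M)"
    using ii ib by (simp add: distrib_right iX)
  moreover have "(\<integral>\<omega>. u \<omega> + k \<partial>M) = (\<integral>\<omega>. u \<omega> \<partial>M) + k" using iu by (simp add: prob_space)
  ultimately show ?thesis by (simp add: distrib_right)
qed

text \<open>The real part of the weight inherits the factorization as half the sum of the weight and
  its conjugate; the imaginary part is the real part after multiplication by minus the imaginary
  unit.\<close>

lemma integral_indicator_eq_if_char_factorizes:
  fixes w :: "'w \<Rightarrow> complex"
  assumes M: "prob_space M" and X[measurable]: "X \<in> borel_measurable M"
    and w[measurable]: "w \<in> borel_measurable M" and b: "\<And>\<omega>. norm (w \<omega>) \<le> c"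
    and ch: "\<And>t. (CLINT \<omega>|M. w \<omega> * iexp (t * X \<omega>)) = (CLINT \<omega>|M. w \<omega>) * (CLINT \<omega>|M. iexp (t * X \<omega>))"
    and B[measurable]: "B \<in> sets borel"
  shows "(CLINT \<omega>|M. w \<omega> * indicator B (X \<omega>)) = (CLINT \<omega>|M. w \<omega>) * measure M (X -` B \<inter> space M)"
proof -
  interpret prob_space M by fact
  have main: "Re (CLINT \<omega>|M. v \<omega> * indicator B (X \<omega>)) = Re (CLINT \<omega>|M. v \<omega>) * measure M (X -` B \<inter> space M)"
    if v[measurable]: "v \<in> borel_measurable M" and b: "\<And>\<omega>. norm (v \<omega>) \<le> c"
      and ch: "\<And>t. (CLINT \<omega>|M. v \<omega> * iexp (t * X \<omega>)) = (CLINT \<omega>|M. v \<omega>) * (CLINT \<omega>|M. iexp (t * X \<omega>))"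
    for v
  proof -
    have iv: "integrable M v"
      by (rule integrable_const_bound[where B=c]) (auto intro!: AE_I2 b)
    have ie: "integrable M (\<lambda>\<omega>. v \<omega> * iexp (t * X \<omega>))" for t
      by (rule integrable_const_bound[where B=c]) (auto intro!: AE_I2 b simp: norm_mult)
    have ii: "integrable M (\<lambda>\<omega>. v \<omega> * indicator B (X \<omega>))"
      by (rule integrable_const_bound[where B=c])
        (auto intro!: AE_I2 b simp: norm_mult split: split_indicator, meson b norm_ge_zero order_trans)
    have "(\<integral>\<omega>. Re (v \<omega>) * indicator B (X \<omega>) \<partial>M) = (\<integral>\<omega>. Re (v \<omega>) \<partial>M) * measure M (X -` B \<inter> space M)"
    proof (rule integral_indicator_eq_if_char_factorizes_real[OF M X])
      show "\<bar>Re (v \<omega>)\<bar> \<le> c" for \<omega> using b[of \<omega>] abs_Re_le_cmod[of "v \<omega>"] by linarith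
      fix t
      \<comment> \<open>The conjugate weight factorizes because the hypothesis holds for every t:
        conjugation only replaces t by -t.\<close>
      have cc: "(CLINT \<omega>|M. cnj (v \<omega>) * iexp (t * X \<omega>)) = cnj (CLINT \<omega>|M. v \<omega>) * (CLINT \<omega>|M. iexp (t * X \<omega>))"
      proof -
        have "(CLINT \<omega>|M. cnj (v \<omega>) * iexp (t * X \<omega>)) = (CLINT \<omega>|M. cnj (v \<omega> * iexp (- t * X \<omega>)))"
          by (simp add: exp_cnj)
        also have "\<dots> = cnj (CLINT \<omega>|M. v \<omega> * iexp (- t * X \<omega>))" by (rule Bochner_Integration.integral_cnj)
        also have "\<dots> = cnj (CLINT \<omega>|M. v \<omega>) * cnj (CLINT \<omega>|M. iexp (- t * X \<omega>))"
          unfolding ch by simp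
        also have "cnj (CLINT \<omega>|M. iexp (- t * X \<omega>)) = (CLINT \<omega>|M. cnj (iexp (- t * X \<omega>)))"
          by (rule Bochner_Integration.integral_cnj[symmetric])
        also have "\<dots> = (CLINT \<omega>|M. iexp (t * X \<omega>))" by (simp add: exp_cnj)
        finally show ?thesis .
      qed
      have re: "complex_of_real (Re z) = (z + cnj z) / 2" for z by (simp add: complex_eq_iff)
      have "(CLINT \<omega>|M. Re (v \<omega>) * iexp (t * X \<omega>)) =
          (CLINT \<omega>|M. (v \<omega> * iexp (t * X \<omega>) + cnj (v \<omega>) * iexp (t * X \<omega>)) / 2)"
        by (simp only: re distrib_right[symmetric] times_divide_eq_left)
      also have "\<dots> = ((CLINT \<omega>|M. v \<omega> * iexp (t * X \<omega>)) + (CLINT \<omega>|M. cnj (v \<omega>) * iexp (t * X \<omega>))) / 2"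
      proof -
        have [measurable]: "(\<lambda>\<omega>. cnj (v \<omega>)) \<in> borel_measurable M"
          by (rule borel_measurable_continuous_on[OF continuous_on_cnj[OF continuous_on_id] v])
        have "integrable M (\<lambda>\<omega>. cnj (v \<omega>) * iexp (t * X \<omega>))"
          by (rule integrable_const_bound[where B=c]) (auto intro!: AE_I2 b simp: norm_mult)
        with ie show ?thesis unfolding integral_divide_zero
          by (subst Bochner_Integration.integral_add) auto
      qed
      also have "\<dots> = (((CLINT \<omega>|M. v \<omega>) + cnj (CLINT \<omega>|M. v \<omega>)) / 2) * (CLINT \<omega>|M. iexp (t * X \<omega>))"
        unfolding ch cc by (simp only: distrib_right times_divide_eq_left)
      also have "\<dots> = Re (CLINT \<omega>|M. v \<omega>) * (CLINT \<omega>|M. iexp (t * X \<omega>))" by (simp only: re)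
      also have "Re (CLINT \<omega>|M. v \<omega>) = (\<integral>\<omega>. Re (v \<omega>) \<partial>M)" using iv by simp
      finally show "(CLINT \<omega>|M. Re (v \<omega>) * iexp (t * X \<omega>)) =
        (\<integral>\<omega>. Re (v \<omega>) \<partial>M) * (CLINT \<omega>|M. iexp (t * X \<omega>))" .
    qed auto
    moreover have "(\<integral>\<omega>. Re (v \<omega>) * indicator B (X \<omega>) \<partial>M) = (\<integral>\<omega>. Re (v \<omega> * indicator B (X \<omega>)) \<partial>M)"
      by (rule arg_cong[where f="integral\<^sup>L M"]) (auto split: split_indicator)
    ultimately show ?thesis unfolding integral_Re[OF ii] integral_Re[OF iv] by simp
  qed
  have iw: "integrable M w"
    by (rule integrable_const_bound[where B=c]) (auto intro!: AE_I2 b)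
  have 1: "Re (CLINT \<omega>|M. w \<omega> * indicator B (X \<omega>)) = Re (CLINT \<omega>|M. w \<omega>) * measure M (X -` B \<inter> space M)"
    by (rule main[OF w b ch])
  have "Re (CLINT \<omega>|M. (- \<i> * w \<omega>) * indicator B (X \<omega>)) = Re (CLINT \<omega>|M. - \<i> * w \<omega>) * measure M (X -` B \<inter> space M)"
  proof (rule main)
    show "norm (- \<i> * w \<omega>) \<le> c" for \<omega> using b by (simp add: norm_mult)
    show "(CLINT \<omega>|M. (- \<i> * w \<omega>) * iexp (t * X \<omega>)) = (CLINT \<omega>|M. - \<i> * w \<omega>) * (CLINT \<omega>|M. iexp (t * X \<omega>))" for t
      unfolding mult.assoc integral_mult_right_zero ch by simp
  qed auto
  then have 2: "Im (CLINT \<omega>|M. w \<omega> * indicator B (X \<omega>)) = Im (CLINT \<omega>|M. w \<omega>) * measure M (X -` B \<inter> space M)"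
    unfolding mult.assoc integral_mult_right_zero by simp
  show ?thesis using 1 2 by (simp add: complex_eq_iff)
qed

text \<open>Exponentials are traded for indicators one variable at a time. Each trade uses only the
  one-dimensional uniqueness theorem, with the remaining factors as a complex weight.\<close>

lemma prob_box_eq_prod_if_char_factorizes:
  fixes X :: "'s \<Rightarrow> 'w \<Rightarrow> real"
  assumes M: "prob_space M" and S: "finite S" and X: "\<And>s. s \<in> S \<Longrightarrow> X s \<in> borel_measurable M"
    and ch: "\<And>t. (CLINT \<omega>|M. iexp (\<Sum>s\<in>S. t s * X s \<omega>)) = (\<Prod>s\<in>S. CLINT \<omega>|M. iexp (t s * X s \<omega>))"
    and B: "\<And>s. s \<in> S \<Longrightarrow> B s \<in> sets borel" and S1: "S1 \<subseteq> S"
  shows "measure M {\<omega> \<in> space M. \<forall>s\<in>S1. X s \<omega> \<in> B s} = (\<Prod>s\<in>S1. measure M (X s -` B s \<inter> space M))"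
proof -
  interpret prob_space M by fact
  note [measurable] = X B
  \<comment> \<open>Subfamilies are reached by setting the other coefficients to 0.\<close>
  have ch': "(CLINT \<omega>|M. iexp (\<Sum>s\<in>S2. t s * X s \<omega>)) = (\<Prod>s\<in>S2. CLINT \<omega>|M. iexp (t s * X s \<omega>))"
    if "S2 \<subseteq> S" for S2 t
  proof -
    define t' where "t' s = (if s \<in> S2 then t s else 0)" for s
    have "(\<Sum>s\<in>S2. t s * X s \<omega>) = (\<Sum>s\<in>S. t' s * X s \<omega>)" for \<omega>
      by (rule sum.mono_neutral_cong_left) (use that S in \<open>auto simp: t'_def\<close>)
    then have "(CLINT \<omega>|M. iexp (\<Sum>s\<in>S2. t s * X s \<omega>)) = (\<Prod>s\<in>S. CLINT \<omega>|M. iexp (t' s * X s \<omega>))"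
      using ch[of t'] by (simp only:)
    also have "\<dots> = (\<Prod>s\<in>S2. CLINT \<omega>|M. iexp (t s * X s \<omega>))"
      by (rule prod.mono_neutral_cong_right) (use that S in \<open>auto simp: t'_def prob_space\<close>)
    finally show ?thesis .
  qed
  have fS1: "finite S1" using S S1 by (rule finite_subset[rotated])
  \<comment> \<open>The induction needs a mixed form: indicators over \<open>S1\<close>, already
    converted, and exponentials over a disjoint \<open>S2\<close> with free coefficients.\<close>
  have "\<forall>S2 t. S2 \<subseteq> S \<longrightarrow> S1 \<inter> S2 = {} \<longrightarrow>
      (CLINT \<omega>|M. (\<Prod>s\<in>S1. indicator (B s) (X s \<omega>)) * iexp (\<Sum>s\<in>S2. t s * X s \<omega>)) =
      (\<Prod>s\<in>S1. complex_of_real (measure M (X s -` B s \<inter> space M))) * (\<Prod>s\<in>S2. CLINT \<omega>|M. iexp (t s * X s \<omega>))"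
    using fS1 S1
  proof (induction S1)
    case empty
    then show ?case using ch' by simp
  next
    case (insert a S1)
    have aS: "a \<in> S" "S1 \<subseteq> S" using insert.prems by auto
    show ?case
    proof (intro allI impI)
      fix S2 and t :: "'s \<Rightarrow> real" assume S2: "S2 \<subseteq> S" "insert a S1 \<inter> S2 = {}"
      note fS2 = finite_subset[OF S2(1) S]
      define w where "w \<omega> = (\<Prod>s\<in>S1. indicator (B s) (X s \<omega>)) * iexp (\<Sum>s\<in>S2. t s * X s \<omega>)" for \<omega>
      have mS: "s \<in> S1 \<Longrightarrow> X s \<in> borel_measurable M" "s \<in> S2 \<Longrightarrow> X s \<in> borel_measurable M"
        "s \<in> S1 \<Longrightarrow> B s \<in> sets borel" for s using X B S2 aS by auto
      note [measurable] = mS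
      have mw[measurable]: "w \<in> borel_measurable M"
        unfolding w_def using mS by (intro borel_measurable_times borel_measurable_prod) measurable
      have nw: "norm (w \<omega>) \<le> 1" for \<omega>
        unfolding w_def norm_mult prod_norm[symmetric]
        by (auto intro!: mult_le_one prod_le_1 prod_nonneg split: split_indicator simp del: of_real_sum)
      have IH: "(CLINT \<omega>|M. (\<Prod>s\<in>S1. indicator (B s) (X s \<omega>)) * iexp (\<Sum>s\<in>S3. t' s * X s \<omega>)) =
        (\<Prod>s\<in>S1. complex_of_real (measure M (X s -` B s \<inter> space M))) * (\<Prod>s\<in>S3. CLINT \<omega>|M. iexp (t' s * X s \<omega>))"
        if "S3 \<subseteq> S" "S1 \<inter> S3 = {}" for S3 t'
        using insert.IH aS(2) that by blast
      have w0: "(CLINT \<omega>|M. w \<omega>) = (\<Prod>s\<in>S1. complex_of_real (measure M (X s -` B s \<inter> space M))) * (\<Prod>s\<in>S2. CLINT \<omega>|M. iexp (t s * X s \<omega>))"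
        unfolding w_def using S2 by (intro IH) auto
      have "(CLINT \<omega>|M. w \<omega> * indicator (B a) (X a \<omega>)) = (CLINT \<omega>|M. w \<omega>) * measure M (X a -` B a \<inter> space M)"
      proof (rule integral_indicator_eq_if_char_factorizes[OF M X[OF aS(1)] mw nw _ B[OF aS(1)]])
        fix r
        \<comment> \<open>The exponential in \<open>X a\<close> joins the sum over
          \<open>S2\<close>, so the induction hypothesis for \<open>insert a S2\<close> supplies the
          factorization that the trade requires.\<close>
        define t' where "t' = t(a := r)"
        have an: "a \<notin> S2" using S2 by auto
        have e: "(\<Sum>s\<in>insert a S2. t' s * X s \<omega>) = (\<Sum>s\<in>S2. t s * X s \<omega>) + r * X a \<omega>" for \<omega>
        proof -
          have "(\<Sum>s\<in>S2. t' s * X s \<omega>) = (\<Sum>s\<in>S2. t s * X s \<omega>)"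
            by (rule sum.cong) (use an in \<open>auto simp: t'_def\<close>)
          then show ?thesis using fS2 an by (simp add: t'_def)
        qed
        have "(CLINT \<omega>|M. w \<omega> * iexp (r * X a \<omega>)) =
          (CLINT \<omega>|M. (\<Prod>s\<in>S1. indicator (B s) (X s \<omega>)) * iexp (\<Sum>s\<in>insert a S2. t' s * X s \<omega>))"
          unfolding e w_def of_real_add distrib_left exp_add mult.assoc ..
        also have "\<dots> = (\<Prod>s\<in>S1. complex_of_real (measure M (X s -` B s \<inter> space M))) * (\<Prod>s\<in>insert a S2. CLINT \<omega>|M. iexp (t' s * X s \<omega>))"
          by (rule IH) (use S2 aS insert.hyps in auto)
        also have "(\<Prod>s\<in>insert a S2. CLINT \<omega>|M. iexp (t' s * X s \<omega>)) =
            (CLINT \<omega>|M. iexp (r * X a \<omega>)) * (\<Prod>s\<in>S2. CLINT \<omega>|M. iexp (t s * X s \<omega>))"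
        proof -
          have "(\<Prod>s\<in>S2. CLINT \<omega>|M. iexp (t' s * X s \<omega>)) = (\<Prod>s\<in>S2. CLINT \<omega>|M. iexp (t s * X s \<omega>))"
            by (rule prod.cong) (use an in \<open>auto simp: t'_def\<close>)
          moreover have "t' a = r" by (simp add: t'_def)
          ultimately show ?thesis unfolding prod.insert[OF fS2 an] by (simp only:)
        qed
        finally show "(CLINT \<omega>|M. w \<omega> * iexp (r * X a \<omega>)) = (CLINT \<omega>|M. w \<omega>) * (CLINT \<omega>|M. iexp (r * X a \<omega>))"
          unfolding w0 by (simp only: mult_ac)
      qed
      moreover have "(\<Prod>s\<in>insert a S1. indicator (B s) (X s \<omega>)) * iexp (\<Sum>s\<in>S2. t s * X s \<omega>) = w \<omega> * indicator (B a) (X a \<omega>)" for \<omega>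
        unfolding w_def prod.insert[OF insert.hyps(1,2)] by (simp only: mult_ac)
      ultimately show "(CLINT \<omega>|M. (\<Prod>s\<in>insert a S1. indicator (B s) (X s \<omega>)) * iexp (\<Sum>s\<in>S2. t s * X s \<omega>)) =
        (\<Prod>s\<in>insert a S1. complex_of_real (measure M (X s -` B s \<inter> space M))) * (\<Prod>s\<in>S2. CLINT \<omega>|M. iexp (t s * X s \<omega>))"
        using w0 unfolding prod.insert[OF insert.hyps(1,2)] by (simp only: mult_ac)
    qed
  qed
  from this[rule_format, of "{}" "\<lambda>_. 0"]
  have "(CLINT \<omega>|M. (\<Prod>s\<in>S1. indicator (B s) (X s \<omega>))) = complex_of_real (\<Prod>s\<in>S1. measure M (X s -` B s \<inter> space M))"
    by simp
  moreover have "(CLINT \<omega>|M. (\<Prod>s\<in>S1. indicator (B s) (X s \<omega>))) = (CLINT \<omega>|M. complex_of_real (indicator {\<omega> \<in> space M. \<forall>s\<in>S1. X s \<omega> \<in> B s} \<omega>))"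
  proof (rule Bochner_Integration.integral_cong)
    fix \<omega> assume "\<omega> \<in> space M"
    then show "(\<Prod>s\<in>S1. indicator (B s) (X s \<omega>)) = complex_of_real (indicator {\<omega> \<in> space M. \<forall>s\<in>S1. X s \<omega> \<in> B s} \<omega>)"
      using fS1 by (cases "\<forall>s\<in>S1. X s \<omega> \<in> B s") (auto simp: indicator_def)
  qed simp
  moreover have "{\<omega> \<in> space M. \<forall>s\<in>S1. X s \<omega> \<in> B s} \<in> sets M"
  proof -
    have "{\<omega> \<in> space M. \<forall>s\<in>S1. X s \<omega> \<in> B s} = (\<Inter>s\<in>S1. X s -` B s \<inter> space M)" if "S1 \<noteq> {}"
      using that by auto
    moreover have "X s -` B s \<inter> space M \<in> sets M" if "s \<in> S1" for s
      using S1 that by (intro measurable_sets[OF X B]) auto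
    ultimately show ?thesis using fS1 by (cases "S1 = {}") (auto simp del: Inter_iff INT_simps intro!: sets.finite_INT)
  qed
  moreover have "{\<omega> \<in> space M. \<forall>s\<in>S1. X s \<omega> \<in> B s} \<inter> space M = {\<omega> \<in> space M. \<forall>s\<in>S1. X s \<omega> \<in> B s}"
    by blast
  ultimately have "complex_of_real (measure M {\<omega> \<in> space M. \<forall>s\<in>S1. X s \<omega> \<in> B s}) = complex_of_real (\<Prod>s\<in>S1. measure M (X s -` B s \<inter> space M))"
    by simp
  then show ?thesis by (simp only: of_real_eq_iff)
qed

text \<open>Events are replaced by their complements one at a time, through P(A and not E) = P(A) -
  P(A and E). As for boxes, the induction runs on a mixed statement with complements over
  \<open>I1\<close> and events over a disjoint \<open>I2\<close>.\<close>

lemma prob_none_eq_prod: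
  assumes M: "prob_space M" and I: "finite I" and E: "\<And>i. i \<in> I \<Longrightarrow> E i \<in> sets M"
    and ind: "\<And>I2. I2 \<subseteq> I \<Longrightarrow> measure M {\<omega> \<in> space M. \<forall>i\<in>I2. \<omega> \<in> E i} = (\<Prod>i\<in>I2. measure M (E i))"
  shows "measure M {\<omega> \<in> space M. \<forall>i\<in>I. \<omega> \<notin> E i} = (\<Prod>i\<in>I. 1 - measure M (E i))"
proof -
  interpret prob_space M by fact
  have *: "\<forall>I2. I2 \<subseteq> I \<longrightarrow> I1 \<inter> I2 = {} \<longrightarrow> measure M {\<omega> \<in> space M. (\<forall>i\<in>I1. \<omega> \<notin> E i) \<and> (\<forall>i\<in>I2. \<omega> \<in> E i)} =
      (\<Prod>i\<in>I1. 1 - measure M (E i)) * (\<Prod>i\<in>I2. measure M (E i))" if "finite I1" "I1 \<subseteq> I" for I1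
    using that
  proof (induction I1)
    case empty
    then show ?case using ind by simp
  next
    case (insert a I1)
    show ?case
    proof (intro allI impI)
      fix I2 assume I2: "I2 \<subseteq> I" "insert a I1 \<inter> I2 = {}"
      have fin: "finite I2" using I I2 finite_subset by blast
      have meas: "{\<omega> \<in> space M. (\<forall>i\<in>I1. \<omega> \<notin> E i) \<and> (\<forall>i\<in>I3. \<omega> \<in> E i)} \<in> sets M" if "I3 \<subseteq> I" for I3
      proof -
        have "finite I3" using that I finite_subset by blast
        then show ?thesis using insert.hyps insert.prems E that
          by (intro sets.sets_Collect_conj sets.sets_Collect_finite_All' sets.sets_Collect_finite_All)
            (auto intro!: sets.sets_Collect_neg simp: Int_def[symmetric] Collect_conj_eq)
      qed
      let ?A = "\<lambda>I3. {\<omega> \<in> space M. (\<forall>i\<in>I1. \<omega> \<notin> E i) \<and> (\<forall>i\<in>I3. \<omega> \<in> E i)}"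
      have "{\<omega> \<in> space M. (\<forall>i\<in>insert a I1. \<omega> \<notin> E i) \<and> (\<forall>i\<in>I2. \<omega> \<in> E i)} = ?A I2 - ?A (insert a I2)" by auto
      then have "measure M {\<omega> \<in> space M. (\<forall>i\<in>insert a I1. \<omega> \<notin> E i) \<and> (\<forall>i\<in>I2. \<omega> \<in> E i)} = measure M (?A I2) - measure M (?A (insert a I2))"
        using insert.prems I2 by (simp only:) (intro finite_measure_Diff meas, auto)
      also have "measure M (?A I2) = (\<Prod>i\<in>I1. 1 - measure M (E i)) * (\<Prod>i\<in>I2. measure M (E i))"
        using insert I2 by blast
      also have "measure M (?A (insert a I2)) = (\<Prod>i\<in>I1. 1 - measure M (E i)) * (\<Prod>i\<in>insert a I2. measure M (E i))"
        using insert I2 by (intro insert.IH[rule_format]) auto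
      finally show "measure M {\<omega> \<in> space M. (\<forall>i\<in>insert a I1. \<omega> \<notin> E i) \<and> (\<forall>i\<in>I2. \<omega> \<in> E i)} =
        (\<Prod>i\<in>insert a I1. 1 - measure M (E i)) * (\<Prod>i\<in>I2. measure M (E i))"
        using insert.hyps I2 fin by (simp add: algebra_simps)
    qed
  qed
  show ?thesis using *[OF I, rule_format, of "{}"] by simp
qed

section \<open>Decoupling by Gaussian noise\<close>

definition gauss_noise :: "'i set \<Rightarrow> ('i \<Rightarrow> real) measure" where
  "gauss_noise P = Pi\<^sub>M P (\<lambda>_. std_normal_distribution)"

lemma gauss_noise_sets[measurable_cong]: "sets (gauss_noise P) = sets (Pi\<^sub>M P (\<lambda>_. borel))"
  unfolding gauss_noise_def by (rule sets_PiM_cong) auto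

lemma prob_space_gauss_noise: "prob_space (gauss_noise P)"
  unfolding gauss_noise_def
  by (intro prob_space_PiM) (simp add: prob_space_normal_density)

lemma char_gauss_noise:
  assumes "finite P"
  shows "(CLINT z|gauss_noise P. iexp (\<Sum>p\<in>P. c p * z p)) = exp (- ((\<Sum>p\<in>P. (c p)\<^sup>2) / 2))"
proof -
  interpret product_prob_space "\<lambda>_::'a. std_normal_distribution" P
    by (intro product_prob_spaceI) (simp add: prob_space_normal_density)
  have "(CLINT z|gauss_noise P. iexp (\<Sum>p\<in>P. c p * z p)) = (CLINT z|gauss_noise P. (\<Prod>p\<in>P. iexp (c p * z p)))"
    using assms by (simp add: exp_sum sum_distrib_left)
  also have "\<dots> = (\<Prod>p\<in>P. CLINT x|std_normal_distribution. iexp (c p * x))"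
    unfolding gauss_noise_def
    by (rule product_integral_prod[OF assms]) (rule prob_space.integrable_iexp[OF prob_space_normal_density], auto)
  also have "\<dots> = (\<Prod>p\<in>P. complex_of_real (exp (- ((c p)\<^sup>2) / 2)))"
    using char_std_normal_distribution by (simp add: char_def fun_eq_iff)
  also have "\<dots> = exp (- ((\<Sum>p\<in>P. (c p)\<^sup>2) / 2))"
    using assms by (simp add: exp_sum[symmetric] sum_divide_distrib sum_negf flip: of_real_prod)
  finally show ?thesis .
qed

text \<open>Each ordered pair \<open>(s, s')\<close> carries an independent noise that enters \<open>s\<close> and \<open>s'\<close> with
  weights whose product is minus half the covariance \<open>e s s'\<close>, so that adding the noise cancels
  all off-diagonal covariances.\<close>

definition pair_weight :: "('s \<Rightarrow> 's \<Rightarrow> real) \<Rightarrow> 's \<Rightarrow> 's \<Rightarrow> real" where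
  "pair_weight e s s' = (if s = s' then 0 else sqrt (\<bar>e s s'\<bar> / 2))"

definition pair_noise :: "'s set \<Rightarrow> ('s \<Rightarrow> 's \<Rightarrow> real) \<Rightarrow> 's \<Rightarrow> ('s \<times> 's \<Rightarrow> real) \<Rightarrow> real" where
  "pair_noise S e s z =
     (\<Sum>s'\<in>S. pair_weight e s s' * z (s, s') - sgn (e s' s) * pair_weight e s' s * z (s', s))"

text \<open>For symmetric \<open>e\<close> this is the variance of \<open>pair_noise\<close> at
  \<open>s\<close>: both orders of a pair contribute half of |e s s'|.\<close>

definition off_diag :: "'s set \<Rightarrow> ('s \<Rightarrow> 's \<Rightarrow> real) \<Rightarrow> 's \<Rightarrow> real" where
  "off_diag S e s = (\<Sum>s'\<in>S - {s}. \<bar>e s s'\<bar>)"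

text \<open>The noise has covariance -e s s' off the diagonal and \<open>off_diag\<close> on it.
  This matrix is diagonally dominant, and the noise attached to pairs is an explicit square root of
  it.\<close>

lemma char_pair_noise:
  assumes S: "finite S" and sym: "\<And>s s'. e s s' = e s' s"
  shows "(CLINT z|gauss_noise (S \<times> S). iexp (\<Sum>s\<in>S. t s * pair_noise S e s z)) =
    exp (- ((\<Sum>s\<in>S. (t s)\<^sup>2 * off_diag S e s) - (\<Sum>s\<in>S. \<Sum>s'\<in>S - {s}. t s * t s' * e s s')) / 2)"
proof -
  let ?a = "pair_weight e" and ?b = "\<lambda>s s'. - sgn (e s s') * pair_weight e s s'"
  define c where "c p = (case p of (s, s') \<Rightarrow> t s * ?a s s' + t s' * ?b s s')" for p
  have "(\<Sum>s\<in>S. t s * pair_noise S e s z) = (\<Sum>p\<in>S \<times> S. c p * z p)" for z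
  proof -
    have "(\<Sum>s\<in>S. t s * pair_noise S e s z) =
        (\<Sum>s\<in>S. \<Sum>s'\<in>S. t s * ?a s s' * z (s, s')) + (\<Sum>s\<in>S. \<Sum>s'\<in>S. t s * ?b s' s * z (s', s))"
      unfolding pair_noise_def sum.distrib[symmetric] sum_distrib_left
      by (simp add: algebra_simps)
    also have "(\<Sum>s\<in>S. \<Sum>s'\<in>S. t s * ?b s' s * z (s', s)) = (\<Sum>s\<in>S. \<Sum>s'\<in>S. t s' * ?b s s' * z (s, s'))"
      by (rule sum.swap)
    also have "(\<Sum>s\<in>S. \<Sum>s'\<in>S. t s * ?a s s' * z (s, s')) + \<dots> = (\<Sum>p\<in>S \<times> S. c p * z p)"
      unfolding sum.distrib[symmetric] sum.cartesian_product[symmetric] c_def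
      by (simp add: algebra_simps split_beta sum.cartesian_product)
    finally show ?thesis .
  qed
  then have "(CLINT z|gauss_noise (S \<times> S). iexp (\<Sum>s\<in>S. t s * pair_noise S e s z)) = exp (- ((\<Sum>p\<in>S \<times> S. (c p)\<^sup>2) / 2))"
    using char_gauss_noise[of "S \<times> S" c] S by simp
  moreover have "(\<Sum>p\<in>S \<times> S. (c p)\<^sup>2) = (\<Sum>s\<in>S. (t s)\<^sup>2 * off_diag S e s) - (\<Sum>s\<in>S. \<Sum>s'\<in>S - {s}. t s * t s' * e s s')"
  proof -
    \<comment> \<open>The off-diagonal part of \<open>e\<close>, extended by 0, so that all sums run
      over the full square and can be swapped.\<close>
    define d where "d s s' = (if s = s' then 0 else e s s')" for s s'
    have c2: "(c (s, s'))\<^sup>2 = ((t s)\<^sup>2 * \<bar>d s s'\<bar> + (t s')\<^sup>2 * \<bar>d s' s\<bar>) / 2 - t s * t s' * d s s'" for s s'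
    proof (cases "s = s'")
      case True then show ?thesis by (simp add: c_def pair_weight_def d_def)
    next
      case False
      have w2: "(?a s s')\<^sup>2 = \<bar>e s s'\<bar> / 2" using False by (simp add: pair_weight_def)
      have "(c (s, s'))\<^sup>2 = (t s)\<^sup>2 * (?a s s')\<^sup>2 + (t s')\<^sup>2 * ((sgn (e s s'))\<^sup>2 * (?a s s')\<^sup>2) - 2 * (t s * t s' * (sgn (e s s') * (?a s s')\<^sup>2))"
        unfolding c_def by (simp add: power2_eq_square algebra_simps)
      also have "\<dots> = ((t s)\<^sup>2 * \<bar>e s s'\<bar> + (t s')\<^sup>2 * \<bar>e s s'\<bar>) / 2 - t s * t s' * e s s'"
        unfolding w2 by (simp add: sgn_if field_simps)
      finally show ?thesis using False sym[of s' s] by (simp add: d_def)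
    qed
    have off: "off_diag S e s = (\<Sum>s'\<in>S. \<bar>d s s'\<bar>)" if "s \<in> S" for s
      unfolding off_diag_def by (rule sum.mono_neutral_cong_left) (use S in \<open>auto simp: d_def\<close>)
    have off2: "(\<Sum>s'\<in>S - {s}. t s * t s' * e s s') = (\<Sum>s'\<in>S. t s * t s' * d s s')" for s
      by (rule sum.mono_neutral_cong_left) (use S in \<open>auto simp: d_def\<close>)
    have "(\<Sum>p\<in>S \<times> S. (c p)\<^sup>2) = (\<Sum>s\<in>S. \<Sum>s'\<in>S. (c (s, s'))\<^sup>2)"
      by (simp add: sum.cartesian_product)
    also have "\<dots> = (\<Sum>s\<in>S. \<Sum>s'\<in>S. (t s)\<^sup>2 * \<bar>d s s'\<bar>) / 2 + (\<Sum>s\<in>S. \<Sum>s'\<in>S. (t s')\<^sup>2 * \<bar>d s' s\<bar>) / 2 - (\<Sum>s\<in>S. \<Sum>s'\<in>S. t s * t s' * d s s')"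
      unfolding c2 sum_subtractf sum.distrib[symmetric] sum_divide_distrib add_divide_distrib ..
    also have "(\<Sum>s\<in>S. \<Sum>s'\<in>S. (t s')\<^sup>2 * \<bar>d s' s\<bar>) = (\<Sum>s\<in>S. \<Sum>s'\<in>S. (t s)\<^sup>2 * \<bar>d s s'\<bar>)"
      by (rule sum.swap)
    also have "(\<Sum>s\<in>S. \<Sum>s'\<in>S. (t s)\<^sup>2 * \<bar>d s s'\<bar>) = (\<Sum>s\<in>S. (t s)\<^sup>2 * off_diag S e s)"
      by (rule sum.cong) (simp_all add: off sum_distrib_left)
    finally show ?thesis unfolding off2 by simp
  qed
  ultimately show ?thesis by (simp only: minus_divide_left)
qed

lemma off_diag_nonneg: "0 \<le> off_diag S e s"
  by (auto simp: off_diag_def intro!: sum_nonneg)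

lemma pair_noise_measurable:
  assumes "finite S" "s \<in> S"
  shows "pair_noise S e s \<in> borel_measurable (gauss_noise (S \<times> S))"
proof -
  have "(\<lambda>z. z (a, b)) \<in> borel_measurable (gauss_noise (S \<times> S))" if "a \<in> S" "b \<in> S" for a b
    using that unfolding measurable_cong_sets[OF gauss_noise_sets refl]
    by (intro measurable_component_singleton) auto
  then show ?thesis unfolding pair_noise_def using assms
    by (intro borel_measurable_sum borel_measurable_diff borel_measurable_times) auto
qed

text \<open>The perturbed variables have a diagonal covariance, hence are independent.\<close>

lemma char_decoupled:
  fixes Q :: "'s \<Rightarrow> 'w \<Rightarrow> real"
  assumes M: "prob_space M" and S: "finite S"
    and Q: "\<And>a. centered_normal M (\<lambda>\<omega>. \<Sum>s\<in>S. a s * Q s \<omega>)" "\<And>s. s \<in> S \<Longrightarrow> centered_normal M (Q s)"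
    and e: "e = (\<lambda>s s'. \<integral>\<omega>. Q s \<omega> * Q s' \<omega> \<partial>M)"
  shows "(CLINT x|M \<Otimes>\<^sub>M gauss_noise (S \<times> S). iexp (\<Sum>s\<in>S. t s * (Q s (fst x) + pair_noise S e s (snd x)))) =
    exp (- (\<Sum>s\<in>S. (t s)\<^sup>2 * (e s s + off_diag S e s)) / 2)"
proof -
  interpret M: prob_space M by fact
  interpret G: prob_space "gauss_noise (S \<times> S)" by (rule prob_space_gauss_noise)
  interpret MG: pair_prob_space M "gauss_noise (S \<times> S)" ..
  note [measurable] = centered_normal_measurable[OF Q(1)] centered_normal_measurable[OF Q(2)] pair_noise_measurable[OF S]
  let ?q = "\<lambda>\<omega>. \<Sum>s\<in>S. t s * Q s \<omega>" and ?w = "\<lambda>z. \<Sum>s\<in>S. t s * pair_noise S e s z"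
  have sym: "e s s' = e s' s" for s s' by (simp add: e mult.commute)
  have "(CLINT x|M \<Otimes>\<^sub>M gauss_noise (S \<times> S). iexp (\<Sum>s\<in>S. t s * (Q s (fst x) + pair_noise S e s (snd x)))) =
    (CLINT x|M \<Otimes>\<^sub>M gauss_noise (S \<times> S). iexp (?q (fst x)) * iexp (?w (snd x)))"
    by (simp only: distrib_left sum.distrib of_real_add exp_add)
  also have "\<dots> = (CLINT \<omega>|M. CLINT z|gauss_noise (S \<times> S). iexp (?q \<omega>) * iexp (?w z))"
  proof -
    have "integrable (M \<Otimes>\<^sub>M gauss_noise (S \<times> S)) (\<lambda>x. iexp (?q (fst x)) * iexp (?w (snd x)))"
      by (rule MG.integrable_const_bound[where B=1]) (auto intro!: AE_I2 simp: norm_mult simp del: of_real_sum)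
    from MG.integral_fst'[OF this] show ?thesis by simp
  qed
  also have "\<dots> = (CLINT \<omega>|M. iexp (?q \<omega>)) * (CLINT z|gauss_noise (S \<times> S). iexp (?w z))"
    unfolding integral_mult_right_zero integral_mult_left_zero ..
  also have "(CLINT \<omega>|M. iexp (?q \<omega>)) = exp (- ((\<integral>\<omega>. (?q \<omega>)\<^sup>2 \<partial>M) / 2))"
    using centered_normal_char[OF M Q(1), of 1 t] by simp
  also have "(\<integral>\<omega>. (?q \<omega>)\<^sup>2 \<partial>M) = (\<Sum>s\<in>S. \<Sum>s'\<in>S. t s * t s' * e s s')"
  proof -
    have "(\<integral>\<omega>. (?q \<omega>)\<^sup>2 \<partial>M) = (\<integral>\<omega>. (\<Sum>s\<in>S. \<Sum>s'\<in>S. t s * t s' * (Q s \<omega> * Q s' \<omega>)) \<partial>M)"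
      by (simp add: power2_eq_square sum_product mult_ac)
    also have "\<dots> = (\<Sum>s\<in>S. \<Sum>s'\<in>S. \<integral>\<omega>. t s * t s' * (Q s \<omega> * Q s' \<omega>) \<partial>M)"
    proof (subst Bochner_Integration.integral_sum)
      have i: "integrable M (\<lambda>\<omega>. t s * t s' * (Q s \<omega> * Q s' \<omega>))" if "s \<in> S" "s' \<in> S" for s s'
        by (intro integrable_mult_right centered_normal_integrable_mult[OF M] Q that)
      then show "integrable M (\<lambda>\<omega>. \<Sum>s'\<in>S. t s * t s' * (Q s \<omega> * Q s' \<omega>))" if "s \<in> S" for s
        using that by (intro Bochner_Integration.integrable_sum)
      show "(\<Sum>s\<in>S. \<integral>\<omega>. (\<Sum>s'\<in>S. t s * t s' * (Q s \<omega> * Q s' \<omega>)) \<partial>M) =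
        (\<Sum>s\<in>S. \<Sum>s'\<in>S. \<integral>\<omega>. t s * t s' * (Q s \<omega> * Q s' \<omega>) \<partial>M)"
        by (intro sum.cong refl Bochner_Integration.integral_sum i)
    qed
    also have "\<dots> = (\<Sum>s\<in>S. \<Sum>s'\<in>S. t s * t s' * e s s')"
      unfolding e integral_mult_right_zero ..
    finally show ?thesis .
  qed
  \<comment> \<open>Once the diagonal is split off, the remaining terms are those that the noise
    cancels.\<close>
  also have "(\<Sum>s\<in>S. \<Sum>s'\<in>S. t s * t s' * e s s') = (\<Sum>s\<in>S. (t s)\<^sup>2 * e s s) + (\<Sum>s\<in>S. \<Sum>s'\<in>S - {s}. t s * t s' * e s s')"
    unfolding sum.distrib[symmetric] using S by (intro sum.cong) (auto simp: sum.remove power2_eq_square)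
  finally have *: "(CLINT x|M \<Otimes>\<^sub>M gauss_noise (S \<times> S). iexp (\<Sum>s\<in>S. t s * (Q s (fst x) + pair_noise S e s (snd x)))) =
    complex_of_real (exp (- (((\<Sum>s\<in>S. (t s)\<^sup>2 * e s s) + (\<Sum>s\<in>S. \<Sum>s'\<in>S - {s}. t s * t s' * e s s')) / 2)) *
     exp (- ((\<Sum>s\<in>S. (t s)\<^sup>2 * off_diag S e s) - (\<Sum>s\<in>S. \<Sum>s'\<in>S - {s}. t s * t s' * e s s')) / 2))"
    unfolding char_pair_noise[OF S sym] of_real_mult .
  show ?thesis unfolding * exp_add[symmetric]
    by (rule arg_cong[where f="\<lambda>x. complex_of_real (exp x)"]) (simp add: distrib_left sum.distrib field_simps)
qed

lemma centered_normal_char_variance: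
  assumes M: "prob_space M" and Y: "Y \<in> borel_measurable M" and v: "0 \<le> v"
    and ch: "\<And>t. (CLINT \<omega>|M. iexp (t * Y \<omega>)) = exp (- (v * t\<^sup>2 / 2))"
  shows "(\<integral>\<omega>. (Y \<omega>)\<^sup>2 \<partial>M) = v"
proof -
  note n = centered_normalI_char[OF M Y v ch]
  have "complex_of_real (exp (- ((\<integral>\<omega>. (Y \<omega>)\<^sup>2 \<partial>M) * 1\<^sup>2 / 2))) = complex_of_real (exp (- (v * 1\<^sup>2 / 2)))"
    by (rule trans[OF sym[OF centered_normal_char[OF M n]] ch])
  then show ?thesis unfolding of_real_eq_iff by simp
qed

text \<open>The law of a single noise variable is read off the joint characteristic function by
  taking coefficients supported at \<open>s\<close>.\<close>

lemma pair_noise_normal: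
  assumes S: "finite S" and sym: "\<And>s s'. e s s' = e s' s" and s: "s \<in> S"
  shows "centered_normal (gauss_noise (S \<times> S)) (pair_noise S e s)"
    "(\<integral>z. (pair_noise S e s z)\<^sup>2 \<partial>gauss_noise (S \<times> S)) = off_diag S e s"
proof -
  have ch: "(CLINT z|gauss_noise (S \<times> S). iexp (t * pair_noise S e s z)) = exp (- (off_diag S e s * t\<^sup>2 / 2))" for t
  proof -
    define u where "u s' = (if s' = s then t else 0)" for s'
    have 1: "(\<Sum>s'\<in>S. u s' * pair_noise S e s' z) = t * pair_noise S e s z" for z
      using S s by (simp add: u_def if_distrib[of "\<lambda>x. x * _"] sum.delta cong: if_cong)
    have 2: "(\<Sum>s'\<in>S. (u s')\<^sup>2 * off_diag S e s') = t\<^sup>2 * off_diag S e s"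
      using S s by (simp add: u_def if_distrib[of "\<lambda>x. x\<^sup>2 * _"] sum.delta cong: if_cong)
    have 3: "(\<Sum>s\<in>S. \<Sum>s'\<in>S - {s}. u s * u s' * e s s') = 0"
      by (intro sum.neutral ballI) (auto simp: u_def)
    show ?thesis using char_pair_noise[where e=e and t=u, OF S sym] unfolding 1 2 3 by (simp add: mult.commute)
  qed
  note a = prob_space_gauss_noise pair_noise_measurable[OF S s] off_diag_nonneg
  show "centered_normal (gauss_noise (S \<times> S)) (pair_noise S e s)"
    by (rule centered_normalI_char[OF a ch])
  show "(\<integral>z. (pair_noise S e s z)\<^sup>2 \<partial>gauss_noise (S \<times> S)) = off_diag S e s"
    by (rule centered_normal_char_variance[OF a ch])
qed

text \<open>Here \<open>I\<close> numbers the points and \<open>J\<close> the standardised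
  coordinates at one point. Either some noise variable exceeds \<epsilon>/2, which the tail bound
  covers, or the perturbed variables miss their windows in every block. The perturbed variables are
  independent with variances between 1 and 2, so the second event has a product bound.\<close>

lemma prob_no_block_le:
  fixes Q :: "'i \<times> 'j \<Rightarrow> 'w \<Rightarrow> real"
  assumes M: "prob_space M" and I: "finite I" and J: "finite J" and S_def: "S = I \<times> J"
    and Q: "\<And>a. centered_normal M (\<lambda>\<omega>. \<Sum>s\<in>S. a s * Q s \<omega>)" "\<And>s. s \<in> S \<Longrightarrow> centered_normal M (Q s)"
    and e: "e = (\<lambda>s s'. \<integral>\<omega>. Q s \<omega> * Q s' \<omega> \<partial>M)"
    and e1: "\<And>s. s \<in> S \<Longrightarrow> e s s = 1" and off: "\<And>s. s \<in> S \<Longrightarrow> off_diag S e s \<le> \<tau>" and \<tau>: "\<tau> \<le> 1"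
    and q: "\<And>s. s \<in> S \<Longrightarrow> \<bar>q s\<bar> \<le> K" and eps: "0 < \<epsilon>" "\<epsilon> \<le> 1"
  shows "measure M {\<omega> \<in> space M. \<forall>i\<in>I. \<exists>j\<in>J. \<epsilon> < \<bar>Q (i, j) \<omega> - q (i, j)\<bar>} \<le>
    card S * (normal_tail_const m * (\<tau> / (\<epsilon> / 2)\<^sup>2) ^ m) + (1 - (\<epsilon> / 2 * exp (- ((K + 1)\<^sup>2)) / 4) ^ card J) ^ card I"
proof -
  have S: "finite S" using I J by (simp add: S_def)
  let ?G = "gauss_noise (S \<times> S)"
  let ?N = "M \<Otimes>\<^sub>M ?G"
  interpret M: prob_space M by fact
  interpret G: prob_space ?G by (rule prob_space_gauss_noise)
  interpret MG: pair_prob_space M ?G ..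
  have N: "prob_space ?N" by (rule MG.prob_space_axioms)
  have sym: "e s s' = e s' s" for s s' by (simp add: e mult.commute)
  have mQ: "Q s \<in> borel_measurable M" if "s \<in> S" for s using Q(2)[OF that] by (rule centered_normal_measurable)
  define T where "T s x = Q s (fst x) + pair_noise S e s (snd x)" for s x
  have mT: "T s \<in> borel_measurable ?N" if "s \<in> S" for s
    using mQ[OF that] pair_noise_measurable[OF S that] unfolding T_def by measurable
  have chT: "(CLINT x|?N. iexp (\<Sum>s\<in>S. t s * T s x)) = exp (- (\<Sum>s\<in>S. (t s)\<^sup>2 * (e s s + off_diag S e s)) / 2)" for t
    unfolding T_def by (rule char_decoupled[OF M S Q e])
  have ch1: "(CLINT x|?N. iexp (t * T s x)) = exp (- ((1 + off_diag S e s) * t\<^sup>2 / 2))" if s: "s \<in> S" for s t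
  proof -
    define u where "u s' = (if s' = s then t else 0)" for s'
    have 1: "(\<Sum>s'\<in>S. u s' * T s' x) = t * T s x" for x
      using S s by (simp add: u_def if_distrib[of "\<lambda>x. x * _"] sum.delta cong: if_cong)
    have 2: "(\<Sum>s'\<in>S. (u s')\<^sup>2 * (e s' s' + off_diag S e s')) = t\<^sup>2 * (1 + off_diag S e s)"
      using S s e1[OF s] by (simp add: u_def if_distrib[of "\<lambda>x. x\<^sup>2 * _"] sum.delta cong: if_cong)
    show ?thesis using chT[of u] unfolding 1 2 by (simp add: mult.commute)
  qed
  have v0: "0 \<le> 1 + off_diag S e s" for s using off_diag_nonneg[of S e s] by simp
  note nT = centered_normalI_char[OF N mT v0 ch1] and vT = centered_normal_char_variance[OF N mT v0 ch1]
  \<comment> \<open>The tolerance \<epsilon> is shared equally between the perturbed variable and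
    the noise.\<close>
  define B where "B s = {q s - \<epsilon> / 2..q s + \<epsilon> / 2}" for s
  define p where "p = \<epsilon> / 2 * exp (- ((K + 1)\<^sup>2)) / 4"
  have p: "p \<le> measure ?N (T s -` B s \<inter> space ?N)" if s: "s \<in> S" for s
  proof -
    have "p \<le> measure ?N {x \<in> space ?N. \<bar>T s x - q s\<bar> \<le> \<epsilon> / 2}"
      unfolding p_def using off[OF s] off_diag_nonneg[of S e s] \<tau> q[OF s] eps s
      by (intro centered_normal_window[OF N nT]) (auto simp: vT)
    also have "{x \<in> space ?N. \<bar>T s x - q s\<bar> \<le> \<epsilon> / 2} = T s -` B s \<inter> space ?N"
      unfolding B_def vimage_def abs_diff_le_iff by auto
    finally show ?thesis .
  qed
  have box: "measure ?N {x \<in> space ?N. \<forall>s\<in>S1. T s x \<in> B s} = (\<Prod>s\<in>S1. measure ?N (T s -` B s \<inter> space ?N))"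
    if "S1 \<subseteq> S" for S1
  proof (rule prob_box_eq_prod_if_char_factorizes[OF N S mT _ _ that])
    fix t
    have "(CLINT x|?N. iexp (\<Sum>s\<in>S. t s * T s x)) = complex_of_real (exp (\<Sum>s\<in>S. - ((1 + off_diag S e s) * (t s)\<^sup>2 / 2)))"
      unfolding chT using e1 by (simp add: sum_negf sum_divide_distrib mult.commute)
    also have "\<dots> = (\<Prod>s\<in>S. CLINT x|?N. iexp (t s * T s x))"
      unfolding exp_sum[OF S] of_real_prod by (rule prod.cong) (simp_all only: ch1)
    finally show "(CLINT x|?N. iexp (\<Sum>s\<in>S. t s * T s x)) = (\<Prod>s\<in>S. CLINT x|?N. iexp (t s * T s x))" .
  qed (auto simp: B_def)
  define E where "E i = {x \<in> space ?N. \<forall>s\<in>{i} \<times> J. T s x \<in> B s}" for i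
  have mE: "E i \<in> sets ?N" if "i \<in> I" for i
    unfolding E_def
  proof (rule sets.sets_Collect_finite_All)
    fix s assume "s \<in> {i} \<times> J"
    then have s: "s \<in> S" using that by (auto simp: S_def)
    have "{x \<in> space ?N. T s x \<in> B s} = T s -` B s \<inter> space ?N" by auto
    also have "\<dots> \<in> sets ?N" by (rule measurable_sets[OF mT[OF s]]) (simp add: B_def)
    finally show "{x \<in> space ?N. T s x \<in> B s} \<in> sets ?N" .
  qed (use J in auto)
  have pE: "measure ?N (E i) = (\<Prod>s\<in>{i} \<times> J. measure ?N (T s -` B s \<inter> space ?N))" if "i \<in> I" for i
    unfolding E_def by (rule box) (use that in \<open>auto simp: S_def\<close>)
  have none: "measure ?N {x \<in> space ?N. \<forall>i\<in>I. x \<notin> E i} = (\<Prod>i\<in>I. 1 - measure ?N (E i))"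
  proof (rule prob_none_eq_prod[OF N I mE])
    fix I2 assume I2: "I2 \<subseteq> I"
    have "{x \<in> space ?N. \<forall>i\<in>I2. x \<in> E i} = {x \<in> space ?N. \<forall>s\<in>I2 \<times> J. T s x \<in> B s}"
      by (auto simp: E_def)
    also have "measure ?N \<dots> = (\<Prod>s\<in>I2 \<times> J. measure ?N (T s -` B s \<inter> space ?N))"
      by (rule box) (use I2 in \<open>auto simp: S_def\<close>)
    also have "\<dots> = (\<Prod>i\<in>I2. \<Prod>j\<in>J. measure ?N (T (i, j) -` B (i, j) \<inter> space ?N))"
      by (simp add: prod.cartesian_product split_beta)
    also have "\<dots> = (\<Prod>i\<in>I2. measure ?N (E i))"
    proof (rule prod.cong[OF refl])
      fix i assume "i \<in> I2"
      then have i: "i \<in> I" using I2 by auto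
      show "(\<Prod>j\<in>J. measure ?N (T (i, j) -` B (i, j) \<inter> space ?N)) = measure ?N (E i)"
        unfolding pE[OF i] by (rule prod.reindex_bij_witness[where i=snd and j="\<lambda>j. (i, j)"]) auto
    qed
    finally show "measure ?N {x \<in> space ?N. \<forall>i\<in>I2. x \<in> E i} = (\<Prod>i\<in>I2. measure ?N (E i))" .
  qed
  have p0: "0 \<le> p" using eps by (simp add: p_def)
  have "(\<Prod>i\<in>I. 1 - measure ?N (E i)) \<le> (\<Prod>i\<in>I. 1 - p ^ card J)"
  proof (rule prod_mono)
    fix i assume i: "i \<in> I"
    have "p ^ card J = (\<Prod>s\<in>{i} \<times> J. p)" using J by (simp add: card_cartesian_product)
    also have "\<dots> \<le> measure ?N (E i)" unfolding pE[OF i]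
      by (rule prod_mono) (use i p p0 in \<open>auto simp: S_def\<close>)
    finally show "0 \<le> 1 - measure ?N (E i) \<and> 1 - measure ?N (E i) \<le> 1 - p ^ card J"
      using MG.prob_le_1[of "E i"] by simp
  qed
  then have none': "measure ?N {x \<in> space ?N. \<forall>i\<in>I. x \<notin> E i} \<le> (1 - p ^ card J) ^ card I"
    unfolding none by simp
  define W where "W s = {z \<in> space ?G. \<epsilon> / 2 \<le> \<bar>pair_noise S e s z\<bar>}" for s
  have mW: "W s \<in> sets ?G" if "s \<in> S" for s
    unfolding W_def using pair_noise_measurable[OF S that, measurable] by measurable
  have pW: "measure ?N (space M \<times> W s) \<le> normal_tail_const m * (\<tau> / (\<epsilon> / 2)\<^sup>2) ^ m" if s: "s \<in> S" for s
  proof -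
    have "measure ?N (space M \<times> W s) = measure ?G (W s)"
      unfolding measure_def by (subst G.emeasure_pair_measure_Times) (use mW[OF s] in \<open>auto simp: M.emeasure_space_1\<close>)
    also have "\<dots> \<le> normal_tail_const m * (\<tau> / (\<epsilon> / 2)\<^sup>2) ^ m"
      unfolding W_def using eps off[OF s]
      by (intro centered_normal_tail[OF prob_space_gauss_noise pair_noise_normal(1)[OF S sym s]])
        (auto simp: pair_noise_normal(2)[OF S sym s])
    finally show ?thesis .
  qed
  let ?bad = "{\<omega> \<in> space M. \<forall>i\<in>I. \<exists>j\<in>J. \<epsilon> < \<bar>Q (i, j) \<omega> - q (i, j)\<bar>}"
  have mb: "?bad \<in> sets M"
  proof (intro sets.sets_Collect_finite_All sets.sets_Collect_finite_Ex I J)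
    fix i j assume "i \<in> I" "j \<in> J"
    then have [measurable]: "Q (i, j) \<in> borel_measurable M" using mQ by (auto simp: S_def)
    show "{\<omega> \<in> space M. \<epsilon> < \<bar>Q (i, j) \<omega> - q (i, j)\<bar>} \<in> sets M" by measurable
  qed
  have "measure M ?bad = measure ?N (?bad \<times> space ?G)"
    unfolding measure_def by (subst G.emeasure_pair_measure_Times) (use mb in \<open>auto simp: G.emeasure_space_1\<close>)
  also have "\<dots> \<le> measure ?N ((\<Union>s\<in>S. space M \<times> W s) \<union> {x \<in> space ?N. \<forall>i\<in>I. x \<notin> E i})"
  proof (rule MG.finite_measure_mono)
    show "?bad \<times> space ?G \<subseteq> (\<Union>s\<in>S. space M \<times> W s) \<union> {x \<in> space ?N. \<forall>i\<in>I. x \<notin> E i}"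
    proof
      fix x assume x: "x \<in> ?bad \<times> space ?G"
      obtain \<omega> z where xz: "x = (\<omega>, z)" by (cases x)
      show "x \<in> (\<Union>s\<in>S. space M \<times> W s) \<union> {x \<in> space ?N. \<forall>i\<in>I. x \<notin> E i}"
      proof (cases "\<exists>s\<in>S. z \<in> W s")
        case True then show ?thesis using x xz by auto
      next
        case False
        have "x \<notin> E i" if i: "i \<in> I" for i
        proof
          assume xE: "x \<in> E i"
          obtain j where j: "j \<in> J" "\<epsilon> < \<bar>Q (i, j) \<omega> - q (i, j)\<bar>" using x xz i by auto
          have s: "(i, j) \<in> S" using i j by (simp add: S_def)
          have "\<bar>pair_noise S e (i, j) z\<bar> < \<epsilon> / 2" using False s x xz by (auto simp: W_def not_le)
          moreover have "\<bar>Q (i, j) \<omega> + pair_noise S e (i, j) z - q (i, j)\<bar> \<le> \<epsilon> / 2"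
            unfolding abs_diff_le_iff using xE j xz by (auto simp: E_def B_def T_def)
          ultimately show False using j by linarith
        qed
        then show ?thesis using x xz by (auto simp: space_pair_measure)
      qed
    qed
    show "(\<Union>s\<in>S. space M \<times> W s) \<union> {x \<in> space ?N. \<forall>i\<in>I. x \<notin> E i} \<in> sets ?N"
    proof (intro sets.Un sets.finite_UN S pair_measureI sets.top mW sets.sets_Collect_finite_All I)
      show "{x \<in> space ?N. x \<notin> E i} \<in> sets ?N" if "i \<in> I" for i
        using mE[OF that] by (simp add: set_diff_eq[symmetric] sets.compl_sets)
    qed
  qed
  also have "\<dots> \<le> measure ?N (\<Union>s\<in>S. space M \<times> W s) + measure ?N {x \<in> space ?N. \<forall>i\<in>I. x \<notin> E i}"
  proof (rule measure_Un_le)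
    show "(\<Union>s\<in>S. space M \<times> W s) \<in> sets ?N"
      by (intro sets.finite_UN S pair_measureI sets.top mW)
    show "{x \<in> space ?N. \<forall>i\<in>I. x \<notin> E i} \<in> sets ?N"
    proof (intro sets.sets_Collect_finite_All I)
      show "{x \<in> space ?N. x \<notin> E i} \<in> sets ?N" if "i \<in> I" for i
        using mE[OF that] by (simp add: set_diff_eq[symmetric] sets.compl_sets)
    qed
  qed
  also have "measure ?N (\<Union>s\<in>S. space M \<times> W s) \<le> (\<Sum>s\<in>S. measure ?N (space M \<times> W s))"
    by (rule measure_UNION_le[OF S]) (auto intro!: mW)
  also have "\<dots> \<le> (\<Sum>s\<in>S. normal_tail_const m * (\<tau> / (\<epsilon> / 2)\<^sup>2) ^ m)"
    by (rule sum_mono) (rule pW)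
  also have "\<dots> = card S * (normal_tail_const m * (\<tau> / (\<epsilon> / 2)\<^sup>2) ^ m)" by simp
  finally show ?thesis using none' unfolding p_def by linarith
qed

section \<open>Gram-Schmidt for bilinear forms\<close>

definition bilin :: "'i set \<Rightarrow> ('i \<Rightarrow> 'i \<Rightarrow> real) \<Rightarrow> ('i \<Rightarrow> real) \<Rightarrow> ('i \<Rightarrow> real) \<Rightarrow> real" where
  "bilin J c a b = (\<Sum>i\<in>J. \<Sum>j\<in>J. a i * c i j * b j)"

lemma bilin_add_left: "bilin J c (\<lambda>i. a i + a' i) b = bilin J c a b + bilin J c a' b"
  by (simp add: bilin_def distrib_right sum.distrib)

lemma bilin_diff_left: "bilin J c (\<lambda>i. a i - a' i) b = bilin J c a b - bilin J c a' b"
  by (simp add: bilin_def left_diff_distrib sum_subtractf)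

lemma bilin_scale_left: "bilin J c (\<lambda>i. r * a i) b = r * bilin J c a b"
  by (simp add: bilin_def sum_distrib_left mult.assoc)

lemma bilin_sym: "(\<And>i j. c i j = c j i) \<Longrightarrow> bilin J c a b = bilin J c b a"
  unfolding bilin_def by (subst sum.swap) (simp add: mult_ac)

lemma bilin_sum_left: "finite S \<Longrightarrow> bilin J c (\<lambda>i. \<Sum>s\<in>S. r s * a s i) b = (\<Sum>s\<in>S. r s * bilin J c (a s) b)"
  by (induction S rule: finite_induct)
    (simp_all add: bilin_add_left bilin_scale_left, simp add: bilin_def)

lemma bilin_cong: "(\<And>i. i \<in> J \<Longrightarrow> a i = a' i) \<Longrightarrow> (\<And>i. i \<in> J \<Longrightarrow> b i = b' i) \<Longrightarrow> bilin J c a b = bilin J c a' b'"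
  by (simp add: bilin_def cong: sum.cong)

text \<open>Keeping the support of each vector inside \<open>S\<close> makes the residual of the
  next basis vector non-zero, so positivity of the form allows its normalisation. The last clause,
  expanding the basis vectors in the new ones, is what later recovers the original variables from
  the orthonormal ones.\<close>

lemma gram_schmidt_finite:
  fixes c :: "'i \<Rightarrow> 'i \<Rightarrow> real"
  assumes J: "finite J" and sym: "\<And>i j. c i j = c j i"
    and pos: "\<forall>a. (\<exists>i\<in>J. a i \<noteq> 0) \<longrightarrow> 0 < bilin J c a a" and S: "S \<subseteq> J"
  shows "\<exists>q. (\<forall>s\<in>S. \<forall>i. i \<notin> S \<longrightarrow> q s i = 0) \<and>
    (\<forall>s\<in>S. \<forall>s'\<in>S. bilin J c (q s) (q s') = (if s = s' then 1 else 0)) \<and>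
    (\<forall>s\<in>S. \<exists>b. \<forall>i. (if i = s then 1 else 0) = (\<Sum>s'\<in>S. b s' * q s' i))"
proof -
  have "finite S" using J S by (rule finite_subset[rotated])
  then show ?thesis using S
  proof (induction S)
    case empty then show ?case by simp
  next
    case (insert z S)
    have "S \<subseteq> J" using insert.prems by simp
    from insert.IH[OF this] obtain q
      where q: "(\<forall>s\<in>S. \<forall>i. i \<notin> S \<longrightarrow> q s i = 0) \<and>
        (\<forall>s\<in>S. \<forall>s'\<in>S. bilin J c (q s) (q s') = (if s = s' then 1 else 0)) \<and>
        (\<forall>s\<in>S. \<exists>b. \<forall>i. (if i = s then 1 else 0) = (\<Sum>s'\<in>S. b s' * q s' i))" by (elim exE)
    have q0: "q s i = 0" if "s \<in> S" "i \<notin> S" for s i using q that by blast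
    have qo: "bilin J c (q s) (q s') = (if s = s' then 1 else 0)" if "s \<in> S" "s' \<in> S" for s s'
      using conjunct1[OF conjunct2[OF q]] that by blast
    have qe: "\<exists>b. \<forall>i. (if i = s then 1 else 0) = (\<Sum>s'\<in>S. b s' * q s' i)" if "s \<in> S" for s
      using conjunct2[OF conjunct2[OF q]] that by blast
    define d where "d i = (if i = z then 1 else 0 :: real)" for i
    define r where "r s = bilin J c d (q s)" for s
    define u where "u i = d i - (\<Sum>s\<in>S. r s * q s i)" for i
    \<comment> \<open>No earlier vector has a component at \<open>z\<close>, so the projection
      leaves that coefficient untouched.\<close>
    have uz: "u z = 1" using q0 insert.hyps by (auto simp: u_def d_def intro!: sum.neutral)
    have upos: "0 < bilin J c u u" using pos[rule_format, of u] uz insert.prems by force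
    define n where "n = sqrt (bilin J c u u)"
    have n: "n > 0" "n * n = bilin J c u u" using upos by (auto simp: n_def)
    have uo: "bilin J c u (q s) = 0" if "s \<in> S" for s
    proof -
      have "bilin J c u (q s) = r s - (\<Sum>s'\<in>S. r s' * bilin J c (q s') (q s))"
        unfolding u_def bilin_diff_left bilin_sum_left[OF insert.hyps(1)] r_def ..
      also have "(\<Sum>s'\<in>S. r s' * bilin J c (q s') (q s)) = (\<Sum>s'\<in>S. if s' = s then r s' else 0)"
        by (rule sum.cong) (simp_all add: qo that)
      also have "\<dots> = r s" using that insert.hyps by simp
      finally show ?thesis by simp
    qed
    define q' where "q' s = (if s = z then (\<lambda>i. (1 / n) * u i) else q s)" for s
    have q'S: "q' s = q s" if "s \<in> S" for s using that insert.hyps by (auto simp: q'_def)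
    have q'z: "q' z = (\<lambda>i. (1 / n) * u i)" by (simp add: q'_def)
    have zz: "bilin J c (q' z) (q' z) = 1"
    proof -
      have "bilin J c (q' z) (q' z) = (1 / n) * ((1 / n) * bilin J c u u)"
        unfolding q'z bilin_scale_left by (subst bilin_sym[OF sym]) (simp only: bilin_scale_left)
      also have "\<dots> = 1" using n by (simp flip: n(2))
      finally show ?thesis .
    qed
    have zs: "bilin J c (q' z) (q s) = 0" if "s \<in> S" for s
      unfolding q'z bilin_scale_left uo[OF that] by simp
    have sz: "bilin J c (q s) (q' z) = 0" if "s \<in> S" for s
      using zs[OF that] by (subst bilin_sym[OF sym])
    have sup: "\<forall>s\<in>insert z S. \<forall>i. i \<notin> insert z S \<longrightarrow> q' s i = 0"
      using q0 by (auto simp: q'_def u_def d_def)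
    have orth: "\<forall>s\<in>insert z S. \<forall>s'\<in>insert z S. bilin J c (q' s) (q' s') = (if s = s' then 1 else 0)"
      using zz zs sz qo insert.hyps by (auto simp: q'S)
    have "\<exists>b. \<forall>i. (if i = s then 1 else 0) = (\<Sum>s'\<in>insert z S. b s' * q' s' i)" if s: "s \<in> insert z S" for s
    proof (cases "s = z")
      case True
      define b where "b s' = (if s' = z then n else r s')" for s'
      have "(\<Sum>s'\<in>insert z S. b s' * q' s' i) = u i + (\<Sum>s'\<in>S. r s' * q s' i)" for i
      proof -
        have "(\<Sum>s'\<in>S. b s' * q' s' i) = (\<Sum>s'\<in>S. r s' * q s' i)"
          by (rule sum.cong) (use insert.hyps in \<open>auto simp: b_def q'S\<close>)
        then show ?thesis using insert.hyps n by (simp add: b_def q'z)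
      qed
      then have "\<forall>i. (if i = s then 1 else 0) = (\<Sum>s'\<in>insert z S. b s' * q' s' i)"
        using True by (simp add: u_def d_def)
      then show ?thesis by blast
    next
      case False
      then obtain b where b: "\<And>i. (if i = s then 1 else 0) = (\<Sum>s'\<in>S. b s' * q s' i)"
        using qe[of s] s by auto
      define b' where "b' s' = (if s' = z then 0 else b s')" for s'
      have "(\<Sum>s'\<in>insert z S. b' s' * q' s' i) = (\<Sum>s'\<in>S. b s' * q s' i)" for i
      proof -
        have "(\<Sum>s'\<in>S. b' s' * q' s' i) = (\<Sum>s'\<in>S. b s' * q s' i)"
          by (rule sum.cong) (use insert.hyps in \<open>auto simp: b'_def q'S\<close>)
        then show ?thesis using insert.hyps by (simp add: b'_def)
      qed
      then show ?thesis using b by metis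
    qed
    then show ?case using sup orth by blast
  qed
qed

text \<open>Orthonormality identifies the coefficients of the expansion as values of the form, which
  makes them boundable by the entries of \<open>c\<close>.\<close>

lemma gram_schmidt:
  fixes c :: "'i \<Rightarrow> 'i \<Rightarrow> real"
  assumes J: "finite J" and sym: "\<And>i j. c i j = c j i"
    and pos: "\<forall>a. (\<exists>i\<in>J. a i \<noteq> 0) \<longrightarrow> 0 < bilin J c a a"
  shows "\<exists>q. (\<forall>s\<in>J. \<forall>s'\<in>J. bilin J c (q s) (q s') = (if s = s' then 1 else 0)) \<and>
    (\<forall>s\<in>J. \<forall>i. (if i = s then 1 else 0) = (\<Sum>s'\<in>J. bilin J c (\<lambda>i. if i = s then 1 else 0) (q s') * q s' i))"
proof -
  obtain q where q: "(\<forall>s\<in>J. \<forall>i. i \<notin> J \<longrightarrow> q s i = 0) \<and>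
        (\<forall>s\<in>J. \<forall>s'\<in>J. bilin J c (q s) (q s') = (if s = s' then 1 else 0)) \<and>
        (\<forall>s\<in>J. \<exists>b. \<forall>i. (if i = s then 1 else 0) = (\<Sum>s'\<in>J. b s' * q s' i))"
    using gram_schmidt_finite[where c=c, OF J sym pos subset_refl] by (elim exE)
  have qo: "bilin J c (q s) (q s') = (if s = s' then 1 else 0)" if "s \<in> J" "s' \<in> J" for s s'
    using conjunct1[OF conjunct2[OF q]] that by blast
  have qe: "\<exists>b. \<forall>i. (if i = s then 1 else 0) = (\<Sum>s'\<in>J. b s' * q s' i)" if "s \<in> J" for s
    using conjunct2[OF conjunct2[OF q]] that by blast
  show ?thesis
  proof (intro exI[of _ q] conjI ballI allI, rule qo, assumption, assumption)
    fix s i assume s: "s \<in> J"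
    then obtain b where b: "\<And>i. (if i = s then 1 else 0) = (\<Sum>s'\<in>J. b s' * q s' i)" using qe by blast
    have "bilin J c (\<lambda>i. if i = s then 1 else 0) (q s') = b s'" if "s' \<in> J" for s'
    proof -
      have "bilin J c (\<lambda>i. if i = s then 1 else 0) (q s') = bilin J c (\<lambda>i. \<Sum>s'\<in>J. b s' * q s' i) (q s')"
        using b by (intro bilin_cong) auto
      also have "\<dots> = (\<Sum>s''\<in>J. b s'' * bilin J c (q s'') (q s'))" by (rule bilin_sum_left[OF J])
      also have "\<dots> = (\<Sum>s''\<in>J. if s'' = s' then b s'' else 0)" by (rule sum.cong) (simp_all add: qo that)
      also have "\<dots> = b s'" using J that by simp
      finally show ?thesis .
    qed
    then show "(if i = s then 1 else 0) = (\<Sum>s'\<in>J. bilin J c (\<lambda>i. if i = s then 1 else 0) (q s') * q s' i)"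
      using b[of i] by simp
  qed
qed

text \<open>In an orthonormal basis the form is a sum of squares of coordinates, and Cauchy-Schwarz
  bounds the original coordinates by these. This gives an explicit constant in place of a
  compactness argument on the sphere.\<close>

lemma bilin_coercive:
  fixes c :: "'i \<Rightarrow> 'i \<Rightarrow> real"
  assumes J: "finite J" and sym: "\<And>i j. c i j = c j i"
    and pos: "\<forall>a. (\<exists>i\<in>J. a i \<noteq> 0) \<longrightarrow> 0 < bilin J c a a"
  shows "\<exists>l>0. \<forall>a. l * (\<Sum>i\<in>J. (a i)\<^sup>2) \<le> bilin J c a a"
proof -
  obtain q where q: "(\<forall>s\<in>J. \<forall>s'\<in>J. bilin J c (q s) (q s') = (if s = s' then 1 else 0)) \<and>
    (\<forall>s\<in>J. \<forall>i. (if i = s then 1 else 0) = (\<Sum>s'\<in>J. bilin J c (\<lambda>i. if i = s then 1 else 0) (q s') * q s' i))"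
    using gram_schmidt[where c=c, OF J sym pos] by (elim exE)
  have qo: "bilin J c (q s) (q s') = (if s = s' then 1 else 0)" if "s \<in> J" "s' \<in> J" for s s'
    using conjunct1[OF q] that by blast
  have qe: "(if i = s then 1 else 0) = (\<Sum>s'\<in>J. bilin J c (\<lambda>i. if i = s then 1 else 0) (q s') * q s' i)" if "s \<in> J" for s i
    using conjunct2[OF q] that by blast
  \<comment> \<open>The summand 1 keeps \<open>D\<close> positive even for empty
    \<open>J\<close>.\<close>
  define D where "D = 1 + (\<Sum>i\<in>J. \<Sum>s\<in>J. (q s i)\<^sup>2)"
  have D: "D \<ge> 1" by (auto simp: D_def intro!: sum_nonneg)
  have "(\<Sum>i\<in>J. (a i)\<^sup>2) \<le> D * bilin J c a a" for a
  proof -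
    define \<alpha> where "\<alpha> s' = (\<Sum>s\<in>J. a s * bilin J c (\<lambda>i. if i = s then 1 else 0) (q s'))" for s'
    have ex: "a i = (\<Sum>s\<in>J. \<alpha> s * q s i)" if "i \<in> J" for i
    proof -
      have "a i = (\<Sum>s\<in>J. a s * (if i = s then 1 else 0))"
      proof -
        have "(\<Sum>s\<in>J. a s * (if i = s then 1 else 0)) = (\<Sum>s\<in>J. if i = s then a s else 0)"
          by (rule sum.cong) auto
        then show ?thesis using J that by simp
      qed
      also have "\<dots> = (\<Sum>s\<in>J. \<Sum>s'\<in>J. a s * bilin J c (\<lambda>i. if i = s then 1 else 0) (q s') * q s' i)"
        by (rule sum.cong[OF refl], subst qe, assumption) (simp only: sum_distrib_left mult.assoc)
      also have "\<dots> = (\<Sum>s\<in>J. \<alpha> s * q s i)"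
        unfolding \<alpha>_def by (subst sum.swap) (simp add: sum_distrib_right)
      finally show ?thesis .
    qed
    have caa: "bilin J c a a = (\<Sum>s\<in>J. (\<alpha> s)\<^sup>2)"
    proof -
      have "bilin J c a a = bilin J c (\<lambda>i. \<Sum>s\<in>J. \<alpha> s * q s i) a" by (rule bilin_cong) (auto simp: ex)
      also have "\<dots> = (\<Sum>s\<in>J. \<alpha> s * bilin J c (q s) a)" by (rule bilin_sum_left[OF J])
      also have "\<dots> = (\<Sum>s\<in>J. (\<alpha> s)\<^sup>2)"
      proof (rule sum.cong[OF refl])
        fix s assume s: "s \<in> J"
        have "bilin J c (q s) a = bilin J c a (q s)" by (rule bilin_sym[OF sym])
        also have "\<dots> = bilin J c (\<lambda>i. \<Sum>s\<in>J. \<alpha> s * q s i) (q s)" by (rule bilin_cong) (auto simp: ex)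
        also have "\<dots> = (\<Sum>s'\<in>J. \<alpha> s' * bilin J c (q s') (q s))" by (rule bilin_sum_left[OF J])
        also have "\<dots> = (\<Sum>s'\<in>J. if s' = s then \<alpha> s' else 0)" by (rule sum.cong) (simp_all add: qo s)
        also have "\<dots> = \<alpha> s" using J s by simp
        finally show "\<alpha> s * bilin J c (q s) a = (\<alpha> s)\<^sup>2" by (simp add: power2_eq_square)
      qed
      finally show ?thesis .
    qed
    have "(\<Sum>i\<in>J. (a i)\<^sup>2) \<le> (\<Sum>i\<in>J. (\<Sum>s\<in>J. (\<alpha> s)\<^sup>2) * (\<Sum>s\<in>J. (q s i)\<^sup>2))"
      by (rule sum_mono) (simp add: ex Cauchy_Schwarz_ineq_sum)
    also have "\<dots> = bilin J c a a * (D - 1)" by (simp add: caa D_def sum_distrib_left)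
    also have "\<dots> \<le> bilin J c a a * D" by (rule mult_left_mono) (auto simp: caa intro!: sum_nonneg)
    finally show ?thesis by (simp add: mult.commute)
  qed
  then show ?thesis using D by (intro exI[of _ "1 / D"]) (auto simp: field_simps)
qed

section \<open>Gaussian spaces and differentiation\<close>

text \<open>The elements are functions and not classes modulo null sets, because limits will be
  taken pointwise on the sample space.\<close>

definition gaussian_space :: "'w measure \<Rightarrow> ('w \<Rightarrow> real) set \<Rightarrow> bool" where
  "gaussian_space M G \<longleftrightarrow> (\<lambda>_. 0) \<in> G \<and> (\<forall>Y\<in>G. centered_normal M Y) \<and>
     (\<forall>Y\<in>G. \<forall>Z\<in>G. (\<lambda>\<omega>. Y \<omega> + Z \<omega>) \<in> G) \<and> (\<forall>Y\<in>G. \<forall>a. (\<lambda>\<omega>. a * Y \<omega>) \<in> G)"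

definition seq_closure :: "'w measure \<Rightarrow> ('w \<Rightarrow> real) set \<Rightarrow> ('w \<Rightarrow> real) set" where
  "seq_closure M G = {Y. \<exists>X. (\<forall>n::nat. X n \<in> G) \<and> (\<forall>\<omega>\<in>space M. (\<lambda>n. X n \<omega>) \<longlonglongrightarrow> Y \<omega>)}"

lemma seq_closureI:
  assumes "\<And>n::nat. X n \<in> G" "\<And>\<omega>. \<omega> \<in> space M \<Longrightarrow> (\<lambda>n. X n \<omega>) \<longlonglongrightarrow> Y \<omega>"
  shows "Y \<in> seq_closure M G"
  using assms unfolding seq_closure_def by (intro CollectI exI[of _ X]) auto

lemma seq_closureE:
  assumes "Y \<in> seq_closure M G"
  obtains X where "\<forall>n::nat. X n \<in> G" "\<forall>\<omega>\<in>space M. (\<lambda>n. X n \<omega>) \<longlonglongrightarrow> Y \<omega>"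
proof -
  from assms obtain X where X: "(\<forall>n::nat. X n \<in> G) \<and> (\<forall>\<omega>\<in>space M. (\<lambda>n. X n \<omega>) \<longlonglongrightarrow> Y \<omega>)"
    unfolding seq_closure_def by (elim CollectE exE)
  show thesis by (rule that[of X]) (use X in auto)
qed

lemma
  assumes "gaussian_space M G"
  shows gaussian_space_zero: "(\<lambda>_. 0) \<in> G"
    and gaussian_space_normal: "Y \<in> G \<Longrightarrow> centered_normal M Y"
    and gaussian_space_add: "Y \<in> G \<Longrightarrow> Z \<in> G \<Longrightarrow> (\<lambda>\<omega>. Y \<omega> + Z \<omega>) \<in> G"
    and gaussian_space_mult: "Y \<in> G \<Longrightarrow> (\<lambda>\<omega>. a * Y \<omega>) \<in> G"
  using assms by (auto simp: gaussian_space_def)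

lemma gaussian_space_diff:
  assumes "gaussian_space M G" "Y \<in> G" "Z \<in> G"
  shows "(\<lambda>\<omega>. Y \<omega> - Z \<omega>) \<in> G"
  using gaussian_space_add[OF assms(1,2) gaussian_space_mult[OF assms(1,3), of "-1"]] by simp

lemma gaussian_space_sum:
  assumes "gaussian_space M G" "finite S" "\<And>s. s \<in> S \<Longrightarrow> Y s \<in> G"
  shows "(\<lambda>\<omega>. \<Sum>s\<in>S. Y s \<omega>) \<in> G"
  using assms(2,3) by (induction S) (auto intro: gaussian_space_zero gaussian_space_add assms(1))

lemma seq_closure_superset: "G \<subseteq> seq_closure M G"
proof
  fix Y assume "Y \<in> G"
  then show "Y \<in> seq_closure M G" by (rule seq_closureI[of "\<lambda>_. Y"]) auto
qed

lemma gaussian_space_seq_closure: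
  assumes M: "prob_space M" and G: "gaussian_space M G"
  shows "gaussian_space M (seq_closure M G)"
  unfolding gaussian_space_def
proof (intro conjI ballI allI)
  show "(\<lambda>_. 0) \<in> seq_closure M G" using gaussian_space_zero[OF G] seq_closure_superset by blast
  show "centered_normal M Y" if Y: "Y \<in> seq_closure M G" for Y
  proof -
    obtain X where X: "\<forall>n. X n \<in> G" "\<forall>\<omega>\<in>space M. (\<lambda>n. X n \<omega>) \<longlonglongrightarrow> Y \<omega>"
      using Y by (rule seq_closureE)
    show ?thesis
      by (rule centered_normal_limit(1)[OF M gaussian_space_normal[OF G X(1)[rule_format]] X(2)[rule_format]])
  qed
  show "(\<lambda>\<omega>. Y \<omega> + Z \<omega>) \<in> seq_closure M G" if YZ: "Y \<in> seq_closure M G" "Z \<in> seq_closure M G" for Y Z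
  proof -
    obtain X where X: "\<forall>n. X n \<in> G" "\<forall>\<omega>\<in>space M. (\<lambda>n. X n \<omega>) \<longlonglongrightarrow> Y \<omega>"
      using YZ(1) by (rule seq_closureE)
    obtain X' where X': "\<forall>n. X' n \<in> G" "\<forall>\<omega>\<in>space M. (\<lambda>n. X' n \<omega>) \<longlonglongrightarrow> Z \<omega>"
      using YZ(2) by (rule seq_closureE)
    show ?thesis
      by (rule seq_closureI[OF gaussian_space_add[OF G X(1)[rule_format] X'(1)[rule_format]]
            tendsto_add[OF X(2)[rule_format] X'(2)[rule_format]]])
  qed
  show "(\<lambda>\<omega>. a * Y \<omega>) \<in> seq_closure M G" if Y: "Y \<in> seq_closure M G" for Y a
  proof -
    obtain X where X: "\<forall>n. X n \<in> G" "\<forall>\<omega>\<in>space M. (\<lambda>n. X n \<omega>) \<longlonglongrightarrow> Y \<omega>"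
      using Y by (rule seq_closureE)
    show ?thesis
      by (rule seq_closureI[OF gaussian_space_mult[OF G X(1)[rule_format]] tendsto_mult_left[OF X(2)[rule_format]]])
  qed
qed

text \<open>Polarization expresses the covariance through variances of sums and differences, which
  converge by \<open>centered_normal_limit\<close>.\<close>

lemma gaussian_space_cov_limit:
  assumes M: "prob_space M" and G: "gaussian_space M G" and X: "\<And>n. X n \<in> G" and Z: "Z \<in> G"
    and lim: "\<And>\<omega>. \<omega> \<in> space M \<Longrightarrow> (\<lambda>n. X n \<omega>) \<longlonglongrightarrow> Y \<omega>"
  shows "(\<lambda>n. \<integral>\<omega>. X n \<omega> * Z \<omega> \<partial>M) \<longlonglongrightarrow> (\<integral>\<omega>. Y \<omega> * Z \<omega> \<partial>M)"
proof -
  note N = gaussian_space_normal[OF G] and NN = gaussian_space_normal[OF gaussian_space_seq_closure[OF M G]]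
  have Y: "Y \<in> seq_closure M G" by (rule seq_closureI[OF X lim])
  have Z': "Z \<in> seq_closure M G" using Z seq_closure_superset by blast
  have pol: "(\<integral>\<omega>. A \<omega> * B \<omega> \<partial>M) = ((\<integral>\<omega>. (A \<omega> + B \<omega>)\<^sup>2 \<partial>M) - (\<integral>\<omega>. (A \<omega> - B \<omega>)\<^sup>2 \<partial>M)) / 4"
    if "A \<in> seq_closure M G" "B \<in> seq_closure M G" for A B
  proof -
    note GG = gaussian_space_seq_closure[OF M G]
    have "integrable M (\<lambda>\<omega>. (A \<omega> + B \<omega>)\<^sup>2)" "integrable M (\<lambda>\<omega>. (A \<omega> - B \<omega>)\<^sup>2)"
      using centered_normal_integrable_power[OF M NN[OF gaussian_space_add[OF GG that]], of 2]
        centered_normal_integrable_power[OF M NN[OF gaussian_space_diff[OF GG that]], of 2] by auto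
    then have "(\<integral>\<omega>. (A \<omega> + B \<omega>)\<^sup>2 \<partial>M) - (\<integral>\<omega>. (A \<omega> - B \<omega>)\<^sup>2 \<partial>M) = (\<integral>\<omega>. (A \<omega> + B \<omega>)\<^sup>2 - (A \<omega> - B \<omega>)\<^sup>2 \<partial>M)"
      by simp
    also have "\<dots> = (\<integral>\<omega>. 4 * (A \<omega> * B \<omega>) \<partial>M)"
      by (rule arg_cong[where f="integral\<^sup>L M"]) (auto simp: power2_eq_square algebra_simps)
    finally show ?thesis by simp
  qed
  have 1: "(\<lambda>n. \<integral>\<omega>. (X n \<omega> + Z \<omega>)\<^sup>2 \<partial>M) \<longlonglongrightarrow> (\<integral>\<omega>. (Y \<omega> + Z \<omega>)\<^sup>2 \<partial>M)"
    by (rule centered_normal_limit(2)[OF M]) (auto intro!: tendsto_intros lim N gaussian_space_add[OF G] X Z)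
  have 2: "(\<lambda>n. \<integral>\<omega>. (X n \<omega> - Z \<omega>)\<^sup>2 \<partial>M) \<longlonglongrightarrow> (\<integral>\<omega>. (Y \<omega> - Z \<omega>)\<^sup>2 \<partial>M)"
    by (rule centered_normal_limit(2)[OF M]) (auto intro!: tendsto_intros lim N gaussian_space_diff[OF G] X Z)
  have X': "X n \<in> seq_closure M G" for n using X seq_closure_superset by blast
  show ?thesis unfolding pol[OF X' Z'] pol[OF Y Z']
    by (rule tendsto_divide[OF tendsto_diff[OF 1 2] tendsto_const]) simp
qed

text \<open>Difference quotients lie in \<open>G\<close> and converge pointwise. Both claims apply
  the limit results to them, the second one along arbitrary sequences tending to 0.\<close>

lemma gaussian_space_deriv:
  assumes M: "prob_space M" and G: "gaussian_space M G" and d: "0 < d"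
    and P: "\<And>t. \<bar>t - a\<bar> < d \<Longrightarrow> P t \<in> G"
    and D: "\<And>\<omega>. \<omega> \<in> space M \<Longrightarrow> ((\<lambda>t. P t \<omega>) has_real_derivative P' \<omega>) (at a)"
  shows "P' \<in> seq_closure M G"
    and "Z \<in> G \<Longrightarrow> ((\<lambda>t. \<integral>\<omega>. P t \<omega> * Z \<omega> \<partial>M) has_real_derivative (\<integral>\<omega>. P' \<omega> * Z \<omega> \<partial>M)) (at a)"
proof -
  \<comment> \<open>The value 0 for large increments puts \<open>Q h\<close> into \<open>G\<close>
    for every h.\<close>
  define Q where "Q h = (if \<bar>h\<bar> < d then (\<lambda>\<omega>. (1 / h) * (P (a + h) \<omega> - P a \<omega>)) else (\<lambda>_. 0))" for h
  have QG: "Q h \<in> G" for h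
    using gaussian_space_mult[OF G gaussian_space_diff[OF G P[of "a + h"] P[of a]], of "1 / h"]
      gaussian_space_zero[OF G] d by (auto simp: Q_def)
  have Ql: "((\<lambda>h. Q h \<omega>) \<longlongrightarrow> P' \<omega>) (at 0)" if "\<omega> \<in> space M" for \<omega>
  proof (rule Lim_transform_eventually)
    show "((\<lambda>h. (P (a + h) \<omega> - P a \<omega>) / h) \<longlongrightarrow> P' \<omega>) (at 0)" using D[OF that] by (simp add: DERIV_def)
    show "\<forall>\<^sub>F h in at 0. (P (a + h) \<omega> - P a \<omega>) / h = Q h \<omega>"
      using d by (auto simp: eventually_at Q_def dist_real_def intro!: exI[of _ d])
  qed
  have seq: "(\<lambda>n. Q (h n) \<omega>) \<longlonglongrightarrow> P' \<omega>" if "h \<longlonglongrightarrow> 0" "\<And>n. h n \<noteq> 0" "\<omega> \<in> space M" for h \<omega>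
    using Ql[OF that(3)] that(1,2) unfolding tendsto_at_iff_sequentially by (auto simp: o_def)
  have "(\<lambda>n. 1 / real (Suc n)) \<longlonglongrightarrow> 0" by (rule LIMSEQ_Suc[OF lim_1_over_n])
  then show "P' \<in> seq_closure M G"
    by (intro seq_closureI[of "\<lambda>n. Q (1 / real (Suc n))"] QG seq) auto
  assume Z: "Z \<in> G"
  have "((\<lambda>h. \<integral>\<omega>. Q h \<omega> * Z \<omega> \<partial>M) \<longlongrightarrow> (\<integral>\<omega>. P' \<omega> * Z \<omega> \<partial>M)) (at 0)"
    unfolding tendsto_at_iff_sequentially o_def
  proof (intro allI impI)
    fix h :: "nat \<Rightarrow> real" assume "\<forall>i. h i \<in> UNIV - {0}" "h \<longlonglongrightarrow> 0"
    then show "(\<lambda>n. \<integral>\<omega>. Q (h n) \<omega> * Z \<omega> \<partial>M) \<longlonglongrightarrow> (\<integral>\<omega>. P' \<omega> * Z \<omega> \<partial>M)"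
      by (intro gaussian_space_cov_limit[OF M G QG Z] seq) auto
  qed
  then have "((\<lambda>h. ((\<integral>\<omega>. P (a + h) \<omega> * Z \<omega> \<partial>M) - (\<integral>\<omega>. P a \<omega> * Z \<omega> \<partial>M)) / h) \<longlongrightarrow> (\<integral>\<omega>. P' \<omega> * Z \<omega> \<partial>M)) (at 0)"
  proof (rule Lim_transform_eventually)
    have "(\<integral>\<omega>. Q h \<omega> * Z \<omega> \<partial>M) = ((\<integral>\<omega>. P (a + h) \<omega> * Z \<omega> \<partial>M) - (\<integral>\<omega>. P a \<omega> * Z \<omega> \<partial>M)) / h" if h: "\<bar>h\<bar> < d" for h
    proof -
      have i: "integrable M (\<lambda>\<omega>. P t \<omega> * Z \<omega>)" if "\<bar>t - a\<bar> < d" for t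
        by (rule centered_normal_integrable_mult[OF M]) (auto intro: gaussian_space_normal[OF G] P that Z)
      have "(\<integral>\<omega>. Q h \<omega> * Z \<omega> \<partial>M) = (\<integral>\<omega>. (P (a + h) \<omega> * Z \<omega> - P a \<omega> * Z \<omega>) / h \<partial>M)"
        using h by (simp add: Q_def left_diff_distrib diff_divide_distrib)
      then show ?thesis using i[of "a + h"] i[of a] h d by simp
    qed
    then show "\<forall>\<^sub>F h in at 0. (\<integral>\<omega>. Q h \<omega> * Z \<omega> \<partial>M) = ((\<integral>\<omega>. P (a + h) \<omega> * Z \<omega> \<partial>M) - (\<integral>\<omega>. P a \<omega> * Z \<omega> \<partial>M)) / h"
      using d by (auto simp: eventually_at dist_real_def intro!: exI[of _ d])
  qed
  then show "((\<lambda>t. \<integral>\<omega>. P t \<omega> * Z \<omega> \<partial>M) has_real_derivative (\<integral>\<omega>. P' \<omega> * Z \<omega> \<partial>M)) (at a)"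
    by (simp add: DERIV_def)
qed

text \<open>A mean value inequality in mean square. The increment Z = P s - P 0 is used as its own
  test variable: the scalar mean value theorem for t |-> E[P t * Z] bounds E[Z^2].\<close>

lemma gaussian_space_mean_value:
  assumes M: "prob_space M" and G: "gaussian_space M G" and s: "0 \<le> s" and B: "0 \<le> B"
    and P: "\<And>t. t \<in> {0..s} \<Longrightarrow> \<exists>d>0. \<forall>t'. \<bar>t' - t\<bar> < d \<longrightarrow> P t' \<in> G"
    and P': "\<And>t. t \<in> {0..s} \<Longrightarrow> P' t \<in> G"
    and D: "\<And>t \<omega>. t \<in> {0..s} \<Longrightarrow> \<omega> \<in> space M \<Longrightarrow> ((\<lambda>t. P t \<omega>) has_real_derivative P' t \<omega>) (at t)"
    and bd: "\<And>t. t \<in> {0..s} \<Longrightarrow> (\<integral>\<omega>. (P' t \<omega>)\<^sup>2 \<partial>M) \<le> B\<^sup>2"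
  shows "(\<integral>\<omega>. (P s \<omega> - P 0 \<omega>)\<^sup>2 \<partial>M) \<le> (s * B)\<^sup>2"
proof (cases "s = 0")
  case True then show ?thesis by simp
next
  case False
  with s have s0: "0 < s" by simp
  define Z where "Z \<omega> = P s \<omega> - P 0 \<omega>" for \<omega>
  define z where "z = (\<integral>\<omega>. (Z \<omega>)\<^sup>2 \<partial>M)"
  have PG: "P t \<in> G" if t: "t \<in> {0..s}" for t
  proof -
    obtain d where "d > 0" "\<forall>t'. \<bar>t' - t\<bar> < d \<longrightarrow> P t' \<in> G" using P[OF t] by blast
    then show ?thesis by simp
  qed
  have Z: "Z \<in> G" unfolding Z_def by (rule gaussian_space_diff[OF G PG PG]) (use s in auto)
  note N = gaussian_space_normal[OF G]
  have der: "((\<lambda>t. \<integral>\<omega>. P t \<omega> * Z \<omega> \<partial>M) has_real_derivative (\<integral>\<omega>. P' t \<omega> * Z \<omega> \<partial>M)) (at t)" if t: "t \<in> {0..s}" for t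
  proof -
    obtain d where "d > 0" "\<And>t'. \<bar>t' - t\<bar> < d \<Longrightarrow> P t' \<in> G" using P[OF t] by blast
    then show ?thesis by (rule gaussian_space_deriv(2)[OF M G]) (auto intro: D t Z)
  qed
  obtain t where t: "0 < t" "t < s" "(\<integral>\<omega>. P s \<omega> * Z \<omega> \<partial>M) - (\<integral>\<omega>. P 0 \<omega> * Z \<omega> \<partial>M) = (s - 0) * (\<integral>\<omega>. P' t \<omega> * Z \<omega> \<partial>M)"
    using MVT2[OF s0, of "\<lambda>t. \<integral>\<omega>. P t \<omega> * Z \<omega> \<partial>M" "\<lambda>t. \<integral>\<omega>. P' t \<omega> * Z \<omega> \<partial>M"] der by auto
  have i: "integrable M (\<lambda>\<omega>. P t \<omega> * Z \<omega>)" if "t \<in> {0..s}" for t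
    by (rule centered_normal_integrable_mult[OF M N[OF PG[OF that]] N[OF Z]])
  have "z = (\<integral>\<omega>. P s \<omega> * Z \<omega> - P 0 \<omega> * Z \<omega> \<partial>M)"
    unfolding z_def by (rule arg_cong[where f="integral\<^sup>L M"]) (auto simp: Z_def power2_eq_square algebra_simps)
  also have "\<dots> = s * (\<integral>\<omega>. P' t \<omega> * Z \<omega> \<partial>M)" using t i[of s] i[of 0] s by simp
  also have "\<dots> = (\<integral>\<omega>. (s * P' t \<omega>) * Z \<omega> \<partial>M)" by (simp add: mult.assoc)
  \<comment> \<open>By a b <= (a^2 + b^2) / 2, half of the second moment \<open>z\<close> reappears
    on the right and is absorbed at the end.\<close>
  also have "\<dots> \<le> (\<integral>\<omega>. (s\<^sup>2 * (P' t \<omega>)\<^sup>2 + (Z \<omega>)\<^sup>2) / 2 \<partial>M)"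
  proof (rule integral_mono)
    have t': "t \<in> {0..s}" using t by auto
    show "integrable M (\<lambda>\<omega>. s * P' t \<omega> * Z \<omega>)"
      using centered_normal_integrable_mult[OF M N[OF P'[OF t']] N[OF Z]] by (simp add: mult.assoc)
    show "integrable M (\<lambda>\<omega>. (s\<^sup>2 * (P' t \<omega>)\<^sup>2 + (Z \<omega>)\<^sup>2) / 2)"
      using centered_normal_integrable_power[OF M N[OF P'[OF t']], of 2] centered_normal_integrable_power[OF M N[OF Z], of 2] by simp
    show "s * P' t \<omega> * Z \<omega> \<le> (s\<^sup>2 * (P' t \<omega>)\<^sup>2 + (Z \<omega>)\<^sup>2) / 2" for \<omega>
      using sum_squares_bound[of "s * P' t \<omega>" "Z \<omega>"] by (simp add: power_mult_distrib)
  qed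
  also have "\<dots> = (s\<^sup>2 * (\<integral>\<omega>. (P' t \<omega>)\<^sup>2 \<partial>M) + z) / 2"
    using centered_normal_integrable_power[OF M N[OF P'], of t 2] centered_normal_integrable_power[OF M N[OF Z], of 2] t
    by (simp add: z_def)
  also have "\<dots> \<le> (s\<^sup>2 * B\<^sup>2 + z) / 2" using bd[of t] t by (intro divide_right_mono add_right_mono mult_left_mono) auto
  finally show ?thesis unfolding z_def Z_def by (simp add: power_mult_distrib)
qed

section \<open>Derivatives of a field inside its Gaussian span\<close>

definition lin_span :: "'a set \<Rightarrow> ('w \<Rightarrow> 'a \<Rightarrow> 'b::euclidean_space) \<Rightarrow> ('w \<Rightarrow> real) set" where
  "lin_span S X = {\<lambda>\<omega>. \<Sum>x\<in>T. a x \<bullet> X \<omega> x | T a. finite T \<and> T \<subseteq> S}"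

lemma lin_spanI: "finite T \<Longrightarrow> T \<subseteq> S \<Longrightarrow> (\<lambda>\<omega>. \<Sum>x\<in>T. a x \<bullet> X \<omega> x) \<in> lin_span S X"
  unfolding lin_span_def by (intro CollectI exI conjI) auto

lemma lin_spanE:
  assumes "Y \<in> lin_span S X"
  obtains T a where "finite T" "T \<subseteq> S" "Y = (\<lambda>\<omega>. \<Sum>x\<in>T. a x \<bullet> X \<omega> x)"
proof -
  from assms obtain T a where X: "Y = (\<lambda>\<omega>. \<Sum>x\<in>T. a x \<bullet> X \<omega> x) \<and> finite T \<and> T \<subseteq> S"
    unfolding lin_span_def by (elim CollectE exE)
  show thesis by (rule that[of T a]) (use X in auto)
qed

text \<open>The closures are counted because a pointwise limit of pointwise limits need not be a
  single pointwise limit. Each derivative costs one level.\<close>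

definition field_span :: "'w measure \<Rightarrow> 'a set \<Rightarrow> ('w \<Rightarrow> 'a \<Rightarrow> 'b::euclidean_space) \<Rightarrow> nat \<Rightarrow> ('w \<Rightarrow> real) set" where
  "field_span M S X n = (seq_closure M ^^ n) (lin_span S X)"

lemma gaussian_space_field_span:
  assumes M: "prob_space M" and X: "centered_gaussian_field M S X"
  shows "gaussian_space M (field_span M S X n)"
  unfolding field_span_def
proof (induction n)
  case 0
  let ?G = "lin_span S X"
  show ?case unfolding gaussian_space_def funpow_0
  proof (intro conjI ballI allI)
    show "(\<lambda>_. 0) \<in> ?G" using lin_spanI[of "{}" S _ X] by simp
    show "centered_normal M Y" if "Y \<in> ?G" for Y
      using that X by (elim lin_spanE) (simp add: centered_gaussian_field_def)
    show "(\<lambda>\<omega>. c * Y \<omega>) \<in> ?G" if Y: "Y \<in> ?G" for Y c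
    proof -
      obtain T a where T: "finite T" "T \<subseteq> S" "Y = (\<lambda>\<omega>. \<Sum>x\<in>T. a x \<bullet> X \<omega> x)" using Y by (rule lin_spanE)
      then have "(\<lambda>\<omega>. c * Y \<omega>) = (\<lambda>\<omega>. \<Sum>x\<in>T. (c *\<^sub>R a x) \<bullet> X \<omega> x)" by (simp add: sum_distrib_left)
      then show ?thesis using lin_spanI[OF T(1,2), of "\<lambda>x. c *\<^sub>R a x" X] by simp
    qed
    show "(\<lambda>\<omega>. Y \<omega> + Z \<omega>) \<in> ?G" if YZ: "Y \<in> ?G" "Z \<in> ?G" for Y Z
    proof -
      obtain T a where T: "finite T" "T \<subseteq> S" "Y = (\<lambda>\<omega>. \<Sum>x\<in>T. a x \<bullet> X \<omega> x)" using YZ(1) by (rule lin_spanE)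
      obtain T' a' where T': "finite T'" "T' \<subseteq> S" "Z = (\<lambda>\<omega>. \<Sum>x\<in>T'. a' x \<bullet> X \<omega> x)" using YZ(2) by (rule lin_spanE)
      define b where "b x = (if x \<in> T then a x else 0) + (if x \<in> T' then a' x else 0)" for x
      have "(\<lambda>\<omega>. Y \<omega> + Z \<omega>) = (\<lambda>\<omega>. \<Sum>x\<in>T \<union> T'. b x \<bullet> X \<omega> x)"
      proof
        fix \<omega>
        have "(\<Sum>x\<in>T \<union> T'. b x \<bullet> X \<omega> x) = (\<Sum>x\<in>T \<union> T'. (if x \<in> T then a x else 0) \<bullet> X \<omega> x) + (\<Sum>x\<in>T \<union> T'. (if x \<in> T' then a' x else 0) \<bullet> X \<omega> x)"
          by (simp add: b_def inner_add_left sum.distrib)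
        also have "(\<Sum>x\<in>T \<union> T'. (if x \<in> T then a x else 0) \<bullet> X \<omega> x) = Y \<omega>"
          unfolding T(3) by (rule sum.mono_neutral_cong_right) (use T T' in auto)
        also have "(\<Sum>x\<in>T \<union> T'. (if x \<in> T' then a' x else 0) \<bullet> X \<omega> x) = Z \<omega>"
          unfolding T'(3) by (rule sum.mono_neutral_cong_right) (use T T' in auto)
        finally show "Y \<omega> + Z \<omega> = (\<Sum>x\<in>T \<union> T'. b x \<bullet> X \<omega> x)" by simp
      qed
      then show ?thesis using lin_spanI[of "T \<union> T'" S b X] T(1,2) T'(1,2) by simp
    qed
  qed
next
  case (Suc n)
  then show ?case using gaussian_space_seq_closure[OF M] by simp
qed

lemma field_span_Suc: "field_span M S X (Suc n) = seq_closure M (field_span M S X n)"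
  by (simp add: field_span_def)

lemma field_span_mono: "m \<le> n \<Longrightarrow> field_span M S X m \<subseteq> field_span M S X n"
proof (induction n)
  case (Suc n)
  then show ?case using seq_closure_superset by (cases "m = Suc n") (auto simp: field_span_Suc)
qed simp

lemma field_span_base:
  fixes X :: "'w \<Rightarrow> 'a \<Rightarrow> real^'k"
  assumes "x \<in> S"
  shows "(\<lambda>\<omega>. X \<omega> x $ c) \<in> field_span M S X 0"
proof -
  have "(\<lambda>\<omega>. X \<omega> x $ c) = (\<lambda>\<omega>. \<Sum>y\<in>{x}. axis c 1 \<bullet> X \<omega> y)" by (simp add: inner_axis')
  also have "\<dots> \<in> lin_span S X" by (rule lin_spanI) (use assms in auto)
  finally show ?thesis by (simp add: field_span_def)
qed

lemma class_C_deriv: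
  fixes u :: "real^'d::finite \<Rightarrow> real^'k::finite"
  assumes "class_C q S u" "length js < q" "x + a *\<^sub>R axis j 1 \<in> S"
  shows "((\<lambda>t. iterated_partial js u (x + t *\<^sub>R axis j 1) $ c) has_real_derivative
    iterated_partial (j # js) u (x + a *\<^sub>R axis j 1) $ c) (at a)"
proof -
  have "(\<lambda>t. iterated_partial js u ((x + a *\<^sub>R axis j 1) + t *\<^sub>R axis j 1)) differentiable (at (0::real))"
    using assms by (simp add: class_C_def)
  then have "((\<lambda>t. iterated_partial js u ((x + a *\<^sub>R axis j 1) + t *\<^sub>R axis j 1)) has_vector_derivative
      iterated_partial (j # js) u (x + a *\<^sub>R axis j 1)) (at 0)"
    by (simp add: vector_derivative_works partial_deriv_def)
  from bounded_linear.has_vector_derivative[OF bounded_linear_vec_nth this, of c]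
  have "((\<lambda>t. iterated_partial js u (x + (t + a) *\<^sub>R axis j 1) $ c) has_real_derivative
      iterated_partial (j # js) u (x + a *\<^sub>R axis j 1) $ c) (at 0)"
    by (simp add: has_real_derivative_iff_has_vector_derivative scaleR_add_left ac_simps)
  then show ?thesis
    using DERIV_shift[of "\<lambda>t. iterated_partial js u (x + t *\<^sub>R axis j 1) $ c" _ 0 a] by simp
qed

lemma open_axis_segment:
  fixes S :: "(real^'d::finite) set"
  assumes "open S" "x + a *\<^sub>R axis j 1 \<in> S"
  obtains d where "d > 0" "\<forall>t. \<bar>t - a\<bar> < d \<longrightarrow> x + t *\<^sub>R axis j 1 \<in> S"
proof -
  obtain e where e: "e > 0" "ball (x + a *\<^sub>R axis j 1) e \<subseteq> S" using assms openE by blast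
  have "x + t *\<^sub>R axis j 1 \<in> S" if "\<bar>t - a\<bar> < e" for t
  proof -
    have "dist (x + a *\<^sub>R axis j 1) (x + t *\<^sub>R axis j 1) = norm ((t - a) *\<^sub>R (axis j 1 :: real^'d))"
      by (simp add: dist_norm norm_minus_commute algebra_simps)
    also have "\<dots> < e" using that by (simp add: norm_axis_1)
    finally show ?thesis using e(2) by auto
  qed
  with e(1) that show thesis by blast
qed

text \<open>A partial derivative is a pointwise limit of difference quotients of the preceding one,
  taken over points that remain in the open set \<open>S\<close>.\<close>

lemma iterated_partial_in_span:
  fixes X :: "'w \<Rightarrow> real^'d::finite \<Rightarrow> real^'k::finite"
  assumes M: "prob_space M" and X: "centered_gaussian_field M S X" and S: "open S"
    and C: "\<And>\<omega>. \<omega> \<in> space M \<Longrightarrow> class_C q S (X \<omega>)" and x: "x \<in> S" and js: "length js \<le> q"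
  shows "(\<lambda>\<omega>. iterated_partial js (X \<omega>) x $ c) \<in> field_span M S X (length js)"
  using x js
proof (induction js arbitrary: x)
  case Nil
  then show ?case using field_span_base by simp
next
  case (Cons j js)
  obtain d where d: "d > 0" "\<forall>t. \<bar>t - 0\<bar> < d \<longrightarrow> x + t *\<^sub>R axis j 1 \<in> S"
    by (rule open_axis_segment[OF S, of x 0 j]) (use Cons.prems in auto)
  have "(\<lambda>\<omega>. iterated_partial (j # js) (X \<omega>) (x + 0 *\<^sub>R axis j 1) $ c) \<in> seq_closure M (field_span M S X (length js))"
  proof (rule gaussian_space_deriv(1)[OF M gaussian_space_field_span[OF M X] d(1)])
    show "(\<lambda>\<omega>. iterated_partial js (X \<omega>) (x + t *\<^sub>R axis j 1) $ c) \<in> field_span M S X (length js)" if "\<bar>t - 0\<bar> < d" for t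
      using Cons d that by auto
    show "((\<lambda>t. iterated_partial js (X \<omega>) (x + t *\<^sub>R axis j 1) $ c) has_real_derivative
      iterated_partial (j # js) (X \<omega>) (x + 0 *\<^sub>R axis j 1) $ c) (at 0)" if "\<omega> \<in> space M" for \<omega>
      by (rule class_C_deriv[OF C[OF that]]) (use Cons.prems in auto)
  qed
  then show ?case by (simp add: field_span_Suc)
qed

text \<open>Only the factor at \<open>x\<close> is differentiated. The variable \<open>Z\<close> is
  arbitrary in the span, so that it can later be another derivative of the field at another
  point.\<close>

lemma iterated_partial_cov_deriv:
  fixes X :: "'w \<Rightarrow> real^'d::finite \<Rightarrow> real^'k::finite"
  assumes M: "prob_space M" and X: "centered_gaussian_field M S X" and S: "open S"
    and C: "\<And>\<omega>. \<omega> \<in> space M \<Longrightarrow> class_C q S (X \<omega>)" and x: "x \<in> S" and js: "length js < q"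
    and Z: "Z \<in> field_span M S X n"
  shows "((\<lambda>t. \<integral>\<omega>. iterated_partial js (X \<omega>) (x + t *\<^sub>R axis j 1) $ c * Z \<omega> \<partial>M) has_real_derivative
    (\<integral>\<omega>. iterated_partial (j # js) (X \<omega>) x $ c * Z \<omega> \<partial>M)) (at 0)"
proof -
  obtain d where d: "d > 0" "\<forall>t. \<bar>t - 0\<bar> < d \<longrightarrow> x + t *\<^sub>R axis j 1 \<in> S"
    by (rule open_axis_segment[OF S, of x 0 j]) (use x in auto)
  \<comment> \<open>A common level that contains both factors.\<close>
  define m where "m = max n (length js)"
  have "((\<lambda>t. \<integral>\<omega>. iterated_partial js (X \<omega>) (x + t *\<^sub>R axis j 1) $ c * Z \<omega> \<partial>M) has_real_derivative
    (\<integral>\<omega>. iterated_partial (j # js) (X \<omega>) (x + 0 *\<^sub>R axis j 1) $ c * Z \<omega> \<partial>M)) (at 0)"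
  proof (rule gaussian_space_deriv(2)[OF M gaussian_space_field_span[OF M X, where n=m] d(1)])
    show "(\<lambda>\<omega>. iterated_partial js (X \<omega>) (x + t *\<^sub>R axis j 1) $ c) \<in> field_span M S X m" if "\<bar>t - 0\<bar> < d" for t
    proof -
      have "x + t *\<^sub>R axis j 1 \<in> S" using d that by blast
      then show ?thesis
        using iterated_partial_in_span[OF M X S C _ less_imp_le[OF js]] field_span_mono[of "length js" m M S X]
        by (auto simp: m_def)
    qed
    show "((\<lambda>t. iterated_partial js (X \<omega>) (x + t *\<^sub>R axis j 1) $ c) has_real_derivative
      iterated_partial (j # js) (X \<omega>) (x + 0 *\<^sub>R axis j 1) $ c) (at 0)" if "\<omega> \<in> space M" for \<omega>
      by (rule class_C_deriv[OF C[OF that] js]) (use x in auto)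
    show "Z \<in> field_span M S X m" using Z field_span_mono[of n m M S X] by (auto simp: m_def)
  qed
  then show ?thesis by simp
qed

section \<open>Derivatives of the matrix-valued covariance kernel\<close>

text \<open>Turns integrals and derivatives of matrices into finite sums of scalar ones.\<close>

lemma matrix_decomp: "(\<chi> i j. a i j) = (\<Sum>i\<in>UNIV. \<Sum>j\<in>UNIV. a i j *\<^sub>R axis i (axis j (1::real)))"
proof (simp add: vec_eq_iff sum_component, intro allI)
  fix i j
  have "(\<Sum>i'\<in>UNIV. \<Sum>j'\<in>UNIV. a i' j' * (axis i' (axis j' (1::real)) $ i $ j)) =
    (\<Sum>i'\<in>UNIV. \<Sum>j'\<in>UNIV. if i' = i then if j' = j then a i j else 0 else 0)"
    by (intro sum.cong) (auto simp: axis_def)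
  also have "\<dots> = a i j" by (subst sum.swap) (simp add: sum.delta)
  finally show "a i j = (\<Sum>i'\<in>UNIV. \<Sum>j'\<in>UNIV. a i' j' * axis i' (axis j' 1) $ i $ j)" by simp
qed

lemma matrix_has_vector_derivative:
  fixes a :: "real \<Rightarrow> 'i::finite \<Rightarrow> 'j::finite \<Rightarrow> real"
  assumes "\<And>i j. ((\<lambda>t. a t i j) has_real_derivative b i j) (at x)"
  shows "((\<lambda>t. \<chi> i j. a t i j) has_vector_derivative (\<chi> i j. b i j)) (at x)"
  unfolding matrix_decomp using assms
  by (intro has_vector_derivative_sum)
    (auto simp: has_real_derivative_iff_has_vector_derivative
      intro!: bounded_linear.has_vector_derivative[OF bounded_linear_scaleR_left])

lemma partial_deriv_matrix_eq:
  fixes v :: "real^'d::finite \<Rightarrow> real^'j::finite^'i::finite"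
  assumes S: "open S" and y: "y \<in> S" and v: "\<And>y. y \<in> S \<Longrightarrow> v y = (\<chi> i j. a y i j)"
    and a: "\<And>i j. ((\<lambda>t. a (y + t *\<^sub>R axis k 1) i j) has_real_derivative b i j) (at 0)"
  shows "partial_deriv k v y = (\<chi> i j. b i j)"
  unfolding partial_deriv_def
proof (rule vector_derivative_at)
  obtain d where d: "d > 0" "\<forall>t. \<bar>t - 0\<bar> < d \<longrightarrow> y + t *\<^sub>R axis k 1 \<in> S"
    by (rule open_axis_segment[OF S, of y 0 k]) (use y in auto)
  have "((\<lambda>t. \<chi> i j. a (y + t *\<^sub>R axis k 1) i j) has_vector_derivative (\<chi> i j. b i j)) (at 0)"
    by (rule matrix_has_vector_derivative) (rule a)
  then show "((\<lambda>t. v (y + t *\<^sub>R axis k 1)) has_vector_derivative (\<chi> i j. b i j)) (at 0)"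
  proof (rule has_vector_derivative_transform_within_open)
    show "open (ball 0 d :: real set)" by simp
    show "(\<chi> i j. a (y + t *\<^sub>R axis k 1) i j) = v (y + t *\<^sub>R axis k 1)" if "t \<in> ball 0 d" for t
      using that d(2) by (subst v) (auto simp: dist_real_def)
  qed (use d in auto)
qed

lemma cov_kernel_nth:
  fixes X :: "'w \<Rightarrow> real^'d::finite \<Rightarrow> real^'k::finite"
  assumes M: "prob_space M" and X: "centered_gaussian_field M S X" and "x \<in> S" "y \<in> S"
  shows "cov_kernel M X x y = (\<chi> i j. \<integral>\<omega>. X \<omega> x $ i * X \<omega> y $ j \<partial>M)"
proof -
  note N = gaussian_space_normal[OF gaussian_space_field_span[OF M X] field_span_base]
  have i: "integrable M (\<lambda>\<omega>. X \<omega> x $ i * X \<omega> y $ j)" for i j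
    using assms by (intro centered_normal_integrable_mult[OF M] N)
  show ?thesis unfolding cov_kernel_def matrix_decomp
    by (simp add: Bochner_Integration.integral_sum Bochner_Integration.integrable_sum i)
qed

text \<open>Every partial derivative passes through the expectation by
  \<open>iterated_partial_cov_deriv\<close>. The derivatives in y come first, for all x in
  \<open>S\<close>, as in the nesting of \<open>mi_deriv2\<close>; those in x then act on the
  resulting expectations.\<close>

lemma iterated_partial_cov_kernel:
  fixes X :: "'w \<Rightarrow> real^'d::finite \<Rightarrow> real^'k::finite"
  assumes M: "prob_space M" and X: "centered_gaussian_field M S X" and S: "open S"
    and C: "\<And>\<omega>. \<omega> \<in> space M \<Longrightarrow> class_C q S (X \<omega>)"
    and x: "x \<in> S" and y: "y \<in> S" and js: "length js \<le> q" and ls: "length ls \<le> q"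
  shows "iterated_partial js (\<lambda>x. iterated_partial ls (cov_kernel M X x) y) x =
    (\<chi> i j. \<integral>\<omega>. iterated_partial js (X \<omega>) x $ i * iterated_partial ls (X \<omega>) y $ j \<partial>M)"
proof -
  have inner: "iterated_partial ls (cov_kernel M X x) y = (\<chi> i j. \<integral>\<omega>. X \<omega> x $ i * iterated_partial ls (X \<omega>) y $ j \<partial>M)"
    if "x \<in> S" "y \<in> S" for x y
    using ls that
  proof (induction ls arbitrary: y)
    case Nil then show ?case by (simp add: cov_kernel_nth[OF M X])
  next
    case (Cons k ls)
    have IH: "iterated_partial ls (cov_kernel M X x) y = (\<chi> i j. \<integral>\<omega>. X \<omega> x $ i * iterated_partial ls (X \<omega>) y $ j \<partial>M)"
      if "y \<in> S" for y using Cons that by simp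
    have "((\<lambda>t. \<integral>\<omega>. X \<omega> x $ i * iterated_partial ls (X \<omega>) (y + t *\<^sub>R axis k 1) $ j \<partial>M) has_real_derivative
        (\<integral>\<omega>. X \<omega> x $ i * iterated_partial (k # ls) (X \<omega>) y $ j \<partial>M)) (at 0)" for i j
      using iterated_partial_cov_deriv[OF M X S C Cons.prems(3) _ field_span_base[OF Cons.prems(2)], of ls k j i]
        Cons.prems by (simp add: mult.commute)
    from partial_deriv_matrix_eq[OF S Cons.prems(3) IH this] show ?case by simp
  qed
  show ?thesis using js x
  proof (induction js arbitrary: x)
    case Nil then show ?case using inner y by simp
  next
    case (Cons k js)
    have IH: "iterated_partial js (\<lambda>x. iterated_partial ls (cov_kernel M X x) y) x =
      (\<chi> i j. \<integral>\<omega>. iterated_partial js (X \<omega>) x $ i * iterated_partial ls (X \<omega>) y $ j \<partial>M)" if "x \<in> S" for x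
      using Cons that by simp
    have "((\<lambda>t. \<integral>\<omega>. iterated_partial js (X \<omega>) (x + t *\<^sub>R axis k 1) $ i * iterated_partial ls (X \<omega>) y $ j \<partial>M) has_real_derivative
        (\<integral>\<omega>. iterated_partial (k # js) (X \<omega>) x $ i * iterated_partial ls (X \<omega>) y $ j \<partial>M)) (at 0)" for i j
      by (rule iterated_partial_cov_deriv[OF M X S C Cons.prems(2) _ iterated_partial_in_span[OF M X S C y ls]])
        (use Cons.prems in auto)
    from partial_deriv_matrix_eq[OF S Cons.prems(2) IH this] show ?case by simp
  qed
qed

section \<open>Multi-indices as lists of directions\<close>

text \<open>Names the arbitrary order of differentiation that is hidden in \<open>mi_deriv\<close>,
  so that its length and multiplicities can be reasoned about.\<close>

definition mi_list :: "('d::finite \<Rightarrow> nat) \<Rightarrow> 'd list" where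
  "mi_list \<alpha> = (SOME js. \<forall>j. count_list js j = \<alpha> j)"

lemma count_mi_list: "count_list (mi_list \<alpha>) j = \<alpha> j"
proof -
  have "finite {x. 0 < \<alpha> x}" by simp
  then have "count (Abs_multiset \<alpha>) = \<alpha>" by (simp add: Abs_multiset_inverse)
  moreover obtain js where "mset js = Abs_multiset \<alpha>" using ex_mset by blast
  ultimately have "\<forall>j. count_list js j = \<alpha> j" by (metis count_mset)
  then have "\<forall>j. count_list (mi_list \<alpha>) j = \<alpha> j" unfolding mi_list_def by (rule someI)
  then show ?thesis by blast
qed

lemma length_mi_list: "length (mi_list \<alpha>) = mi_length \<alpha>"
proof -
  have "length (mi_list \<alpha>) = (\<Sum>j\<in>set (mi_list \<alpha>). count_list (mi_list \<alpha>) j)"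
    by (simp add: sum_count_set)
  also have "\<dots> = (\<Sum>j\<in>UNIV. count_list (mi_list \<alpha>) j)"
    by (rule sum.mono_neutral_left) (auto simp: count_list_0_iff)
  finally show ?thesis by (simp add: count_mi_list)
qed

lemma mi_deriv_eq: "mi_deriv \<alpha> = iterated_partial (mi_list \<alpha>)"
  by (simp add: mi_deriv_def mi_list_def)

definition mi_of_list :: "'d::finite list \<Rightarrow> 'd \<Rightarrow> nat" where
  "mi_of_list js = count_list js"

lemma mi_length_mi_of_list: "mi_length (mi_of_list js) = length js"
proof -
  have "length js = (\<Sum>j\<in>set js. count_list js j)" by (simp add: sum_count_set)
  also have "\<dots> = (\<Sum>j\<in>UNIV. count_list js j)"
    by (rule sum.mono_neutral_left) (auto simp: count_list_0_iff)
  finally show ?thesis by (simp add: mi_of_list_def)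
qed

lemma mset_mi_list_mi_of_list: "mset (mi_list (mi_of_list js)) = mset js"
  by (rule multiset_eqI) (simp add: count_mset count_mi_list mi_of_list_def)

lemma mi_list_Nil: "mi_list (mi_of_list []) = []"
  using mset_mi_list_mi_of_list[of "[]"] by simp

lemma mi_list_single: "mi_list (mi_of_list [j]) = [j]"
  using mset_mi_list_mi_of_list[of "[j]"] by simp

text \<open>The chosen order of a second derivative is determined only up to a swap. All later
  arguments have to work with either order.\<close>

lemma mi_list_pair: "mi_list (mi_of_list [i, j]) = [i, j] \<or> mi_list (mi_of_list [i, j]) = [j, i]"
proof -
  have m: "mset (mi_list (mi_of_list [i, j])) = {#i, j#}" using mset_mi_list_mi_of_list[of "[i, j]"] by simp
  then have "length (mi_list (mi_of_list [i, j])) = 2" by (metis size_mset size_add_mset size_single one_add_one plus_1_eq_Suc)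
  then obtain a b where ab: "mi_list (mi_of_list [i, j]) = [a, b]"
    by (metis (no_types, lifting) length_0_conv length_Suc_conv numeral_2_eq_2)
  then have "{#a, b#} = {#i, j#}" using m by simp
  then show ?thesis using ab by (auto simp: add_eq_conv_ex)
qed

lemma mi_deriv2_cov_kernel:
  fixes X :: "'w \<Rightarrow> real^'d::finite \<Rightarrow> real^'k::finite"
  assumes M: "prob_space M" and X: "centered_gaussian_field M S X" and S: "open S"
    and C: "\<And>\<omega>. \<omega> \<in> space M \<Longrightarrow> class_C q S (X \<omega>)"
    and x: "x \<in> S" and y: "y \<in> S" and js: "mi_length \<alpha> \<le> q" and ls: "mi_length \<beta> \<le> q"
  shows "mi_deriv2 \<alpha> \<beta> (cov_kernel M X) x y $ i $ j =
    (\<integral>\<omega>. mi_deriv \<alpha> (X \<omega>) x $ i * mi_deriv \<beta> (X \<omega>) y $ j \<partial>M)"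
  unfolding mi_deriv2_def mi_deriv_eq
  by (subst iterated_partial_cov_kernel[OF M X S C x y]) (use js ls in \<open>auto simp: length_mi_list\<close>)

section \<open>Chaining and zeros in cubes\<close>

definition dyadic :: "nat \<Rightarrow> ('k::finite \<Rightarrow> nat) \<Rightarrow> real^'k" where
  "dyadic l m = (\<chi> i. real (m i) / 2 ^ l)"

text \<open>The coordinates in \<open>D\<close> are raised one at a time, so the cost is one
  elementary increment for each of them.\<close>

lemma dyadic_step:
  fixes w :: "real^'k::finite \<Rightarrow> real"
  assumes b: "\<And>m i. (\<And>i. m i \<le> 2 ^ l) \<Longrightarrow> m i < 2 ^ l \<Longrightarrow>
      \<bar>w (dyadic l (m(i := Suc (m i)))) - w (dyadic l m)\<bar> \<le> b"
    and D: "finite D" and m: "\<And>i. m i + (if i \<in> D then 1 else 0) \<le> 2 ^ l"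
  shows "\<bar>w (dyadic l (\<lambda>i. m i + (if i \<in> D then 1 else 0))) - w (dyadic l m)\<bar> \<le> real (card D) * b"
  using D m
proof (induction D)
  case empty then show ?case by simp
next
  case (insert a D)
  let ?n = "\<lambda>i. m i + (if i \<in> D then 1 else 0)"
  have le: "?n i \<le> 2 ^ l" for i
  proof -
    have "?n i \<le> m i + (if i \<in> insert a D then 1 else 0)" by auto
    then show ?thesis using insert.prems[of i] by linarith
  qed
  have "?n a < 2 ^ l" using insert.prems[of a] insert.hyps by auto
  with le have "\<bar>w (dyadic l (?n(a := Suc (?n a)))) - w (dyadic l ?n)\<bar> \<le> b" by (rule b)
  moreover have "?n(a := Suc (?n a)) = (\<lambda>i. m i + (if i \<in> insert a D then 1 else 0))"
    using insert.hyps by (auto simp: fun_eq_iff)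
  moreover have "\<bar>w (dyadic l ?n) - w (dyadic l m)\<bar> \<le> real (card D) * b" by (rule insert.IH[OF le])
  ultimately show ?case using insert.hyps by (simp add: algebra_simps)
qed

text \<open>Halving all indices leads from a level to the coarser one: only the odd coordinates
  move, each by one elementary step, hence at most k increments are spent per level.\<close>

lemma dyadic_chaining:
  fixes w :: "real^'k::finite \<Rightarrow> real"
  assumes b: "\<And>l m i. (\<And>i. m i \<le> 2 ^ l) \<Longrightarrow> m i < 2 ^ l \<Longrightarrow>
      \<bar>w (dyadic l (m(i := Suc (m i)))) - w (dyadic l m)\<bar> \<le> b l"
    and b0: "\<And>l. 0 \<le> b l" and w0: "w 0 = 0" and m: "\<And>i. m i \<le> 2 ^ l"
  shows "\<bar>w (dyadic l m)\<bar> \<le> real CARD('k) * (\<Sum>l'\<le>l. b l')"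
  using m
proof (induction l arbitrary: m)
  case 0
  \<comment> \<open>At level 0 the points are the corners of the cube, reached from the origin by
    raising the coordinates equal to 1.\<close>
  define D where "D = {i. m i = 1}"
  have e: "m = (\<lambda>i. 0 + (if i \<in> D then 1 else 0))"
  proof
    fix i show "m i = 0 + (if i \<in> D then 1 else 0)" using 0[of i] by (auto simp: D_def)
  qed
  have "\<bar>w (dyadic 0 (\<lambda>i. 0 + (if i \<in> D then 1 else 0))) - w (dyadic 0 (\<lambda>i. 0))\<bar> \<le> real (card D) * b 0"
    by (rule dyadic_step[OF b]) auto
  moreover have "dyadic 0 (\<lambda>i::'k. 0) = 0" by (simp add: dyadic_def vec_eq_iff)
  ultimately have "\<bar>w (dyadic 0 m)\<bar> \<le> real (card D) * b 0" using e w0 by simp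
  also have "\<dots> \<le> real CARD('k) * b 0" by (intro mult_right_mono b0) (simp add: card_mono)
  finally show ?case by simp
next
  case (Suc l)
  define D where "D = {i. odd (m i)}"
  have e: "m = (\<lambda>i. 2 * (m i div 2) + (if i \<in> D then 1 else 0))"
    by (auto simp: D_def fun_eq_iff)
  have "\<bar>w (dyadic (Suc l) (\<lambda>i. 2 * (m i div 2) + (if i \<in> D then 1 else 0))) - w (dyadic (Suc l) (\<lambda>i. 2 * (m i div 2)))\<bar> \<le> real (card D) * b (Suc l)"
    by (rule dyadic_step[OF b]) (use Suc.prems in \<open>auto simp: D_def\<close>)
  moreover have "dyadic (Suc l) (\<lambda>i. 2 * (m i div 2)) = dyadic l (\<lambda>i. m i div 2)"
    by (simp add: dyadic_def vec_eq_iff)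
  moreover have "real (card D) * b (Suc l) \<le> real CARD('k) * b (Suc l)"
    by (intro mult_right_mono b0) (simp add: card_mono)
  moreover have "\<bar>w (dyadic l (\<lambda>i. m i div 2))\<bar> \<le> real CARD('k) * (\<Sum>l'\<le>l. b l')"
  proof (rule Suc.IH)
    show "m i div 2 \<le> 2 ^ l" for i using Suc.prems[of i] by simp
  qed
  ultimately show ?case using e by (simp add: distrib_left)
qed

text \<open>Rounding down each coordinate at level l gives dyadic points of the cube converging to
  t, and continuity carries the uniform bound over.\<close>

lemma dyadic_chaining_continuous:
  fixes w :: "real^'k::finite \<Rightarrow> real"
  assumes b: "\<And>l m i. (\<And>i. m i \<le> 2 ^ l) \<Longrightarrow> m i < 2 ^ l \<Longrightarrow>
      \<bar>w (dyadic l (m(i := Suc (m i)))) - w (dyadic l m)\<bar> \<le> b l"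
    and b0: "\<And>l. 0 \<le> b l" and w0: "w 0 = 0" and B: "\<And>l. (\<Sum>l'\<le>l. b l') \<le> B"
    and cont: "continuous_on {t. \<forall>i. 0 \<le> t $ i \<and> t $ i \<le> 1} w" and t: "\<And>i. 0 \<le> t $ i" "\<And>i. t $ i \<le> 1"
  shows "\<bar>w t\<bar> \<le> real CARD('k) * B"
proof -
  define m where "m l i = nat \<lfloor>t $ i * 2 ^ l\<rfloor>" for l i
  have rm: "real (m l i) = of_int \<lfloor>t $ i * 2 ^ l\<rfloor>" for l i using t by (simp add: m_def)
  have le: "real (m l i) \<le> t $ i * 2 ^ l" "t $ i * 2 ^ l - 1 \<le> real (m l i)" for l i
    unfolding rm by linarith+
  have m2: "m l i \<le> 2 ^ l" for l i
  proof -
    have "real (m l i) \<le> 1 * 2 ^ l" by (rule order_trans[OF le(1)]) (intro mult_right_mono t, simp)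
    then show ?thesis by (simp flip: of_nat_le_iff)
  qed
  have lim: "(\<lambda>l. dyadic l (m l)) \<longlonglongrightarrow> t"
  proof (rule vec_tendstoI)
    fix i
    show "(\<lambda>l. dyadic l (m l) $ i) \<longlonglongrightarrow> t $ i"
    proof (rule tendsto_sandwich)
      have "(\<lambda>l. t $ i - (1 / 2) ^ l) \<longlonglongrightarrow> t $ i - 0"
        by (intro tendsto_diff tendsto_const LIMSEQ_power_zero) simp
      then show "(\<lambda>l. t $ i - (1 / 2) ^ l) \<longlonglongrightarrow> t $ i" by simp
      show "(\<lambda>l. t $ i) \<longlonglongrightarrow> t $ i" by simp
      show "\<forall>\<^sub>F l in sequentially. t $ i - (1 / 2) ^ l \<le> dyadic l (m l) $ i"
      proof (intro always_eventually allI)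
        fix l
        have "t $ i - (1 / 2) ^ l = (t $ i * 2 ^ l - 1) / 2 ^ l" by (simp add: diff_divide_distrib power_one_over)
        also have "\<dots> \<le> real (m l i) / 2 ^ l" by (rule divide_right_mono[OF le(2)]) simp
        finally show "t $ i - (1 / 2) ^ l \<le> dyadic l (m l) $ i" by (simp add: dyadic_def)
      qed
      show "\<forall>\<^sub>F l in sequentially. dyadic l (m l) $ i \<le> t $ i"
        using le by (intro always_eventually allI) (simp add: dyadic_def field_simps)
    qed
  qed
  have "(\<lambda>l. w (dyadic l (m l))) \<longlonglongrightarrow> w t"
    by (rule continuous_on_tendsto_compose[OF cont lim])
      (use t m2 in \<open>auto simp: dyadic_def intro!: always_eventually simp flip: of_nat_le_iff\<close>)
  then have "(\<lambda>l. \<bar>w (dyadic l (m l))\<bar>) \<longlonglongrightarrow> \<bar>w t\<bar>" by (rule tendsto_rabs)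
  then show ?thesis
  proof (rule LIMSEQ_le_const2, intro exI allI impI)
    fix l
    have "\<bar>w (dyadic l (m l))\<bar> \<le> real CARD('k) * (\<Sum>l'\<le>l. b l')"
      by (rule dyadic_chaining[OF b b0 w0 m2])
    also have "\<dots> \<le> real CARD('k) * B" by (intro mult_left_mono B) simp
    finally show "\<bar>w (dyadic l (m l))\<bar> \<le> real CARD('k) * B" .
  qed
qed

section \<open>Zeros on a face of a cube by Brouwer's theorem\<close>

text \<open>With k components only k coordinates have to vary. For injective \<iota> this
  parametrises, by the k-dimensional unit cube, the face on which a zero is sought; all other
  coordinates stay fixed.\<close>

definition coord_embed :: "('k::finite \<Rightarrow> 'd::finite) \<Rightarrow> real^'k \<Rightarrow> real^'d" where
  "coord_embed \<iota> t = (\<Sum>i\<in>UNIV. t $ i *\<^sub>R axis (\<iota> i) 1)"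

lemma coord_embed_nth:
  assumes "inj \<iota>"
  shows "coord_embed \<iota> t $ \<iota> i = t $ i" "j \<notin> range \<iota> \<Longrightarrow> coord_embed \<iota> t $ j = 0"
proof -
  have "coord_embed \<iota> t $ \<iota> i = (\<Sum>i'\<in>UNIV. if i' = i then t $ i' else 0)"
    unfolding coord_embed_def sum_component by (rule sum.cong) (use assms in \<open>auto simp: axis_def inj_eq\<close>)
  then show "coord_embed \<iota> t $ \<iota> i = t $ i" by simp
  show "coord_embed \<iota> t $ j = 0" if "j \<notin> range \<iota>"
    unfolding coord_embed_def sum_component by (rule sum.neutral) (use that in \<open>auto simp: axis_def\<close>)
qed

lemma coord_embed_dyadic_Suc:
  "coord_embed \<iota> (dyadic l (m(i := Suc (m i)))) = coord_embed \<iota> (dyadic l m) + (1 / 2 ^ l) *\<^sub>R axis (\<iota> i) 1"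
proof -
  have "coord_embed \<iota> (dyadic l (m(i := Suc (m i)))) =
    (\<Sum>i'\<in>UNIV. dyadic l m $ i' *\<^sub>R axis (\<iota> i') 1 + (if i' = i then (1 / 2 ^ l) *\<^sub>R axis (\<iota> i) 1 else 0))"
    unfolding coord_embed_def
    by (rule sum.cong) (auto simp: dyadic_def add_divide_distrib scaleR_add_left)
  then show ?thesis by (simp add: sum.distrib coord_embed_def)
qed

text \<open>Over the cube, \<open>u\<close> is close to the affine map with zero at the centre; the fixed points of
  \<open>t - u / \<rho>\<close> are the zeros of \<open>u\<close>.\<close>

lemma zero_in_cube:
  fixes u :: "real^'d::finite \<Rightarrow> real^'k::finite" and \<iota> :: "'k \<Rightarrow> 'd"
  assumes \<rho>: "0 < \<rho>" and c: "0 \<le> c" "12 * real CARD('k) * c \<le> 1"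
    and cont: "continuous_on {x + \<rho> *\<^sub>R coord_embed \<iota> t | t. \<forall>i. 0 \<le> t $ i \<and> t $ i \<le> 1} u"
    and base: "\<And>i. \<bar>u x $ i + \<rho> / 2\<bar> \<le> c * \<rho>"
    and der: "\<And>i j. \<bar>D i j - (if i = j then 1 else 0)\<bar> \<le> c"
    and incr: "\<And>l m i j. (\<And>i. m i \<le> 2 ^ l) \<Longrightarrow> m j < 2 ^ l \<Longrightarrow>
      \<bar>u (x + \<rho> *\<^sub>R coord_embed \<iota> (dyadic l m) + (\<rho> / 2 ^ l) *\<^sub>R axis (\<iota> j) 1) $ i
         - u (x + \<rho> *\<^sub>R coord_embed \<iota> (dyadic l m)) $ i - \<rho> / 2 ^ l * D i j\<bar> \<le> c * \<rho> * (3 / 4) ^ l"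
  obtains t where "\<And>i. 0 \<le> t $ i" "\<And>i. t $ i \<le> 1" "u (x + \<rho> *\<^sub>R coord_embed \<iota> t) = 0"
proof -
  define K where "K = {t::real^'k. \<forall>i. 0 \<le> t $ i \<and> t $ i \<le> 1}"
  have Kbox: "K = cbox 0 (\<chi> i. 1)" by (auto simp: K_def mem_box_cart)
  have ce: "continuous_on K (\<lambda>t. x + \<rho> *\<^sub>R coord_embed \<iota> t)"
    unfolding coord_embed_def by (intro continuous_intros)
  have cu: "continuous_on K (\<lambda>t. u (x + \<rho> *\<^sub>R coord_embed \<iota> t))"
    by (rule continuous_on_compose2[OF cont ce]) (auto simp: K_def)
  \<comment> \<open>The deviation of \<open>u\<close> from an affine map with matrix
    \<open>D\<close>. The hypothesis on increments says precisely that the elementary dyadic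
    increments of \<open>w\<close> are small.\<close>
  define w where "w i t = u (x + \<rho> *\<^sub>R coord_embed \<iota> t) $ i - u x $ i - \<rho> * (\<Sum>j\<in>UNIV. D i j * t $ j)" for i t
  have wb: "\<bar>w i t\<bar> \<le> real CARD('k) * (4 * (c * \<rho>))" if t: "t \<in> K" for i t
  proof (rule dyadic_chaining_continuous[where b="\<lambda>l. c * \<rho> * (3 / 4) ^ l"])
    fix l and m :: "'k \<Rightarrow> nat" and j
    assume m: "\<And>i. m i \<le> 2 ^ l" "m j < 2 ^ l"
    have s: "(\<Sum>j'\<in>UNIV. D i j' * dyadic l (m(j := Suc (m j))) $ j') = (\<Sum>j'\<in>UNIV. D i j' * dyadic l m $ j') + D i j / 2 ^ l"
    proof -
      have "(\<Sum>j'\<in>UNIV. D i j' * dyadic l (m(j := Suc (m j))) $ j') =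
        (\<Sum>j'\<in>UNIV. D i j' * dyadic l m $ j' + (if j' = j then D i j / 2 ^ l else 0))"
        by (rule sum.cong) (auto simp: dyadic_def add_divide_distrib distrib_left)
      then show ?thesis by (simp add: sum.distrib)
    qed
    have e: "x + \<rho> *\<^sub>R coord_embed \<iota> (dyadic l (m(j := Suc (m j)))) =
      x + \<rho> *\<^sub>R coord_embed \<iota> (dyadic l m) + (\<rho> / 2 ^ l) *\<^sub>R axis (\<iota> j) 1"
      by (simp add: coord_embed_dyadic_Suc scaleR_add_right add.assoc)
    have "w i (dyadic l (m(j := Suc (m j)))) - w i (dyadic l m) =
      u (x + \<rho> *\<^sub>R coord_embed \<iota> (dyadic l m) + (\<rho> / 2 ^ l) *\<^sub>R axis (\<iota> j) 1) $ i
         - u (x + \<rho> *\<^sub>R coord_embed \<iota> (dyadic l m)) $ i - \<rho> / 2 ^ l * D i j"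
      unfolding w_def s e by (simp add: algebra_simps)
    then show "\<bar>w i (dyadic l (m(j := Suc (m j)))) - w i (dyadic l m)\<bar> \<le> c * \<rho> * (3 / 4) ^ l"
      using incr[where m=m and l=l and i=i and j=j, OF m] by simp
  next
    show "0 \<le> c * \<rho> * (3 / 4) ^ l" for l using c \<rho> by simp
    show "w i 0 = 0" by (simp add: w_def coord_embed_def)
    show "(\<Sum>l'\<le>l. c * \<rho> * (3 / 4) ^ l') \<le> 4 * (c * \<rho>)" for l
    proof -
      have "(\<Sum>l'\<le>l. (3 / 4 :: real) ^ l') \<le> 4"
        by (subst lessThan_Suc_atMost[symmetric], subst geometric_sum) auto
      then have "c * \<rho> * (\<Sum>l'\<le>l. (3 / 4 :: real) ^ l') \<le> c * \<rho> * 4" using c \<rho> by (intro mult_left_mono) auto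
      then show ?thesis by (simp add: sum_distrib_left mult_ac)
    qed
    show "continuous_on {t. \<forall>i. 0 \<le> t $ i \<and> t $ i \<le> 1} (w i)"
      using cu unfolding w_def[abs_def] K_def[symmetric] by (intro continuous_intros)
  qed (use t in \<open>auto simp: K_def\<close>)
  define T where "T t = t - (1 / \<rho>) *\<^sub>R u (x + \<rho> *\<^sub>R coord_embed \<iota> t)" for t
  have "\<exists>t\<in>K. T t = t"
  proof (rule brouwer[of K T])
    show "compact K" "convex K" unfolding Kbox by auto
    show "K \<noteq> {}" by (auto simp: K_def intro!: exI[of _ 0])
    show "continuous_on K T" unfolding T_def by (intro continuous_intros cu)
    show "T \<in> K \<rightarrow> K"
    proof
      fix t assume t: "t \<in> K"
      \<comment> \<open>The error budget behind the constant 12: in units of \<rho>, chaining costs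
        4kc, the base value at most kc and the matrix kc. The total 6kc is at most 1/2, so
        \<open>T\<close> maps the cube into itself.\<close>
      have "\<bar>T t $ i - 1 / 2\<bar> \<le> 1 / 2" for i
      proof -
        have sj: "\<bar>\<Sum>j\<in>UNIV. (D i j - (if i = j then 1 else 0)) * t $ j\<bar> \<le> real CARD('k) * c"
        proof -
          have "\<bar>\<Sum>j\<in>UNIV. (D i j - (if i = j then 1 else 0)) * t $ j\<bar> \<le> (\<Sum>j\<in>UNIV. \<bar>(D i j - (if i = j then 1 else 0)) * t $ j\<bar>)"
            by (rule sum_abs)
          also have "\<dots> \<le> (\<Sum>j\<in>(UNIV::'k set). c * 1)"
            unfolding abs_mult by (intro sum_mono mult_mono der) (use t c in \<open>auto simp: K_def\<close>)
          finally show ?thesis by simp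
        qed
        have dt: "(\<Sum>j\<in>UNIV. (D i j - (if i = j then 1 else 0)) * t $ j) = (\<Sum>j\<in>UNIV. D i j * t $ j) - t $ i"
        proof -
          have "(\<Sum>j\<in>UNIV. (if i = j then 1 else 0) * t $ j) = (\<Sum>j\<in>UNIV. if i = j then t $ j else 0)"
            by (rule sum.cong) auto
          then show ?thesis by (simp add: left_diff_distrib sum_subtractf)
        qed
        have k1: "1 \<le> real CARD('k)" by (simp add: Suc_le_eq)
        have "\<rho> * (T t $ i - 1 / 2) = - w i t - (u x $ i + \<rho> / 2) - \<rho> * (\<Sum>j\<in>UNIV. (D i j - (if i = j then 1 else 0)) * t $ j)"
          unfolding T_def w_def dt using \<rho> by (simp add: field_simps)
        also have "\<bar>\<dots>\<bar> \<le> \<bar>w i t\<bar> + \<bar>u x $ i + \<rho> / 2\<bar> + \<bar>\<rho> * (\<Sum>j\<in>UNIV. (D i j - (if i = j then 1 else 0)) * t $ j)\<bar>"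
          by linarith
        also have "\<dots> \<le> real CARD('k) * (4 * (c * \<rho>)) + c * \<rho> + \<rho> * (real CARD('k) * c)"
          unfolding abs_mult[of \<rho>] using \<rho> sj by (intro add_mono wb[OF t] base mult_mono) auto
        also have "\<dots> \<le> real CARD('k) * (4 * (c * \<rho>)) + real CARD('k) * (c * \<rho>) + \<rho> * (real CARD('k) * c)"
          using mult_right_mono[OF k1, of "c * \<rho>"] c \<rho> by (simp add: mult_ac)
        also have "\<dots> = \<rho> * (12 * real CARD('k) * c / 2)" by (simp add: algebra_simps)
        also have "\<dots> \<le> \<rho> * (1 / 2)" using c \<rho> by (intro mult_left_mono divide_right_mono) auto
        finally have "\<rho> * \<bar>T t $ i - 1 / 2\<bar> \<le> \<rho> * (1 / 2)" using \<rho> by (simp add: abs_mult)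
        then show ?thesis using \<rho> by (rule mult_left_le_imp_le)
      qed
      then show "T t \<in> K" unfolding K_def abs_diff_le_iff by auto
    qed
  qed blast
  then obtain t where "t \<in> K" "T t = t" by blast
  then show thesis using that[of t] \<rho> by (auto simp: K_def T_def)
qed

section \<open>Increments of smooth Gaussian fields\<close>

text \<open>Minkowski's inequality. The covariance is bounded by expanding the square of b Y - a Z,
  which avoids square roots but divides by a b and so needs positive bounds.\<close>

lemma l2_triangle:
  assumes M: "prob_space M" and Y: "centered_normal M Y" and Z: "centered_normal M Z"
    and a: "0 < a" "(\<integral>\<omega>. (Y \<omega>)\<^sup>2 \<partial>M) \<le> a\<^sup>2" and b: "0 < b" "(\<integral>\<omega>. (Z \<omega>)\<^sup>2 \<partial>M) \<le> b\<^sup>2"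
  shows "(\<integral>\<omega>. (Y \<omega> + Z \<omega>)\<^sup>2 \<partial>M) \<le> (a + b)\<^sup>2"
proof -
  note iY = centered_normal_integrable_power[OF M Y, of 2] and iZ = centered_normal_integrable_power[OF M Z, of 2]
    and iYZ = centered_normal_integrable_mult[OF M Y Z]
  have "0 \<le> (\<integral>\<omega>. (b * Y \<omega> - a * Z \<omega>)\<^sup>2 \<partial>M)" by simp
  also have "\<dots> = (\<integral>\<omega>. b\<^sup>2 * (Y \<omega>)\<^sup>2 + a\<^sup>2 * (Z \<omega>)\<^sup>2 - 2 * a * b * (Y \<omega> * Z \<omega>) \<partial>M)"
    by (rule arg_cong[where f="integral\<^sup>L M"]) (auto simp: power2_eq_square algebra_simps)
  also have "\<dots> = b\<^sup>2 * (\<integral>\<omega>. (Y \<omega>)\<^sup>2 \<partial>M) + a\<^sup>2 * (\<integral>\<omega>. (Z \<omega>)\<^sup>2 \<partial>M) - 2 * a * b * (\<integral>\<omega>. Y \<omega> * Z \<omega> \<partial>M)"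
    using iY iZ iYZ by simp
  also have "\<dots> \<le> b\<^sup>2 * a\<^sup>2 + a\<^sup>2 * b\<^sup>2 - 2 * a * b * (\<integral>\<omega>. Y \<omega> * Z \<omega> \<partial>M)"
    using a b by (intro diff_right_mono add_mono mult_left_mono) auto
  finally have "(2 * (a * b)) * (\<integral>\<omega>. Y \<omega> * Z \<omega> \<partial>M) \<le> (2 * (a * b)) * (a * b)"
    by (simp add: power2_eq_square algebra_simps)
  then have c: "(\<integral>\<omega>. Y \<omega> * Z \<omega> \<partial>M) \<le> a * b" using a b by (simp add: mult_le_cancel_left_pos)
  have "(\<integral>\<omega>. (Y \<omega> + Z \<omega>)\<^sup>2 \<partial>M) = (\<integral>\<omega>. (Y \<omega>)\<^sup>2 + (Z \<omega>)\<^sup>2 + 2 * (Y \<omega> * Z \<omega>) \<partial>M)"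
    by (rule arg_cong[where f="integral\<^sup>L M"]) (auto simp: power2_eq_square algebra_simps)
  also have "\<dots> = (\<integral>\<omega>. (Y \<omega>)\<^sup>2 \<partial>M) + (\<integral>\<omega>. (Z \<omega>)\<^sup>2 \<partial>M) + 2 * (\<integral>\<omega>. Y \<omega> * Z \<omega> \<partial>M)"
    using iY iZ iYZ by simp
  also have "\<dots> \<le> a\<^sup>2 + b\<^sup>2 + 2 * (a * b)" using a b c by linarith
  finally show ?thesis by (simp add: power2_eq_square algebra_simps)
qed

text \<open>The disjunction in \<open>second\<close> reflects that a bound on mixed second
  derivatives is known only for the order of differentiation chosen by
  \<open>mi_deriv\<close>.\<close>

locale smooth_gaussian_field =
  fixes M :: "'w measure" and S :: "(real^'d::finite) set" and X :: "'w \<Rightarrow> real^'d \<Rightarrow> real^'k::finite" and B :: real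
  assumes M: "prob_space M" and X: "centered_gaussian_field M S X" and S: "open S"
    and C: "\<And>\<omega>. \<omega> \<in> space M \<Longrightarrow> class_C 2 S (X \<omega>)" and B: "0 < B"
    and second: "\<And>a b. (\<forall>y\<in>S. \<forall>c. (\<integral>\<omega>. (iterated_partial [a, b] (X \<omega>) y $ c)\<^sup>2 \<partial>M) \<le> B\<^sup>2) \<or>
      (\<forall>y\<in>S. \<forall>c. (\<integral>\<omega>. (iterated_partial [b, a] (X \<omega>) y $ c)\<^sup>2 \<partial>M) \<le> B\<^sup>2)"
begin

abbreviation "GS \<equiv> field_span M S X 2"

lemma GS: "gaussian_space M GS"
  by (rule gaussian_space_field_span[OF M X])

lemma partial_GS: "y \<in> S \<Longrightarrow> length js \<le> 2 \<Longrightarrow> (\<lambda>\<omega>. iterated_partial js (X \<omega>) y $ c) \<in> GS"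
  using iterated_partial_in_span[OF M X S C, of y js c] field_span_mono[of "length js" 2 M S X] by blast

lemmas GS_normal = gaussian_space_normal[OF GS]

lemma field_deriv:
  assumes "\<omega> \<in> space M" "length js < 2" "y + t *\<^sub>R axis a 1 \<in> S"
  shows "((\<lambda>t. iterated_partial js (X \<omega>) (y + t *\<^sub>R axis a 1) $ c) has_real_derivative
    iterated_partial (a # js) (X \<omega>) (y + t *\<^sub>R axis a 1) $ c) (at t)"
  by (rule class_C_deriv[OF C[OF assms(1)] assms(2,3)])

lemma near_GS:
  assumes "y + t *\<^sub>R axis a 1 \<in> S" "length js \<le> 2"
  shows "\<exists>d>0. \<forall>t'. \<bar>t' - t\<bar> < d \<longrightarrow> (\<lambda>\<omega>. iterated_partial js (X \<omega>) (y + t' *\<^sub>R axis a 1) $ c) \<in> GS"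
proof -
  obtain d where "d > 0" "\<forall>t'. \<bar>t' - t\<bar> < d \<longrightarrow> y + t' *\<^sub>R axis a 1 \<in> S"
    using S assms(1) by (rule open_axis_segment)
  then show ?thesis using partial_GS[OF _ assms(2)] by blast
qed

lemma partial_increment:
  assumes s: "0 \<le> s" and seg: "\<And>t. t \<in> {0..s} \<Longrightarrow> y + t *\<^sub>R axis a 1 \<in> S"
    and bd: "\<And>z. z \<in> S \<Longrightarrow> (\<integral>\<omega>. (iterated_partial [a, b] (X \<omega>) z $ c)\<^sup>2 \<partial>M) \<le> B\<^sup>2"
  shows "(\<integral>\<omega>. (iterated_partial [b] (X \<omega>) (y + s *\<^sub>R axis a 1) $ c - iterated_partial [b] (X \<omega>) y $ c)\<^sup>2 \<partial>M) \<le> (s * B)\<^sup>2"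
proof -
  have "(\<integral>\<omega>. (iterated_partial [b] (X \<omega>) (y + s *\<^sub>R axis a 1) $ c - iterated_partial [b] (X \<omega>) (y + 0 *\<^sub>R axis a 1) $ c)\<^sup>2 \<partial>M) \<le> (s * B)\<^sup>2"
  proof (rule gaussian_space_mean_value[OF M GS s less_imp_le[OF B],
        where P="\<lambda>t \<omega>. iterated_partial [b] (X \<omega>) (y + t *\<^sub>R axis a 1) $ c"
          and P'="\<lambda>t \<omega>. iterated_partial [a, b] (X \<omega>) (y + t *\<^sub>R axis a 1) $ c"])
    fix t assume t: "t \<in> {0..s}"
    show "\<exists>d>0. \<forall>t'. \<bar>t' - t\<bar> < d \<longrightarrow> (\<lambda>\<omega>. iterated_partial [b] (X \<omega>) (y + t' *\<^sub>R axis a 1) $ c) \<in> GS"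
      by (rule near_GS[OF seg[OF t]]) simp
    show "(\<lambda>\<omega>. iterated_partial [a, b] (X \<omega>) (y + t *\<^sub>R axis a 1) $ c) \<in> GS"
      by (rule partial_GS[OF seg[OF t]]) simp
    show "(\<integral>\<omega>. (iterated_partial [a, b] (X \<omega>) (y + t *\<^sub>R axis a 1) $ c)\<^sup>2 \<partial>M) \<le> B\<^sup>2" by (rule bd[OF seg[OF t]])
    show "((\<lambda>t. iterated_partial [b] (X \<omega>) (y + t *\<^sub>R axis a 1) $ c) has_real_derivative
      iterated_partial [a, b] (X \<omega>) (y + t *\<^sub>R axis a 1) $ c) (at t)" if "\<omega> \<in> space M" for \<omega>
      by (rule field_deriv[OF that _ seg[OF t]]) simp
  qed
  then show ?thesis by simp
qed

text \<open>The mean value inequality in direction b is applied to the difference of the field along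
  two parallel segments. Its derivative is the increment of the b-derivative in direction a, which
  \<open>partial_increment\<close> controls.\<close>

lemma double_increment_ordered:
  assumes s: "0 < s" and h: "0 \<le> h"
    and rect: "\<And>\<sigma> \<tau>. \<sigma> \<in> {0..s} \<Longrightarrow> \<tau> \<in> {0..h} \<Longrightarrow> y + \<sigma> *\<^sub>R axis a 1 + \<tau> *\<^sub>R axis b 1 \<in> S"
    and bd: "\<And>z. z \<in> S \<Longrightarrow> (\<integral>\<omega>. (iterated_partial [a, b] (X \<omega>) z $ c)\<^sup>2 \<partial>M) \<le> B\<^sup>2"
  shows "(\<integral>\<omega>. (X \<omega> (y + s *\<^sub>R axis a 1 + h *\<^sub>R axis b 1) $ c - X \<omega> (y + h *\<^sub>R axis b 1) $ c
    - (X \<omega> (y + s *\<^sub>R axis a 1) $ c - X \<omega> y $ c))\<^sup>2 \<partial>M) \<le> (h * (s * B))\<^sup>2"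
proof -
  let ?p = "\<lambda>z js \<omega> t. iterated_partial js (X \<omega>) (z + t *\<^sub>R axis b 1) $ c"
  let ?ys = "y + s *\<^sub>R axis a 1"
  have r1: "?ys + t *\<^sub>R axis b 1 \<in> S" and r0: "y + t *\<^sub>R axis b 1 \<in> S" if "t \<in> {0..h}" for t
    using rect[of s t] rect[of 0 t] s that by auto
  have "(\<integral>\<omega>. ((?p ?ys [] \<omega> h - ?p y [] \<omega> h) - (?p ?ys [] \<omega> 0 - ?p y [] \<omega> 0))\<^sup>2 \<partial>M) \<le> (h * (s * B))\<^sup>2"
  proof (rule gaussian_space_mean_value[OF M GS h,
        where P="\<lambda>t \<omega>. ?p ?ys [] \<omega> t - ?p y [] \<omega> t" and P'="\<lambda>t \<omega>. ?p ?ys [b] \<omega> t - ?p y [b] \<omega> t"])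
    show "0 \<le> s * B" using s B by simp
    fix t assume t: "t \<in> {0..h}"
    show "\<exists>d>0. \<forall>t'. \<bar>t' - t\<bar> < d \<longrightarrow> (\<lambda>\<omega>. ?p ?ys [] \<omega> t' - ?p y [] \<omega> t') \<in> GS"
    proof -
      obtain d1 where d1: "d1 > 0" "\<forall>t'. \<bar>t' - t\<bar> < d1 \<longrightarrow> (\<lambda>\<omega>. ?p ?ys [] \<omega> t') \<in> GS"
        using near_GS[OF r1[OF t], of "[]" c] by auto
      obtain d0 where d0: "d0 > 0" "\<forall>t'. \<bar>t' - t\<bar> < d0 \<longrightarrow> (\<lambda>\<omega>. ?p y [] \<omega> t') \<in> GS"
        using near_GS[OF r0[OF t], of "[]" c] by auto
      show ?thesis using d1 d0 gaussian_space_diff[OF GS] by (intro exI[of _ "min d1 d0"]) auto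
    qed
    show "(\<lambda>\<omega>. ?p ?ys [b] \<omega> t - ?p y [b] \<omega> t) \<in> GS"
      by (intro gaussian_space_diff[OF GS] partial_GS r1 r0 t) auto
    show "((\<lambda>t. ?p ?ys [] \<omega> t - ?p y [] \<omega> t) has_real_derivative ?p ?ys [b] \<omega> t - ?p y [b] \<omega> t) (at t)"
      if "\<omega> \<in> space M" for \<omega>
      by (intro DERIV_diff field_deriv that r1 r0 t) auto
    have "(\<integral>\<omega>. (iterated_partial [b] (X \<omega>) ((y + t *\<^sub>R axis b 1) + s *\<^sub>R axis a 1) $ c
        - iterated_partial [b] (X \<omega>) (y + t *\<^sub>R axis b 1) $ c)\<^sup>2 \<partial>M) \<le> (s * B)\<^sup>2"
      by (rule partial_increment[OF less_imp_le[OF s] _ bd]) (use rect t in \<open>auto simp: add_ac\<close>)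
    then show "(\<integral>\<omega>. (?p ?ys [b] \<omega> t - ?p y [b] \<omega> t)\<^sup>2 \<partial>M) \<le> (s * B)\<^sup>2" by (simp add: add_ac)
  qed
  then show ?thesis by simp
qed

text \<open>A double difference is symmetric in its two directions, so the bound for either order of
  differentiation is enough.\<close>

lemma double_increment:
  assumes s: "0 < s" and h: "0 < h"
    and rect: "\<And>\<sigma> \<tau>. \<sigma> \<in> {0..s} \<Longrightarrow> \<tau> \<in> {0..h} \<Longrightarrow> y + \<sigma> *\<^sub>R axis a 1 + \<tau> *\<^sub>R axis b 1 \<in> S"
  shows "(\<integral>\<omega>. (X \<omega> (y + s *\<^sub>R axis a 1 + h *\<^sub>R axis b 1) $ c - X \<omega> (y + s *\<^sub>R axis a 1) $ c
    - (X \<omega> (y + h *\<^sub>R axis b 1) $ c - X \<omega> y $ c))\<^sup>2 \<partial>M) \<le> (s * h * B)\<^sup>2"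
proof -
  have rect': "y + \<sigma> *\<^sub>R axis b 1 + \<tau> *\<^sub>R axis a 1 \<in> S" if "\<sigma> \<in> {0..h}" "\<tau> \<in> {0..s}" for \<sigma> \<tau>
    using rect[OF that(2,1)] by (simp only: ab_semigroup_add_class.add_ac)
  show ?thesis
    using second[of a b]
  proof
    assume "\<forall>y\<in>S. \<forall>c. (\<integral>\<omega>. (iterated_partial [a, b] (X \<omega>) y $ c)\<^sup>2 \<partial>M) \<le> B\<^sup>2"
    then have "(\<integral>\<omega>. (X \<omega> (y + s *\<^sub>R axis a 1 + h *\<^sub>R axis b 1) $ c - X \<omega> (y + h *\<^sub>R axis b 1) $ c
      - (X \<omega> (y + s *\<^sub>R axis a 1) $ c - X \<omega> y $ c))\<^sup>2 \<partial>M) \<le> (h * (s * B))\<^sup>2"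
      by (intro double_increment_ordered s less_imp_le[OF h] rect) auto
    then show ?thesis by (simp add: algebra_simps)
  next
    assume "\<forall>y\<in>S. \<forall>c. (\<integral>\<omega>. (iterated_partial [b, a] (X \<omega>) y $ c)\<^sup>2 \<partial>M) \<le> B\<^sup>2"
    then have "(\<integral>\<omega>. (X \<omega> (y + h *\<^sub>R axis b 1 + s *\<^sub>R axis a 1) $ c - X \<omega> (y + s *\<^sub>R axis a 1) $ c
      - (X \<omega> (y + h *\<^sub>R axis b 1) $ c - X \<omega> y $ c))\<^sup>2 \<partial>M) \<le> (s * (h * B))\<^sup>2"
      by (intro double_increment_ordered h less_imp_le[OF s] rect') auto
    then show ?thesis by (simp add: algebra_simps)
  qed
qed

text \<open>Subtracting the linear function with the slope at \<open>y\<close> leaves a path whose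
  derivative at t is the increment of the b-derivative over a segment of length t, of mean square
  size at most tB.\<close>

lemma taylor_increment:
  assumes h: "0 < h" and seg: "\<And>t. t \<in> {0..h} \<Longrightarrow> y + t *\<^sub>R axis b 1 \<in> S"
  shows "(\<integral>\<omega>. (X \<omega> (y + h *\<^sub>R axis b 1) $ c - X \<omega> y $ c - h * iterated_partial [b] (X \<omega>) y $ c)\<^sup>2 \<partial>M) \<le> (h * (h * B))\<^sup>2"
proof -
  have yS: "y \<in> S" using seg[of 0] h by simp
  let ?p = "\<lambda>js \<omega> t. iterated_partial js (X \<omega>) (y + t *\<^sub>R axis b 1) $ c" and ?d = "\<lambda>\<omega>. iterated_partial [b] (X \<omega>) y $ c"
  have "(\<integral>\<omega>. ((?p [] \<omega> h - h * ?d \<omega>) - (?p [] \<omega> 0 - 0 * ?d \<omega>))\<^sup>2 \<partial>M) \<le> (h * (h * B))\<^sup>2"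
  proof (rule gaussian_space_mean_value[OF M GS less_imp_le[OF h],
        where P="\<lambda>t \<omega>. ?p [] \<omega> t - t * ?d \<omega>" and P'="\<lambda>t \<omega>. ?p [b] \<omega> t - ?d \<omega>"])
    show "0 \<le> h * B" using h B by simp
    fix t assume t: "t \<in> {0..h}"
    have dG: "?d \<in> GS" by (rule partial_GS[OF yS]) simp
    show "\<exists>d>0. \<forall>t'. \<bar>t' - t\<bar> < d \<longrightarrow> (\<lambda>\<omega>. ?p [] \<omega> t' - t' * ?d \<omega>) \<in> GS"
    proof -
      obtain d1 where d1: "d1 > 0" "\<forall>t'. \<bar>t' - t\<bar> < d1 \<longrightarrow> (\<lambda>\<omega>. ?p [] \<omega> t') \<in> GS"
        using near_GS[OF seg[OF t], of "[]" c] by auto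
      then show ?thesis using gaussian_space_diff[OF GS] gaussian_space_mult[OF GS dG]
        by (intro exI[of _ d1]) auto
    qed
    show "(\<lambda>\<omega>. ?p [b] \<omega> t - ?d \<omega>) \<in> GS"
      by (intro gaussian_space_diff[OF GS] partial_GS seg yS t) auto
    show "((\<lambda>t. ?p [] \<omega> t - t * ?d \<omega>) has_real_derivative ?p [b] \<omega> t - ?d \<omega>) (at t)"
      if w: "\<omega> \<in> space M" for \<omega>
    proof -
      have "((\<lambda>t. t * ?d \<omega>) has_real_derivative ?d \<omega>) (at t)" by (auto intro!: derivative_eq_intros)
      with field_deriv[OF w _ seg[OF t], of "[]"] show ?thesis by (intro DERIV_diff) auto
    qed
    have "(\<integral>\<omega>. (?p [b] \<omega> t - ?d \<omega>)\<^sup>2 \<partial>M) \<le> (t * B)\<^sup>2"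
      by (rule partial_increment) (use second[of b b] seg t in auto)
    also have "\<dots> \<le> (h * B)\<^sup>2" using t B by (intro power_mono mult_right_mono) auto
    finally show "(\<integral>\<omega>. (?p [b] \<omega> t - ?d \<omega>)\<^sup>2 \<partial>M) \<le> (h * B)\<^sup>2" .
  qed
  then show ?thesis by (simp add: algebra_simps)
qed

text \<open>The slope is taken at the fixed corner \<open>x\<close> and not at the current point
  \<open>y\<close>, so that a single jet controls all segments of the cube.\<close>

definition linear_error :: "real^'d \<Rightarrow> real^'d \<Rightarrow> real \<Rightarrow> 'd \<Rightarrow> 'k \<Rightarrow> 'w \<Rightarrow> real" where
  "linear_error x y h b c \<omega> = X \<omega> (y + h *\<^sub>R axis b 1) $ c - X \<omega> y $ c - h * iterated_partial [b] (X \<omega>) x $ c"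

lemma linear_error_GS:
  assumes "x \<in> S" "y \<in> S" "y + h *\<^sub>R axis b 1 \<in> S"
  shows "linear_error x y h b c \<in> GS"
  unfolding linear_error_def[abs_def]
  using partial_GS[OF assms(1), of "[b]" c] partial_GS[OF assms(2), of "[]" c] partial_GS[OF assms(3), of "[]" c]
  by (auto intro!: gaussian_space_diff[OF GS] gaussian_space_mult[OF GS])

end

definition coord_cube :: "real^'d::finite \<Rightarrow> real \<Rightarrow> (real^'d) set" where
  "coord_cube x \<rho> = {z. \<forall>j. x $ j \<le> z $ j \<and> z $ j \<le> x $ j + \<rho>}"

context smooth_gaussian_field
begin

text \<open>The point is reached from the corner along one coordinate after another. The start is a
  Taylor remainder, and each coordinate adds a double difference; every one of these terms has mean
  square norm at most h \<rho> B.\<close>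

lemma linear_error_variance:
  fixes \<iota> :: "'k \<Rightarrow> 'd"
  assumes \<iota>: "inj \<iota>" and cube: "coord_cube x \<rho> \<subseteq> S" and h: "0 < h" and \<rho>: "h \<le> \<rho>"
    and s: "\<And>i. 0 \<le> s i \<and> s i \<le> \<rho>" and sj: "s j + h \<le> \<rho>" and T: "finite T"
  shows "(\<integral>\<omega>. (linear_error x (x + (\<Sum>i\<in>T. s i *\<^sub>R axis (\<iota> i) 1)) h (\<iota> j) c \<omega>)\<^sup>2 \<partial>M) \<le> (h * \<rho> * B * (real (card T) + 1))\<^sup>2"
    and "linear_error x (x + (\<Sum>i\<in>T. s i *\<^sub>R axis (\<iota> i) 1)) h (\<iota> j) c \<in> GS"
proof -
  have \<rho>0: "0 < \<rho>" using h \<rho> by simp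
  have comp: "(\<Sum>i\<in>T. r i *\<^sub>R axis (\<iota> i) (1::real)) $ l = (if l \<in> \<iota> ` T then r (inv \<iota> l) else 0)" if "finite T" for T r l
    using that by (induction T) (use \<iota> in \<open>auto simp: axis_def inj_eq inv_f_f sum_component\<close>)
  \<comment> \<open>The directions of the two sides may coincide; then the hypothesis s j + h <=
    \<rho> keeps the sum of the two displacements inside the cube.\<close>
  have inS: "x + (\<Sum>i\<in>T. s i *\<^sub>R axis (\<iota> i) 1) + \<sigma> *\<^sub>R axis (\<iota> i) 1 + \<tau> *\<^sub>R axis (\<iota> j) 1 \<in> S"
    if "finite T" "i \<notin> T" "\<sigma> \<in> {0..s i}" "\<tau> \<in> {0..h}" for T i \<sigma> \<tau>
  proof -
    have "(x + (\<Sum>i\<in>T. s i *\<^sub>R axis (\<iota> i) 1) + \<sigma> *\<^sub>R axis (\<iota> i) 1 + \<tau> *\<^sub>R axis (\<iota> j) 1) $ l \<in> {x $ l..x $ l + \<rho>}" for l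
    proof -
      have \<tau>: "0 \<le> \<tau>" "\<tau> \<le> h" using that by auto
      have a: "s i + \<tau> \<le> \<rho>" if "i = j" for i using sj \<tau> that by auto
      have "\<sigma> \<le> \<rho>" using that s[of i] by auto
      moreover have "\<sigma> + \<tau> \<le> \<rho>" if "i = j" using that \<open>\<sigma> \<in> {0..s i}\<close> a[of i] by auto
      moreover have "\<tau> \<le> \<rho>" using \<tau> \<rho> by simp
      ultimately show ?thesis
        unfolding vector_add_component comp[OF that(1)] vector_scaleR_component
        using s[of "inv \<iota> l"] a \<tau> that \<iota> by (auto simp: axis_def inj_eq inv_f_f)
    qed
    then show ?thesis using cube by (auto simp: coord_cube_def subset_iff)
  qed
  have inS1: "x + (\<Sum>i\<in>T. s i *\<^sub>R axis (\<iota> i) 1) + \<tau> *\<^sub>R axis (\<iota> j) 1 \<in> S" if "finite T" "\<tau> \<in> {0..h}" for T \<tau>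
  proof -
    have "(x + (\<Sum>i\<in>T. s i *\<^sub>R axis (\<iota> i) 1) + \<tau> *\<^sub>R axis (\<iota> j) 1) $ l \<in> {x $ l..x $ l + \<rho>}" for l
    proof -
      have \<tau>: "0 \<le> \<tau>" "\<tau> \<le> h" using that by auto
      then show ?thesis
        unfolding vector_add_component comp[OF that(1)] vector_scaleR_component
        using s[of "inv \<iota> l"] sj \<rho> \<iota> that by (auto simp: axis_def inj_eq inv_f_f)
    qed
    then show ?thesis using cube by (auto simp: coord_cube_def subset_iff)
  qed
  have xS: "x \<in> S" using inS1[of "{}" 0] h by simp
  have GS': "linear_error x (x + (\<Sum>i\<in>T. s i *\<^sub>R axis (\<iota> i) 1)) h (\<iota> j) c \<in> GS" if "finite T" for T
    by (rule linear_error_GS[OF xS]) (use inS1[OF that, of 0] inS1[OF that, of h] h in auto)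
  show "linear_error x (x + (\<Sum>i\<in>T. s i *\<^sub>R axis (\<iota> i) 1)) h (\<iota> j) c \<in> GS" by (rule GS'[OF T])
  show "(\<integral>\<omega>. (linear_error x (x + (\<Sum>i\<in>T. s i *\<^sub>R axis (\<iota> i) 1)) h (\<iota> j) c \<omega>)\<^sup>2 \<partial>M) \<le> (h * \<rho> * B * (real (card T) + 1))\<^sup>2"
    using T
  proof (induction T)
    case empty
    have "(\<integral>\<omega>. (linear_error x x h (\<iota> j) c \<omega>)\<^sup>2 \<partial>M) \<le> (h * (h * B))\<^sup>2"
      unfolding linear_error_def by (rule taylor_increment[OF h]) (use inS1[of "{}"] in auto)
    also have "\<dots> \<le> (h * \<rho> * B)\<^sup>2" unfolding mult.assoc using h \<rho> B by (intro power_mono mult_left_mono mult_right_mono) auto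
    finally show ?case by simp
  next
    case (insert i T)
    let ?y = "x + (\<Sum>i\<in>T. s i *\<^sub>R axis (\<iota> i) 1)"
    have e: "x + (\<Sum>i\<in>insert i T. s i *\<^sub>R axis (\<iota> i) 1) = ?y + s i *\<^sub>R axis (\<iota> i) 1"
      using insert.hyps by (simp add: add_ac)
    define A where "A = linear_error x (x + (\<Sum>i\<in>insert i T. s i *\<^sub>R axis (\<iota> i) 1)) h (\<iota> j) c"
    define A0 where "A0 = linear_error x ?y h (\<iota> j) c"
    have AG: "A \<in> GS" "A0 \<in> GS" using GS'[of "insert i T"] GS'[of T] insert.hyps by (auto simp: A_def A0_def)
    have "(\<integral>\<omega>. (A \<omega> - A0 \<omega>)\<^sup>2 \<partial>M) \<le> (h * \<rho> * B)\<^sup>2"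
    proof (cases "s i = 0")
      case True
      then have "A = A0" unfolding A_def A0_def e by simp
      then show ?thesis by simp
    next
      case False
      then have si: "0 < s i" using s[of i] by simp
      have "(\<integral>\<omega>. (A \<omega> - A0 \<omega>)\<^sup>2 \<partial>M) \<le> (s i * h * B)\<^sup>2"
      proof -
        have d: "A \<omega> - A0 \<omega> = X \<omega> (?y + s i *\<^sub>R axis (\<iota> i) 1 + h *\<^sub>R axis (\<iota> j) 1) $ c - X \<omega> (?y + s i *\<^sub>R axis (\<iota> i) 1) $ c
            - (X \<omega> (?y + h *\<^sub>R axis (\<iota> j) 1) $ c - X \<omega> ?y $ c)" for \<omega>
          unfolding A_def A0_def e linear_error_def by simp
        show ?thesis unfolding d by (rule double_increment[OF si h inS[OF insert.hyps]])
      qed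
      also have "\<dots> \<le> (\<rho> * h * B)\<^sup>2" using s[of i] h B by (intro power_mono mult_right_mono) auto
      finally show ?thesis by (simp add: mult_ac)
    qed
    then have "(\<integral>\<omega>. (A0 \<omega> + (A \<omega> - A0 \<omega>))\<^sup>2 \<partial>M) \<le> (h * \<rho> * B * (real (card T) + 1) + h * \<rho> * B)\<^sup>2"
      using insert.IH h \<rho>0 B
      by (intro l2_triangle[OF M GS_normal[OF AG(2)] GS_normal[OF gaussian_space_diff[OF GS AG]]])
        (auto simp: A0_def intro!: mult_pos_pos add_nonneg_pos)
    then have "(\<integral>\<omega>. (A \<omega>)\<^sup>2 \<partial>M) \<le> (h * \<rho> * B * (real (card T) + 1) + h * \<rho> * B)\<^sup>2" by simp
    then show ?case using insert.hyps unfolding A_def by (simp add: algebra_simps)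
  qed
qed

lemma coord_embed_dyadic_scaled:
  "\<rho> *\<^sub>R coord_embed \<iota> (dyadic l m) = (\<Sum>i\<in>UNIV. (\<rho> * real (m i) / 2 ^ l) *\<^sub>R axis (\<iota> i) 1)"
  by (simp add: coord_embed_def dyadic_def scaleR_sum_right)

text \<open>A union bound over all levels and segments. Level l has at most a constant times 2^(kl)
  segments, while the moment of order 2r gains (4/9)^(rl); r >= 2k makes the series converge
  geometrically, and the power of \<rho> is arbitrarily large with r.\<close>

lemma chaining_failure:
  fixes \<iota> :: "'k \<Rightarrow> 'd"
  assumes \<iota>: "inj \<iota>" and cube: "coord_cube x \<rho> \<subseteq> S" and \<rho>: "0 < \<rho>" and c: "0 < c" and r: "2 * CARD('k) \<le> r"
  obtains E where "E \<in> sets M"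
    "measure M E \<le> normal_tail_const r * (2 * 2 ^ CARD('k) * (real CARD('k))\<^sup>2) * (\<rho> * ((real CARD('k) + 1) * B / c)) ^ (2 * r)"
    "\<And>\<omega> l m i j. \<omega> \<in> space M - E \<Longrightarrow> (\<forall>i. m i \<le> 2 ^ l) \<Longrightarrow> m j < 2 ^ l \<Longrightarrow>
      \<bar>linear_error x (x + \<rho> *\<^sub>R coord_embed \<iota> (dyadic l m)) (\<rho> / 2 ^ l) (\<iota> j) i \<omega>\<bar> \<le> c * \<rho> * (3 / 4) ^ l"
proof -
  interpret prob_space M by (rule M)
  let ?k = "CARD('k)"
  define Y where "Y l = (\<lambda>(m, i, j). linear_error x (x + \<rho> *\<^sub>R coord_embed \<iota> (dyadic l m)) (\<rho> / 2 ^ l) (\<iota> j) i)" for l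
  define P :: "nat \<Rightarrow> (('k \<Rightarrow> nat) \<times> 'k \<times> 'k) set" where "P l = {(m, i, j). (\<forall>i. m i \<le> 2 ^ l) \<and> m j < 2 ^ l}" for l
  define Ev where "Ev l p = {\<omega> \<in> space M. c * \<rho> * (3 / 4) ^ l \<le> \<bar>Y l p \<omega>\<bar>}" for l p
  define K where "K = \<rho> * ((real ?k + 1) * B / c)"
  have K: "0 < K" using \<rho> c B by (auto simp: K_def intro!: mult_pos_pos divide_pos_pos add_nonneg_pos)
  have box: "{m :: 'k \<Rightarrow> nat. \<forall>i. m i \<le> 2 ^ l} = Pi\<^sub>E UNIV (\<lambda>_. {..2 ^ l})" for l by auto
  have Psub: "P l \<subseteq> {m. \<forall>i. m i \<le> 2 ^ l} \<times> UNIV" for l by (auto simp: P_def)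
  have Pfin: "finite (P l)" for l
    by (rule finite_subset[OF Psub]) (auto simp: box intro!: finite_PiE)
  have Pcard: "real (card (P l)) \<le> 2 ^ ?k * (2 ^ ?k) ^ l * (real ?k)\<^sup>2" for l
  proof -
    have "card (P l) \<le> card ({m :: 'k \<Rightarrow> nat. \<forall>i. m i \<le> 2 ^ l} \<times> (UNIV :: ('k \<times> 'k) set))"
      by (rule card_mono[OF _ Psub]) (auto simp: box intro!: finite_PiE)
    also have "\<dots> = (2 ^ l + 1) ^ ?k * ?k\<^sup>2"
      by (simp add: card_cartesian_product box card_PiE power2_eq_square flip: UNIV_Times_UNIV)
    also have "\<dots> \<le> (2 * 2 ^ l) ^ ?k * ?k\<^sup>2" by (intro mult_right_mono power_mono) auto
    also have "\<dots> = 2 ^ ?k * (2 ^ ?k) ^ l * ?k\<^sup>2" by (simp add: power_mult_distrib mult.commute flip: power_mult)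
    finally have "real (card (P l)) \<le> real (2 ^ ?k * (2 ^ ?k) ^ l * ?k\<^sup>2)" by (simp only: of_nat_le_iff)
    then show ?thesis by simp
  qed
  have YG: "Y l p \<in> GS" and Yv: "(\<integral>\<omega>. (Y l p \<omega>)\<^sup>2 \<partial>M) \<le> (\<rho> / 2 ^ l * \<rho> * B * (real ?k + 1))\<^sup>2" if p: "p \<in> P l" for l p
  proof -
    obtain m i j where pe: "p = (m, i, j)" by (cases p)
    have m: "\<And>i. m i \<le> 2 ^ l" "m j < 2 ^ l" using p by (auto simp: P_def pe)
    have s: "0 \<le> \<rho> * real (m i) / 2 ^ l \<and> \<rho> * real (m i) / 2 ^ l \<le> \<rho>" for i
    proof -
      have "real (m i) \<le> 2 ^ l" using m(1)[of i] by (simp flip: of_nat_le_iff)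
      then show ?thesis using \<rho> by (simp add: field_simps)
    qed
    have sj: "\<rho> * real (m j) / 2 ^ l + \<rho> / 2 ^ l \<le> \<rho>"
    proof -
      have "real (m j) + 1 \<le> 2 ^ l" using m(2) by (metis Suc_leI of_nat_Suc of_nat_le_iff of_nat_numeral of_nat_power add.commute)
      then have "\<rho> * (real (m j) + 1) \<le> \<rho> * 2 ^ l" using \<rho> by (intro mult_left_mono) auto
      then show ?thesis by (simp add: field_simps)
    qed
    have h: "0 < \<rho> / 2 ^ l" "\<rho> / 2 ^ l \<le> \<rho>" using \<rho> by (auto simp: field_simps)
    have Ye: "Y l p = linear_error x (x + (\<Sum>i\<in>UNIV. (\<rho> * real (m i) / 2 ^ l) *\<^sub>R axis (\<iota> i) 1)) (\<rho> / 2 ^ l) (\<iota> j) i"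
      by (simp only: Y_def pe prod.case coord_embed_dyadic_scaled)
    show "Y l p \<in> GS" unfolding Ye by (rule linear_error_variance(2)[where s="\<lambda>i. \<rho> * real (m i) / 2 ^ l" and j=j, OF \<iota> cube h s sj]) simp
    show "(\<integral>\<omega>. (Y l p \<omega>)\<^sup>2 \<partial>M) \<le> (\<rho> / 2 ^ l * \<rho> * B * (real ?k + 1))\<^sup>2"
      unfolding Ye by (rule linear_error_variance(1)[where s="\<lambda>i. \<rho> * real (m i) / 2 ^ l" and j=j, OF \<iota> cube h s sj]) simp
  qed
  have mEv: "Ev l p \<in> sets M" if "p \<in> P l" for l p
    unfolding Ev_def using centered_normal_measurable[OF GS_normal[OF YG[OF that]], measurable] by measurable
  have pEv: "measure M (Ev l p) \<le> normal_tail_const r * (K ^ (2 * r) * ((4 / 9) ^ r) ^ l)" if p: "p \<in> P l" for l p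
  proof -
    have "measure M (Ev l p) \<le> normal_tail_const r * ((\<rho> / 2 ^ l * \<rho> * B * (real ?k + 1))\<^sup>2 / (c * \<rho> * (3 / 4) ^ l)\<^sup>2) ^ r"
      unfolding Ev_def using c \<rho> by (intro centered_normal_tail[OF M GS_normal[OF YG[OF p]] _ Yv[OF p]]) simp
    \<comment> \<open>4/9 is the square of (1/2)/(3/4): the standard deviation is halved at each
      level while the threshold shrinks only by 3/4.\<close>
    also have "(\<rho> / 2 ^ l * \<rho> * B * (real ?k + 1))\<^sup>2 / (c * \<rho> * (3 / 4) ^ l)\<^sup>2 = K\<^sup>2 * (4 / 9) ^ l"
    proof -
      have "\<rho> / 2 ^ l * \<rho> * B * (real ?k + 1) / (c * \<rho> * (3 / 4) ^ l) = K * ((1 / 2) ^ l / (3 / 4) ^ l)"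
        unfolding K_def using \<rho> c by (simp add: field_simps power_one_over)
      also have "(1 / 2 :: real) ^ l / (3 / 4) ^ l = (2 / 3) ^ l" by (simp flip: power_divide)
      finally have q: "\<rho> / 2 ^ l * \<rho> * B * (real ?k + 1) / (c * \<rho> * (3 / 4) ^ l) = K * (2 / 3) ^ l" .
      have "((2 / 3 :: real) ^ l)\<^sup>2 = ((2 / 3)\<^sup>2) ^ l" by (simp only: power_mult[symmetric] mult.commute)
      then show ?thesis unfolding power_divide[symmetric] q by (simp add: power_mult_distrib power2_eq_square)
    qed
    also have "(K\<^sup>2 * (4 / 9) ^ l) ^ r = K ^ (2 * r) * ((4 / 9) ^ r) ^ l"
      by (simp add: power_mult_distrib mult.commute flip: power_mult)
    finally show ?thesis .
  qed
  define L where "L l = (\<Union>p\<in>P l. Ev l p)" for l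
  have mL: "L l \<in> sets M" for l unfolding L_def by (intro sets.finite_UN Pfin mEv)
  define Q where "Q = normal_tail_const r * K ^ (2 * r) * (2 ^ ?k * (real ?k)\<^sup>2)"
  have Q0: "0 \<le> Q" using normal_tail_const_pos[of r] K by (auto simp: Q_def)
  have pL: "measure M (L l) \<le> Q * (1 / 2) ^ l" for l
  proof -
    have "measure M (L l) \<le> (\<Sum>p\<in>P l. measure M (Ev l p))"
      unfolding L_def by (rule measure_UNION_le[OF Pfin mEv])
    also have "\<dots> \<le> (\<Sum>p\<in>P l. normal_tail_const r * (K ^ (2 * r) * ((4 / 9) ^ r) ^ l))" by (rule sum_mono) (rule pEv)
    also have "\<dots> = real (card (P l)) * (normal_tail_const r * (K ^ (2 * r) * ((4 / 9) ^ r) ^ l))" by simp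
    also have "\<dots> \<le> (2 ^ ?k * (2 ^ ?k) ^ l * (real ?k)\<^sup>2) * (normal_tail_const r * (K ^ (2 * r) * ((4 / 9) ^ (2 * ?k)) ^ l))"
      using normal_tail_const_pos[of r] K
      by (intro mult_mono Pcard mult_left_mono power_mono power_decreasing r) auto
    also have "\<dots> = Q * ((2 ^ ?k) ^ l * ((4 / 9) ^ (2 * ?k)) ^ l)" by (simp add: Q_def mult_ac)
    \<comment> \<open>32/81 is twice (4/9)^2: per level and coordinate, a doubling of the points
      against the gain of two moments. It is below the 1/2 used for the geometric series.\<close>
    also have "(2 ^ ?k) ^ l * ((4 / 9 :: real) ^ (2 * ?k)) ^ l = ((32 / 81) ^ ?k) ^ l"
      by (simp add: power_mult power2_eq_square flip: power_mult_distrib)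
    also have "Q * ((32 / 81) ^ ?k) ^ l \<le> Q * (1 / 2) ^ l"
    proof (intro mult_left_mono power_mono Q0)
      have "(32 / 81 :: real) ^ ?k \<le> (32 / 81) ^ 1" by (rule power_decreasing) (auto simp: Suc_le_eq)
      then show "(32 / 81 :: real) ^ ?k \<le> 1 / 2" by simp
    qed auto
    finally show ?thesis .
  qed
  have sg: "(\<lambda>l. Q * (1 / 2 :: real) ^ l) sums (Q * 2)"
    using geometric_sums[of "1 / 2 :: real"] by (intro sums_mult) simp
  have sm: "summable (\<lambda>l. measure M (L l))"
    by (rule summable_comparison_test'[OF sums_summable[OF sg]]) (use pL in auto)
  have "measure M (\<Union>l. L l) \<le> (\<Sum>l. measure M (L l))"
    by (rule finite_measure_subadditive_countably) (use mL sm in auto)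
  also have "\<dots> \<le> (\<Sum>l. Q * (1 / 2) ^ l)" by (rule suminf_le[OF pL sm sums_summable[OF sg]])
  also have "\<dots> = Q * 2" by (rule sums_unique[OF sg, symmetric])
  finally have m: "measure M (\<Union>l. L l) \<le> normal_tail_const r * (2 * 2 ^ ?k * (real ?k)\<^sup>2) * K ^ (2 * r)"
    by (simp add: Q_def mult_ac)
  show thesis
  proof (rule that[OF _ m[unfolded K_def]])
    show "(\<Union>l. L l) \<in> sets M" using mL by auto
    fix \<omega> l and m :: "'k \<Rightarrow> nat" and i j :: 'k
    assume w: "\<omega> \<in> space M - (\<Union>l. L l)" and mm: "\<forall>i. m i \<le> 2 ^ l" "m j < 2 ^ l"
    then have "(m, i, j) \<in> P l" by (simp add: P_def)
    with w have "\<omega> \<notin> Ev l (m, i, j)" unfolding L_def by blast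
    then show "\<bar>linear_error x (x + \<rho> *\<^sub>R coord_embed \<iota> (dyadic l m)) (\<rho> / 2 ^ l) (\<iota> j) i \<omega>\<bar> \<le> c * \<rho> * (3 / 4) ^ l"
      using w by (simp add: Ev_def Y_def)
  qed
qed

end

section \<open>Decorrelated points\<close>

lemma superlevel_measure:
  fixes u :: "real^'d::finite \<Rightarrow> real"
  assumes u: "in_Lp 2 u" and \<theta>: "0 < \<theta>"
  shows "{z. \<theta> < \<bar>u z\<bar>} \<in> lmeasurable"
    and "measure lebesgue {z. \<theta> < \<bar>u z\<bar>} \<le> (\<integral>z. (u z)\<^sup>2 \<partial>lebesgue) / \<theta>\<^sup>2"
proof -
  have two: "enn2real 2 = 2" by (metis enn2real_numeral)
  have um[measurable]: "u \<in> borel_measurable lebesgue" using u by (simp add: in_Lp_def)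
  have i: "integrable lebesgue (\<lambda>z. (u z)\<^sup>2)"
    using u by (simp add: in_Lp_def two)
  have sub: "{z. \<theta> < \<bar>u z\<bar>} \<subseteq> {z \<in> space lebesgue. \<theta>\<^sup>2 \<le> (u z)\<^sup>2}"
  proof clarify
    fix z assume "\<theta> < \<bar>u z\<bar>"
    then have "\<theta>\<^sup>2 \<le> \<bar>u z\<bar>\<^sup>2" using \<theta> by (intro power_mono) auto
    then show "z \<in> space lebesgue \<and> \<theta>\<^sup>2 \<le> (u z)\<^sup>2" by simp
  qed
  have em: "emeasure lebesgue {z \<in> space lebesgue. \<theta>\<^sup>2 \<le> (u z)\<^sup>2} \<le> ennreal (1 / \<theta>\<^sup>2 * (\<integral>z. (u z)\<^sup>2 \<partial>lebesgue))"
    by (rule integral_Markov_inequality[OF i]) (use \<theta> in auto)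
  have m1: "{z. \<theta> < \<bar>u z\<bar>} \<in> sets lebesgue"
    using borel_measurable_less[of "\<lambda>_. \<theta>" lebesgue "\<lambda>z. \<bar>u z\<bar>"] by simp
  have m2: "{z \<in> space lebesgue. \<theta>\<^sup>2 \<le> (u z)\<^sup>2} \<in> sets lebesgue" by measurable
  have le: "emeasure lebesgue {z. \<theta> < \<bar>u z\<bar>} \<le> ennreal (1 / \<theta>\<^sup>2 * (\<integral>z. (u z)\<^sup>2 \<partial>lebesgue))"
    by (rule order_trans[OF emeasure_mono[OF sub m2] em])
  then have fin: "emeasure lebesgue {z. \<theta> < \<bar>u z\<bar>} < \<infinity>" using le_less_trans by fastforce
  then show "{z. \<theta> < \<bar>u z\<bar>} \<in> lmeasurable" using m1 by (simp add: fmeasurable_def)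
  have "ennreal (measure lebesgue {z. \<theta> < \<bar>u z\<bar>}) \<le> ennreal (1 / \<theta>\<^sup>2 * (\<integral>z. (u z)\<^sup>2 \<partial>lebesgue))"
    using le fin by (simp add: emeasure_eq_ennreal_measure)
  then show "measure lebesgue {z. \<theta> < \<bar>u z\<bar>} \<le> (\<integral>z. (u z)\<^sup>2 \<partial>lebesgue) / \<theta>\<^sup>2"
    by (subst (asm) ennreal_le_iff) (auto intro!: mult_nonneg_nonneg)
qed

text \<open>A greedy choice by volume: each chosen point forbids a translate of the set where |u|
  exceeds \<theta>, and by Chebyshev these translates cannot cover the ball. The measurable majorant
  \<open>u\<close> takes the place of \<open>g\<close>, for which no measurability is available.
  Evenness of \<open>g\<close> handles both orders of a pair.\<close>

lemma select_decorrelated_points: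
  fixes u g :: "real^'d::finite \<Rightarrow> real"
  assumes u: "in_Lp 2 u" and gu: "\<And>z. g z \<le> u z" and even: "\<And>z. g (- z) = g z"
    and \<theta>: "0 < \<theta>" and r: "0 \<le> r"
    and n: "real n * ((\<integral>z. (u z)\<^sup>2 \<partial>lebesgue) / \<theta>\<^sup>2) < unit_ball_vol (real CARD('d)) * r ^ CARD('d)"
  shows "\<exists>x::nat \<Rightarrow> real^'d. (\<forall>i<n. x i \<in> ball a r) \<and> (\<forall>i<n. \<forall>j<n. i \<noteq> j \<longrightarrow> g (x j - x i) \<le> \<theta>)"
  using n
proof (induction n)
  case 0 then show ?case by simp
next
  case (Suc n)
  let ?K = "(\<integral>z. (u z)\<^sup>2 \<partial>lebesgue) / \<theta>\<^sup>2"
  have K: "0 \<le> ?K" by simp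
  have lt: "real n * ?K < unit_ball_vol (real CARD('d)) * r ^ CARD('d)"
    by (rule le_less_trans[OF _ Suc.prems]) (intro mult_right_mono K, simp)
  then obtain x where x: "\<And>i. i < n \<Longrightarrow> x i \<in> ball a r" "\<And>i j. i < n \<Longrightarrow> j < n \<Longrightarrow> i \<noteq> j \<Longrightarrow> g (x j - x i) \<le> \<theta>"
    using Suc.IH by blast
  define D where "D = {z. \<theta> < \<bar>u z\<bar>}"
  define Bd where "Bd = (\<Union>i<n. (\<lambda>z. x i + z) ` D)"
  note D = superlevel_measure[OF u \<theta>, folded D_def]
  have mi: "(\<lambda>z. x i + z) ` D \<in> lmeasurable" for i using D(1) by (rule measurable_translation)
  have "measure lebesgue Bd \<le> (\<Sum>i<n. measure lebesgue ((\<lambda>z. x i + z) ` D))"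
    unfolding Bd_def by (rule measure_UNION_le) (use mi in auto)
  also have "\<dots> \<le> (\<Sum>i<n. ?K)" by (rule sum_mono) (simp add: measure_translation D(2))
  also have "\<dots> < measure lebesgue (ball a r)" using lt r by (simp add: content_ball)
  finally have lt2: "measure lebesgue Bd < measure lebesgue (ball a r)" .
  have "\<not> ball a r \<subseteq> Bd"
  proof
    assume "ball a r \<subseteq> Bd"
    moreover have "Bd \<in> lmeasurable" unfolding Bd_def by (intro fmeasurable.finite_UN mi) simp
    ultimately have "measure lebesgue (ball a r) \<le> measure lebesgue Bd"
      by (intro measure_mono_fmeasurable) auto
    with lt2 show False by simp
  qed
  then obtain z where z: "z \<in> ball a r" "z \<notin> Bd" by blast
  have gz: "g (z - x i) \<le> \<theta>" if "i < n" for i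
  proof -
    have "z - x i \<notin> D"
    proof
      assume "z - x i \<in> D"
      then have "x i + (z - x i) \<in> Bd" unfolding Bd_def using that by blast
      with z show False by simp
    qed
    then show ?thesis using gu[of "z - x i"] by (simp add: D_def)
  qed
  have gz': "g (x i - z) \<le> \<theta>" if "i < n" for i using gz[OF that] even[of "z - x i"] by simp
  show ?case
    by (rule exI[of _ "x(n := z)"]) (use x z gz gz' in \<open>auto simp: less_Suc_eq\<close>)
qed

lemma le_local_sup:
  fixes g :: "real^'d::finite \<Rightarrow> real"
  assumes "bounded (range g)" "0 < w"
  shows "g z \<le> (SUP y\<in>cball 0 w. g (z + y))"
proof -
  have "bdd_above ((\<lambda>y. g (z + y)) ` cball 0 w)"
    by (rule bdd_above_mono[OF bounded_imp_bdd_above[OF assms(1)]]) auto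
  from cSUP_upper[OF _ this, of 0] show ?thesis using assms(2) by simp
qed

section \<open>Hole probability at one scale\<close>

definition opt_list :: "'a option \<Rightarrow> 'a list" where
  "opt_list b = (case b of None \<Rightarrow> [] | Some a \<Rightarrow> [a])"

text \<open>The index \<open>(None, c)\<close> stands for the value of the component \<open>c\<close> and \<open>(Some b, c)\<close> for its
  derivative in direction \<open>b\<close>.\<close>

definition jet :: "(real^'d::finite \<Rightarrow> real^'k::finite) \<Rightarrow> 'd option \<times> 'k \<Rightarrow> real^'d \<Rightarrow> real" where
  "jet u s y = iterated_partial (opt_list (fst s)) u y $ snd s"

text \<open>The jet at the corner \<open>x\<close> of the affine map whose component c is z |->
  z_(\<iota> c) - x_(\<iota> c) - \<rho>/2. It vanishes at the centre of the face.\<close>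

definition jet_target :: "('k \<Rightarrow> 'd) \<Rightarrow> real \<Rightarrow> 'd option \<times> 'k \<Rightarrow> real" where
  "jet_target \<iota> \<rho> s = (case fst s of None \<Rightarrow> - \<rho> / 2 | Some b \<Rightarrow> if b = \<iota> (snd s) then 1 else 0)"

lemma length_opt_list: "length (opt_list b) \<le> 1"
  by (cases b) (auto simp: opt_list_def)

lemma coord_embed_in_cube:
  assumes "inj \<iota>" "0 \<le> \<rho>" "\<And>i. 0 \<le> t $ i" "\<And>i. t $ i \<le> 1"
  shows "x + \<rho> *\<^sub>R coord_embed \<iota> t \<in> coord_cube x \<rho>"
proof -
  have "0 \<le> coord_embed \<iota> t $ j \<and> coord_embed \<iota> t $ j \<le> 1" for j
    using coord_embed_nth[where t=t, OF assms(1)] assms(3,4) by (cases "j \<in> range \<iota>") auto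
  then show ?thesis using assms(2) by (auto simp: coord_cube_def mult_left_le)
qed

context smooth_gaussian_field
begin

lemma jet_GS: "y \<in> S \<Longrightarrow> (\<lambda>\<omega>. jet (X \<omega>) s y) \<in> GS"
  unfolding jet_def using length_opt_list[of "fst s"] by (intro partial_GS) auto

text \<open>At each point the jet entries in \<open>J\<close> are orthonormalised, so that points
  correspond to blocks of standardised variables. If some block hits its target within \<epsilon>
  and no increment condition fails at that point, the cube contains a zero. The hypothesis
  \<open>rep\<close> recovers the jet entries outside \<open>J\<close>. The hole event need not be
  measurable, hence it is covered by a measurable set.\<close>

lemma hole_single_scale:
  fixes \<iota> :: "'k \<Rightarrow> 'd" and J :: "('d option \<times> 'k) set" and x :: "nat \<Rightarrow> real^'d"
  defines "c \<equiv> 1 / (12 * real CARD('k))"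
  assumes \<iota>: "inj \<iota>" and cube: "\<And>i. i < n \<Longrightarrow> coord_cube (x i) \<rho> \<subseteq> S" and \<rho>: "0 < \<rho>" "\<rho> \<le> 1"
    and r: "2 * CARD('k) \<le> r" and l: "0 < l" and b: "0 \<le> b"
    and low: "\<And>i a. i < n \<Longrightarrow> l * (\<Sum>s\<in>J. (a s)\<^sup>2) \<le> bilin J (\<lambda>s s'. \<integral>\<omega>. jet (X \<omega>) s (x i) * jet (X \<omega>) s' (x i) \<partial>M) a a"
    and up: "\<And>i s s'. i < n \<Longrightarrow> s \<in> J \<Longrightarrow> s' \<in> J \<Longrightarrow> \<bar>\<integral>\<omega>. jet (X \<omega>) s (x i) * jet (X \<omega>) s' (x i) \<partial>M\<bar> \<le> b"
    and cross: "\<And>i i' s s'. i < n \<Longrightarrow> i' < n \<Longrightarrow> i \<noteq> i' \<Longrightarrow> s \<in> J \<Longrightarrow> s' \<in> J \<Longrightarrow>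
      \<bar>\<integral>\<omega>. jet (X \<omega>) s (x i) * jet (X \<omega>) s' (x i') \<partial>M\<bar> \<le> \<theta>"
    and rep: "\<And>s. fst s = None \<or> (\<exists>i. fst s = Some (\<iota> i)) \<Longrightarrow> \<exists>s'\<in>J. (\<forall>\<rho>. jet_target \<iota> \<rho> s = jet_target \<iota> \<rho> s') \<and>
      (\<forall>\<omega>\<in>space M. \<forall>y\<in>S. jet (X \<omega>) s y = jet (X \<omega>) s' y)"
    and \<theta>: "0 \<le> \<theta>"
    and \<tau>: "\<tau> = real n * real (card J) ^ 3 / l * \<theta>" "\<tau> \<le> 1"
    and eps: "\<epsilon> = c * \<rho> / (1 + (real (card J))\<^sup>2 * b / sqrt l)"
  shows "\<exists>E\<in>sets M. {\<omega> \<in> space M. \<forall>i<n. \<forall>z\<in>coord_cube (x i) \<rho>. X \<omega> z \<noteq> 0} \<subseteq> E \<and>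
    measure M E \<le> real n * (normal_tail_const r * (2 * 2 ^ CARD('k) * (real CARD('k))\<^sup>2) * (\<rho> * ((real CARD('k) + 1) * B / c)) ^ (2 * r))
      + (real (n * card J) * (normal_tail_const m * (\<tau> / (\<epsilon> / 2)\<^sup>2) ^ m)
         + (1 - (\<epsilon> / 2 * exp (- ((real (card J) / sqrt l + 1)\<^sup>2)) / 4) ^ card J) ^ n)"
proof -
  interpret prob_space M by (rule M)
  have J: "finite J" by simp
  have k1: "1 \<le> real CARD('k)" by (simp add: Suc_le_eq)
  have c: "0 < c" "c \<le> 1" "12 * real CARD('k) * c \<le> 1"
  proof -
    have "12 * real CARD('k) \<ge> 1" using k1 by linarith
    then show "c \<le> 1" unfolding c_def by (subst divide_le_eq_1) linarith
  qed (simp_all add: c_def)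
  \<comment> \<open>Amplification from the orthonormal variables back to jet entries:
    \<open>card J\<close> terms, with coefficients at most \<open>card J * b / sqrt l\<close>. The
    choice of \<epsilon> compensates it.\<close>
  define \<Lambda> where "\<Lambda> = (real (card J))\<^sup>2 * b / sqrt l"
  have \<Lambda>: "0 \<le> \<Lambda>" using l b by (simp add: \<Lambda>_def)
  have eps0: "0 < \<epsilon>" "\<epsilon> \<le> 1"
  proof -
    show "0 < \<epsilon>" using c \<rho> \<Lambda> unfolding eps \<Lambda>_def[symmetric] by (intro divide_pos_pos) auto
    have "c * \<rho> \<le> 1 * 1" using c \<rho> by (intro mult_mono) auto
    then show "\<epsilon> \<le> 1" unfolding eps \<Lambda>_def[symmetric] using \<Lambda> by (subst divide_le_eq_1) auto
  qed
  have epsL: "\<Lambda> * \<epsilon> \<le> c * \<rho>"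
  proof -
    have "\<Lambda> * \<epsilon> \<le> (1 + \<Lambda>) * \<epsilon>" using eps0 by (intro mult_right_mono) auto
    also have "\<dots> = c * \<rho>" unfolding eps \<Lambda>_def[symmetric] using \<Lambda> by simp
    finally show ?thesis .
  qed
  have xS: "x i \<in> S" if "i < n" for i using cube[OF that] \<rho> by (auto simp: coord_cube_def)
  define V where "V i s \<omega> = jet (X \<omega>) s (x i)" for i s \<omega>
  have VG: "V i s \<in> GS" if "i < n" for i s unfolding V_def using jet_GS[OF xS[OF that]] by simp
  define C where "C i s s' = (\<integral>\<omega>. V i s \<omega> * V i s' \<omega> \<partial>M)" for i s s'
  have Csym: "C i s s' = C i s' s" for i s s' by (simp add: C_def mult.commute)
  have low': "l * (\<Sum>s\<in>J. (a s)\<^sup>2) \<le> bilin J (C i) a a" if "i < n" for i a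
    using low[OF that, of a] unfolding C_def[abs_def] V_def .
  let ?GS = "\<lambda>i q. (\<forall>s\<in>J. \<forall>s'\<in>J. bilin J (C i) (q s) (q s') = (if s = s' then 1 else 0)) \<and>
    (\<forall>s\<in>J. \<forall>i'. (if i' = s then 1 else 0) = (\<Sum>s'\<in>J. bilin J (C i) (\<lambda>i. if i = s then 1 else 0) (q s') * q s' i'))"
  have "\<forall>i\<in>{..<n}. \<exists>q. ?GS i q"
  proof
    fix i assume "i \<in> {..<n}"
    then have i: "i < n" by simp
    show "\<exists>q. ?GS i q"
    proof (rule gram_schmidt[OF J Csym], intro allI impI)
      fix a :: "'d option \<times> 'k \<Rightarrow> real" assume "\<exists>s\<in>J. a s \<noteq> 0"
      then obtain s where "s \<in> J" "0 < (a s)\<^sup>2" by auto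
      then have "0 < (\<Sum>s\<in>J. (a s)\<^sup>2)" using J by (intro sum_pos2[of J s]) auto
      then have "0 < l * (\<Sum>s\<in>J. (a s)\<^sup>2)" using l by simp
      then show "0 < bilin J (C i) a a" using low'[OF i, of a] by linarith
    qed
  qed
  from bchoice[OF this] obtain q where q': "\<forall>i\<in>{..<n}. ?GS i (q i)" by (elim exE)
  have q: "?GS i (q i)" if "i < n" for i using bspec[OF q', of i] that by simp
  have qo: "bilin J (C i) (q i s) (q i s') = (if s = s' then 1 else 0)" if "i < n" "s \<in> J" "s' \<in> J" for i s s'
    using conjunct1[OF q[OF that(1)]] that by blast
  have qe: "(if i' = s then 1 else 0) = (\<Sum>s'\<in>J. bilin J (C i) (\<lambda>i. if i = s then 1 else 0) (q i s') * q i s' i')"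
    if "i < n" "s \<in> J" for i s i' using conjunct2[OF q[OF that(1)]] that by blast
  \<comment> \<open>Coercivity: l times the squared length of a normalised vector is at most its
    form value 1.\<close>
  have qb: "\<bar>q i s s'\<bar> \<le> 1 / sqrt l" if "i < n" "s \<in> J" "s' \<in> J" for i s s'
  proof -
    have "l * (q i s s')\<^sup>2 \<le> l * (\<Sum>s'\<in>J. (q i s s')\<^sup>2)"
      using l that J by (intro mult_left_mono member_le_sum) auto
    also have "\<dots> \<le> 1" using low'[OF that(1), of "q i s"] qo[OF that(1,2,2)] by simp
    finally have "(q i s s')\<^sup>2 \<le> 1 / l" using l by (simp add: field_simps)
    then have "sqrt ((q i s s')\<^sup>2) \<le> sqrt (1 / l)" by (rule real_sqrt_le_mono)
    then show ?thesis by (simp add: real_sqrt_divide)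
  qed
  define Q where "Q = (\<lambda>(i, s) \<omega>. \<Sum>s'\<in>J. q i s s' * V i s' \<omega>)"
  define Z where "Z = {..<n} \<times> J"
  have QG: "Q p \<in> GS" if pZ: "p \<in> Z" for p
  proof -
    obtain i s where p: "p = (i, s)" "i < n" "s \<in> J" using pZ by (cases p) (auto simp: Z_def)
    show ?thesis unfolding p(1) Q_def prod.case
      by (intro gaussian_space_sum[OF GS J] gaussian_space_mult[OF GS VG[OF p(2)]])
  qed
  define e where "e = (\<lambda>p p'. \<integral>\<omega>. Q p \<omega> * Q p' \<omega> \<partial>M)"
  have eQ: "e (i, s) (i', s') = (\<Sum>u\<in>J. \<Sum>v\<in>J. q i s u * (\<integral>\<omega>. V i u \<omega> * V i' v \<omega> \<partial>M) * q i' s' v)"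
    if "i < n" "i' < n" for i i' s s'
  proof -
    have int: "integrable M (\<lambda>\<omega>. (q i s u * q i' s' v) * (V i u \<omega> * V i' v \<omega>))" for u v
      by (intro integrable_mult_right centered_normal_integrable_mult[OF M] GS_normal VG that)
    have "e (i, s) (i', s') = (\<integral>\<omega>. (\<Sum>u\<in>J. \<Sum>v\<in>J. (q i s u * q i' s' v) * (V i u \<omega> * V i' v \<omega>)) \<partial>M)"
      unfolding e_def Q_def prod.case sum_product by (simp add: mult_ac)
    also have "\<dots> = (\<Sum>u\<in>J. \<Sum>v\<in>J. \<integral>\<omega>. (q i s u * q i' s' v) * (V i u \<omega> * V i' v \<omega>) \<partial>M)"
      by (subst Bochner_Integration.integral_sum, intro Bochner_Integration.integrable_sum int,
          rule sum.cong[OF refl], rule Bochner_Integration.integral_sum, rule int)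
    also have "\<dots> = (\<Sum>u\<in>J. \<Sum>v\<in>J. q i s u * (\<integral>\<omega>. V i u \<omega> * V i' v \<omega> \<partial>M) * q i' s' v)"
      unfolding integral_mult_right_zero by (simp only: mult_ac)
    finally show ?thesis .
  qed
  have e_in: "e (i, s) (i, s') = (if s = s' then 1 else 0)" if "i < n" "s \<in> J" "s' \<in> J" for i s s'
    using qo[OF that] unfolding eQ[OF that(1,1)] bilin_def C_def .
  have e_out: "\<bar>e (i, s) (i', s')\<bar> \<le> (real (card J))\<^sup>2 / l * \<theta>" if "i < n" "i' < n" "i \<noteq> i'" "s \<in> J" "s' \<in> J" for i i' s s'
  proof -
    have "\<bar>e (i, s) (i', s')\<bar> \<le> (\<Sum>u\<in>J. \<Sum>v\<in>J. \<bar>q i s u * (\<integral>\<omega>. V i u \<omega> * V i' v \<omega> \<partial>M) * q i' s' v\<bar>)"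
      unfolding eQ[OF that(1,2)] by (intro order_trans[OF sum_abs] sum_mono sum_abs)
    also have "\<dots> \<le> (\<Sum>u\<in>J. \<Sum>v\<in>J. 1 / sqrt l * \<theta> * (1 / sqrt l))"
      unfolding abs_mult using l that cross \<theta>
      by (intro sum_mono mult_mono qb) (auto simp: V_def)
    also have "\<dots> = (real (card J))\<^sup>2 / l * \<theta>" using l by (simp add: power2_eq_square)
    finally show ?thesis .
  qed
  have off: "off_diag Z e p \<le> \<tau>" if pZ: "p \<in> Z" for p
  proof -
    obtain i s where p: "p = (i, s)" "i < n" "s \<in> J" using pZ by (cases p) (auto simp: Z_def)
    have Zf: "finite Z" using J by (simp add: Z_def)
    \<comment> \<open>Inside a block the variables are orthonormal, so only other points contribute
      to the row sum.\<close>
    define W where "W = {p' \<in> Z. fst p' \<noteq> i}"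
    have "off_diag Z e p = (\<Sum>p'\<in>W. \<bar>e p p'\<bar>)"
      unfolding off_diag_def by (rule sum.mono_neutral_right) (use Zf p in \<open>auto simp: W_def Z_def e_in\<close>)
    also have "\<dots> \<le> (\<Sum>p'\<in>W. (real (card J))\<^sup>2 / l * \<theta>)"
    proof (rule sum_mono)
      fix p' assume "p' \<in> W"
      then obtain i' s' where "p' = (i', s')" "i' < n" "i \<noteq> i'" "s' \<in> J" by (cases p') (auto simp: W_def Z_def)
      then show "\<bar>e p p'\<bar> \<le> (real (card J))\<^sup>2 / l * \<theta>" using e_out[OF p(2) _ _ p(3)] p(1) by simp
    qed
    also have "\<dots> \<le> (\<Sum>p'\<in>Z. (real (card J))\<^sup>2 / l * \<theta>)"
      using Zf l \<theta> by (intro sum_mono2) (auto simp: W_def)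
    also have "\<dots> = \<tau>" unfolding \<tau>(1) by (simp add: Z_def card_cartesian_product power2_eq_square power3_eq_cube)
    finally show ?thesis .
  qed
  \<comment> \<open>The target jet in the orthonormal coordinates of point i.\<close>
  define qt where "qt = (\<lambda>(i, s). \<Sum>s'\<in>J. q i s s' * jet_target \<iota> \<rho> s')"
  have tb: "\<bar>jet_target \<iota> \<rho> s\<bar> \<le> 1" for s using \<rho> by (auto simp: jet_target_def split: option.split)
  have qtb: "\<bar>qt p\<bar> \<le> real (card J) / sqrt l" if pZ: "p \<in> Z" for p
  proof -
    obtain i s where p: "p = (i, s)" "i < n" "s \<in> J" using pZ by (cases p) (auto simp: Z_def)
    have "\<bar>qt p\<bar> \<le> (\<Sum>s'\<in>J. \<bar>q i s s' * jet_target \<iota> \<rho> s'\<bar>)" unfolding qt_def p(1) prod.case by (rule sum_abs)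
    also have "\<dots> \<le> (\<Sum>s'\<in>J. 1 / sqrt l * 1)"
      unfolding abs_mult using p l by (intro sum_mono mult_mono qb tb) auto
    finally show ?thesis by simp
  qed
  let ?bad = "{\<omega> \<in> space M. \<forall>i\<in>{..<n}. \<exists>s\<in>J. \<epsilon> < \<bar>Q (i, s) \<omega> - qt (i, s)\<bar>}"
  have bad: "measure M ?bad \<le> real (card Z) * (normal_tail_const m * (\<tau> / (\<epsilon> / 2)\<^sup>2) ^ m)
      + (1 - (\<epsilon> / 2 * exp (- ((real (card J) / sqrt l + 1)\<^sup>2)) / 4) ^ card J) ^ card {..<n}"
  proof (rule prob_no_block_le[OF M _ J Z_def _ _ e_def _ off \<tau>(2) qtb eps0])
    show "centered_normal M (\<lambda>\<omega>. \<Sum>p\<in>Z. a p * Q p \<omega>)" for a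
      using J by (intro GS_normal gaussian_space_sum[OF GS] gaussian_space_mult[OF GS] QG) (auto simp: Z_def)
    show "centered_normal M (Q p)" if "p \<in> Z" for p by (rule GS_normal[OF QG[OF that]])
    show "e p p = 1" if "p \<in> Z" for p using that e_in by (auto simp: Z_def)
  qed auto
  have badm: "?bad \<in> sets M"
  proof (intro sets.sets_Collect_finite_All sets.sets_Collect_finite_Ex J finite_lessThan)
    fix i s assume "i \<in> {..<n}" "s \<in> J"
    then have [measurable]: "Q (i, s) \<in> borel_measurable M"
      using centered_normal_measurable[OF GS_normal[OF QG[of "(i, s)"]]] by (auto simp: Z_def)
    show "{\<omega> \<in> space M. \<epsilon> < \<bar>Q (i, s) \<omega> - qt (i, s)\<bar>} \<in> sets M" by measurable
  qed
  define F where "F = normal_tail_const r * (2 * 2 ^ CARD('k) * (real CARD('k))\<^sup>2) * (\<rho> * ((real CARD('k) + 1) * B / c)) ^ (2 * r)"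
  let ?CF = "\<lambda>i E. E \<in> sets M \<and> measure M E \<le> F \<and> (\<forall>\<omega>\<in>space M - E. \<forall>l m i' j. (\<forall>i. m i \<le> 2 ^ l) \<longrightarrow> m j < 2 ^ l \<longrightarrow>
      \<bar>linear_error (x i) (x i + \<rho> *\<^sub>R coord_embed \<iota> (dyadic l m)) (\<rho> / 2 ^ l) (\<iota> j) i' \<omega>\<bar> \<le> c * \<rho> * (3 / 4) ^ l)"
  have "\<forall>i\<in>{..<n}. \<exists>E. ?CF i E"
  proof
    fix i assume "i \<in> {..<n}"
    then have i: "i < n" by simp
    show "\<exists>E. ?CF i E"
      by (rule chaining_failure[OF \<iota> cube[OF i] \<rho>(1) c(1) r]) (unfold F_def, blast)
  qed
  from bchoice[OF this] obtain E where E': "\<forall>i\<in>{..<n}. ?CF i (E i)" by (elim exE)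
  have E: "E i \<in> sets M" "measure M (E i) \<le> F" if "i < n" for i using bspec[OF E', of i] that by simp_all
  have E3: "\<bar>linear_error (x i) (x i + \<rho> *\<^sub>R coord_embed \<iota> (dyadic l m)) (\<rho> / 2 ^ l) (\<iota> j) i' \<omega>\<bar> \<le> c * \<rho> * (3 / 4) ^ l"
    if "i < n" "\<omega> \<in> space M - E i" "\<forall>i. m i \<le> 2 ^ l" "m j < 2 ^ l" for i \<omega> l m i' j
    using bspec[OF E', of i] that by blast
  have zero: "\<exists>z\<in>coord_cube (x i) \<rho>. X \<omega> z = 0"
    if i: "i < n" and \<omega>: "\<omega> \<in> space M" "\<omega> \<notin> E i" and good: "\<And>s. s \<in> J \<Longrightarrow> \<bar>Q (i, s) \<omega> - qt (i, s)\<bar> \<le> \<epsilon>" for i \<omega>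
  proof -
    have V1: "\<bar>V i s \<omega> - jet_target \<iota> \<rho> s\<bar> \<le> c * \<rho>" if s: "s \<in> J" for s
    proof -
      \<comment> \<open>Coefficients of the inverse change of basis. They are sums of
        \<open>card J\<close> products of a covariance and an entry of \<open>q\<close>.\<close>
      define \<beta> where "\<beta> s' = bilin J (C i) (\<lambda>i. if i = s then 1 else 0) (q i s')" for s'
      have \<beta>: "\<bar>\<beta> s'\<bar> \<le> real (card J) * b / sqrt l" if "s' \<in> J" for s'
      proof -
        have "\<beta> s' = (\<Sum>u\<in>J. if u = s then \<Sum>v\<in>J. C i u v * q i s' v else 0)"
          unfolding \<beta>_def bilin_def by (rule sum.cong) auto
        also have "\<dots> = (\<Sum>v\<in>J. C i s v * q i s' v)" using J s by simp
        also have "\<bar>\<dots>\<bar> \<le> (\<Sum>v\<in>J. \<bar>C i s v * q i s' v\<bar>)" by (rule sum_abs)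
        also have "\<dots> \<le> (\<Sum>v\<in>J. b * (1 / sqrt l))"
          unfolding abs_mult using i s that up b by (intro sum_mono mult_mono qb) (auto simp: C_def V_def)
        finally show ?thesis by simp
      qed
      have ex: "f s = (\<Sum>s'\<in>J. \<beta> s' * (\<Sum>u\<in>J. q i s' u * f u))" for f
      proof -
        have "f s = (\<Sum>u\<in>J. if u = s then f u else 0)" using J s by simp
        also have "\<dots> = (\<Sum>u\<in>J. (if u = s then 1 else 0) * f u)" by (rule sum.cong) auto
        also have "\<dots> = (\<Sum>u\<in>J. \<Sum>s'\<in>J. \<beta> s' * (q i s' u * f u))"
          by (rule sum.cong[OF refl], subst qe[OF i s]) (simp only: \<beta>_def sum_distrib_right mult.assoc)
        also have "\<dots> = (\<Sum>s'\<in>J. \<beta> s' * (\<Sum>u\<in>J. q i s' u * f u))"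
          by (subst sum.swap) (simp only: sum_distrib_left)
        finally show ?thesis .
      qed
      have "V i s \<omega> - jet_target \<iota> \<rho> s = (\<Sum>s'\<in>J. \<beta> s' * (Q (i, s') \<omega> - qt (i, s')))"
        using ex[of "\<lambda>u. V i u \<omega>"] ex[of "jet_target \<iota> \<rho>"]
        by (simp add: Q_def qt_def right_diff_distrib sum_subtractf)
      also have "\<bar>\<dots>\<bar> \<le> (\<Sum>s'\<in>J. \<bar>\<beta> s' * (Q (i, s') \<omega> - qt (i, s'))\<bar>)" by (rule sum_abs)
      also have "\<dots> \<le> (\<Sum>s'\<in>J. real (card J) * b / sqrt l * \<epsilon>)"
        unfolding abs_mult using l b by (intro sum_mono mult_mono \<beta> good) auto
      also have "\<dots> = \<Lambda> * \<epsilon>" by (simp add: \<Lambda>_def power2_eq_square)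
      finally show ?thesis using epsL by linarith
    qed
    \<comment> \<open>Entries outside \<open>J\<close> have the same value and the same target as a
      representative in \<open>J\<close>.\<close>
    have V2: "\<bar>jet (X \<omega>) s (x i) - jet_target \<iota> \<rho> s\<bar> \<le> c * \<rho>" if fs: "fst s = None \<or> (\<exists>i. fst s = Some (\<iota> i))" for s
    proof -
      obtain s' where "s' \<in> J" "jet_target \<iota> \<rho> s = jet_target \<iota> \<rho> s'" "jet (X \<omega>) s (x i) = jet (X \<omega>) s' (x i)"
        using rep[OF fs] \<omega>(1) xS[OF i] by blast
      then show ?thesis using V1[of s'] by (simp add: V_def)
    qed
    define D where "D i' j = iterated_partial [\<iota> j] (X \<omega>) (x i) $ i'" for i' j
    have "\<exists>t. (\<forall>i. 0 \<le> t $ i) \<and> (\<forall>i. t $ i \<le> 1) \<and> X \<omega> (x i + \<rho> *\<^sub>R coord_embed \<iota> t) = 0"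
    proof (rule zero_in_cube[OF \<rho>(1) less_imp_le[OF c(1)] c(3), where D=D])
      have "{x i + \<rho> *\<^sub>R coord_embed \<iota> t |t. \<forall>i. 0 \<le> t $ i \<and> t $ i \<le> 1} \<subseteq> S"
        using coord_embed_in_cube[OF \<iota>, of \<rho> _ "x i"] \<rho> cube[OF i] by auto
      moreover have "continuous_on S (X \<omega>)" using C[OF \<omega>(1)] unfolding class_C_def by (metis iterated_partial.simps(1) le0 list.size(3))
      ultimately show "continuous_on {x i + \<rho> *\<^sub>R coord_embed \<iota> t |t. \<forall>i. 0 \<le> t $ i \<and> t $ i \<le> 1} (X \<omega>)"
        by (rule continuous_on_subset[rotated])
      show "\<bar>X \<omega> (x i) $ i' + \<rho> / 2\<bar> \<le> c * \<rho>" for i'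
        using V2[of "(None, i')"] by (simp add: jet_def opt_list_def jet_target_def)
      show "\<bar>D i' j - (if i' = j then 1 else 0)\<bar> \<le> c" for i' j
      proof -
        have "\<bar>D i' j - (if i' = j then 1 else 0)\<bar> \<le> c * \<rho>"
          using V2[of "(Some (\<iota> j), i')"] \<iota> by (auto simp: jet_def opt_list_def jet_target_def D_def inj_eq)
        also have "\<dots> \<le> c * 1" using c \<rho> by (intro mult_left_mono) auto
        finally show ?thesis by simp
      qed
      show "\<bar>X \<omega> (x i + \<rho> *\<^sub>R coord_embed \<iota> (dyadic l m) + (\<rho> / 2 ^ l) *\<^sub>R axis (\<iota> j) 1) $ i'
         - X \<omega> (x i + \<rho> *\<^sub>R coord_embed \<iota> (dyadic l m)) $ i' - \<rho> / 2 ^ l * D i' j\<bar> \<le> c * \<rho> * (3 / 4) ^ l"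
        if "\<And>i. m i \<le> 2 ^ l" "m j < 2 ^ l" for l m i' j
        using E3[OF i, of \<omega> m l j i'] that \<omega> unfolding linear_error_def D_def by blast
    qed blast
    then obtain t where "\<And>i. 0 \<le> t $ i" "\<And>i. t $ i \<le> 1" "X \<omega> (x i + \<rho> *\<^sub>R coord_embed \<iota> t) = 0" by blast
    then show ?thesis using coord_embed_in_cube[OF \<iota> less_imp_le[OF \<rho>(1)], of t "x i"] by blast
  qed
  let ?E = "(\<Union>i<n. E i) \<union> ?bad"
  have "measure M ?E \<le> measure M (\<Union>i<n. E i) + measure M ?bad"
    by (rule measure_Un_le) (use E(1) badm in auto)
  also have "measure M (\<Union>i<n. E i) \<le> (\<Sum>i<n. measure M (E i))" by (rule measure_UNION_le) (use E(1) in auto)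
  also have "\<dots> \<le> (\<Sum>i<n. F)" by (rule sum_mono) (use E(2) in auto)
  finally have "measure M ?E \<le> real n * F + measure M ?bad" by simp
  with bad have "measure M ?E \<le> real n * F + (real (n * card J) * (normal_tail_const m * (\<tau> / (\<epsilon> / 2)\<^sup>2) ^ m)
         + (1 - (\<epsilon> / 2 * exp (- ((real (card J) / sqrt l + 1)\<^sup>2)) / 4) ^ card J) ^ n)"
    by (simp add: Z_def card_cartesian_product)
  moreover have "?E \<in> sets M" using E(1) badm by (intro sets.Un sets.finite_UN) auto
  moreover have "{\<omega> \<in> space M. \<forall>i<n. \<forall>z\<in>coord_cube (x i) \<rho>. X \<omega> z \<noteq> 0} \<subseteq> ?E"
  proof
    fix \<omega> assume w: "\<omega> \<in> {\<omega> \<in> space M. \<forall>i<n. \<forall>z\<in>coord_cube (x i) \<rho>. X \<omega> z \<noteq> 0}"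
    show "\<omega> \<in> ?E"
    proof (rule ccontr)
      assume nE: "\<omega> \<notin> ?E"
      then obtain i where i: "i < n" "\<forall>s\<in>J. \<bar>Q (i, s) \<omega> - qt (i, s)\<bar> \<le> \<epsilon>" using w by (auto simp: not_less)
      then have "\<exists>z\<in>coord_cube (x i) \<rho>. X \<omega> z = 0" by (intro zero) (use w nE in auto)
      then show False using w i(1) by blast
    qed
  qed
  ultimately show ?thesis unfolding F_def by blast
qed

end

section \<open>Asymptotics\<close>

text \<open>The failures at the T^h points are paid for by a moment of order 2r with 2r >= h +
  P.\<close>

lemma chaining_term_bound:
  fixes T a k n :: real
  assumes T: "1 \<le> T" and n: "0 \<le> n" "n \<le> T ^ h" and a: "0 \<le> a" "0 \<le> k" and r: "h + P \<le> 2 * r"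
  shows "n * (a * (1 / T * k) ^ (2 * r)) \<le> a * k ^ (2 * r) / T ^ P"
proof -
  have "n * (a * (1 / T * k) ^ (2 * r)) \<le> T ^ h * (a * (1 / T * k) ^ (2 * r))"
    using n a T by (intro mult_right_mono) auto
  also have "\<dots> = a * k ^ (2 * r) * (T ^ h / T ^ (2 * r))" by (simp add: power_mult_distrib power_divide)
  also have "\<dots> \<le> a * k ^ (2 * r) * (1 / T ^ P)"
  proof (rule mult_left_mono)
    have "T ^ h * T ^ P \<le> T ^ (2 * r)" unfolding power_add[symmetric] using T r by (intro power_increasing) auto
    then show "T ^ h / T ^ (2 * r) \<le> 1 / T ^ P" using T by (simp add: field_simps)
  qed (use a in auto)
  finally show ?thesis by simp
qed

text \<open>The noise variance over the squared tolerance is of order T^(2 - h), hence at most of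
  order 1/T when h >= 3. Its m-th power then absorbs the number of points and leaves T^(-P).\<close>

lemma noise_term_bound:
  fixes T a n :: real
  assumes T: "1 \<le> T" and n: "0 \<le> n" "n \<le> T ^ h" and a: "0 \<le> a" "0 \<le> j" and h: "3 \<le> h" and m: "h + P \<le> m"
    and \<tau>: "0 \<le> \<tau>" "\<tau> \<le> D / T ^ h" and e: "0 < e0"
  shows "n * j * (a * (\<tau> / (e0 / T / 2)\<^sup>2) ^ m) \<le> j * a * (4 * D / e0\<^sup>2) ^ m / T ^ P"
proof -
  have "0 < T ^ h" using T by simp
  from pos_le_divide_eq[OF this, of 0 D] have D: "0 \<le> D" using order_trans[OF \<tau>] by simp
  have "\<tau> / (e0 / T / 2)\<^sup>2 \<le> (D / T ^ h) / (e0 / T / 2)\<^sup>2" using \<tau> by (intro divide_right_mono) auto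
  also have "\<dots> = (4 * D / e0\<^sup>2) * (T\<^sup>2 / T ^ h)" using T e by (simp add: field_simps power2_eq_square)
  also have "\<dots> \<le> (4 * D / e0\<^sup>2) * (1 / T)"
  proof (rule mult_left_mono)
    have "T\<^sup>2 * T ^ 1 \<le> T ^ h" unfolding power_add[symmetric] using T h by (intro power_increasing) auto
    then show "T\<^sup>2 / T ^ h \<le> 1 / T" using T by (simp add: field_simps)
  qed (use D in auto)
  finally have "(\<tau> / (e0 / T / 2)\<^sup>2) ^ m \<le> ((4 * D / e0\<^sup>2) * (1 / T)) ^ m" using \<tau> by (intro power_mono) auto
  then have "n * j * (a * (\<tau> / (e0 / T / 2)\<^sup>2) ^ m) \<le> T ^ h * j * (a * ((4 * D / e0\<^sup>2) * (1 / T)) ^ m)"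
    using n a T \<tau> by (intro mult_mono) auto
  also have "\<dots> = j * a * (4 * D / e0\<^sup>2) ^ m * (T ^ h / T ^ m)" by (simp add: power_mult_distrib power_divide)
  also have "\<dots> \<le> j * a * (4 * D / e0\<^sup>2) ^ m * (1 / T ^ P)"
  proof (rule mult_left_mono)
    have "T ^ h * T ^ P \<le> T ^ m" unfolding power_add[symmetric] using T m by (intro power_increasing) auto
    then show "T ^ h / T ^ m \<le> 1 / T ^ P" using T by (simp add: field_simps)
  qed (use a D in auto)
  finally show ?thesis by simp
qed

text \<open>One term of the exponential series bounds exp z from below.\<close>

lemma exp_minus_le:
  fixes z :: real
  assumes "0 < z"
  shows "exp (- z) \<le> fact P / z ^ P"
proof -
  have "z ^ P / fact P \<le> exp z"
  proof -
    have "(\<Sum>n\<in>{P}. z ^ n /\<^sub>R fact n) \<le> (\<Sum>n. z ^ n /\<^sub>R fact n)"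
      using assms by (intro sum_le_suminf summable_exp_generic) auto
    also have "\<dots> = exp z" by (simp add: exp_def)
    finally have "(\<Sum>n\<in>{P}. z ^ n /\<^sub>R fact n) \<le> exp z" .
    then show ?thesis by (simp add: field_simps)
  qed
  then show ?thesis using assms by (simp add: exp_minus field_simps)
qed

text \<open>The expected number of successes n (e1/T)^J is at least of order T, so the probability
  of none is exponentially small in T and in particular below any power.\<close>

lemma block_term_bound:
  fixes T e1 :: real
  assumes T: "1 \<le> T" and n: "T ^ h / 2 \<le> real n" and h: "J + 1 \<le> h" and e: "0 < e1" "e1 \<le> 1"
  shows "(1 - (e1 / T) ^ J) ^ n \<le> fact P * (2 / e1 ^ J) ^ P / T ^ P"
proof -
  define y where "y = (e1 / T) ^ J"
  have y: "0 \<le> y" "y \<le> 1" using T e by (auto simp: y_def intro!: power_le_one)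
  have "(1 - y) ^ n \<le> exp (- y) ^ n" using y exp_ge_add_one_self[of "- y"] by (intro power_mono) auto
  also have "\<dots> = exp (- (real n * y))" by (simp add: exp_of_nat_mult[symmetric])
  also have "\<dots> \<le> exp (- (e1 ^ J / 2 * T))"
  proof -
    have "T ^ J * T ^ 1 \<le> T ^ h" unfolding power_add[symmetric] using T h by (intro power_increasing) auto
    then have "T \<le> T ^ h / T ^ J" using T by (simp add: field_simps)
    then have "e1 ^ J / 2 * T \<le> e1 ^ J / 2 * (T ^ h / T ^ J)" using e by (intro mult_left_mono) auto
    also have "\<dots> = T ^ h / 2 * y" by (simp add: y_def power_divide)
    also have "\<dots> \<le> real n * y" using n y by (intro mult_right_mono) auto
    finally show ?thesis by simp
  qed
  also have "\<dots> \<le> fact P / (e1 ^ J / 2 * T) ^ P" by (rule exp_minus_le) (use e T in auto)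
  also have "\<dots> = fact P * (2 / e1 ^ J) ^ P / T ^ P" by (simp add: power_mult_distrib power_divide)
  finally show ?thesis by (simp add: y_def)
qed

text \<open>By a b <= (a^2 + b^2) / 2, a change of every entry by at most \<delta> changes the form
  by at most \<delta> \<open>card J\<close> times the squared length.\<close>

lemma coercive_perturb:
  fixes c c0 :: "'i \<Rightarrow> 'i \<Rightarrow> real"
  assumes J: "finite J" and l: "l * (\<Sum>s\<in>J. (a s)\<^sup>2) \<le> bilin J c0 a a"
    and \<delta>: "0 \<le> \<delta>" "\<And>s s'. s \<in> J \<Longrightarrow> s' \<in> J \<Longrightarrow> \<bar>c s s' - c0 s s'\<bar> \<le> \<delta>"
  shows "(l - \<delta> * real (card J)) * (\<Sum>s\<in>J. (a s)\<^sup>2) \<le> bilin J c a a"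
proof -
  have "bilin J c0 a a - bilin J c a a = (\<Sum>s\<in>J. \<Sum>s'\<in>J. a s * (c0 s s' - c s s') * a s')"
    by (simp add: bilin_def sum_subtractf algebra_simps)
  also have "\<dots> \<le> (\<Sum>s\<in>J. \<Sum>s'\<in>J. \<delta> * (((a s)\<^sup>2 + (a s')\<^sup>2) / 2))"
  proof (intro sum_mono)
    fix s s' assume s: "s \<in> J" "s' \<in> J"
    have "a s * (c0 s s' - c s s') * a s' \<le> \<bar>c s s' - c0 s s'\<bar> * \<bar>a s * a s'\<bar>"
      using abs_ge_self[of "a s * (c0 s s' - c s s') * a s'"] by (simp add: abs_mult abs_minus_commute mult_ac)
    also have "\<dots> \<le> \<delta> * (((a s)\<^sup>2 + (a s')\<^sup>2) / 2)"
    proof (rule mult_mono[OF \<delta>(2)[OF s]])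
      show "\<bar>a s * a s'\<bar> \<le> ((a s)\<^sup>2 + (a s')\<^sup>2) / 2"
        using sum_squares_bound[of "a s" "a s'"] sum_squares_bound[of "- a s" "a s'"] by (auto simp: abs_le_iff)
    qed (use \<delta> in auto)
    finally show "a s * (c0 s s' - c s s') * a s' \<le> \<delta> * (((a s)\<^sup>2 + (a s')\<^sup>2) / 2)" .
  qed
  also have "\<dots> = \<delta> * real (card J) * (\<Sum>s\<in>J. (a s)\<^sup>2)"
    by (simp add: sum.distrib add_divide_distrib distrib_left sum_distrib_left[symmetric] sum_divide_distrib[symmetric])
  finally show ?thesis using l by (simp add: left_diff_distrib)
qed

section \<open>Jets, dilations and choice of the scale\<close>

lemma class_C_mono: "q' \<le> q \<Longrightarrow> class_C q S u \<Longrightarrow> class_C q' S u"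
  by (simp add: class_C_def)

lemma norm_matrix_component: "\<bar>(m :: real^'j^'i) $ i $ j\<bar> \<le> norm m"
  using order_trans[OF component_le_norm_cart[of "m $ i" j] Finite_Cartesian_Product.norm_nth_le[of m i]] by simp

definition opt_mi :: "'d::finite option \<Rightarrow> 'd \<Rightarrow> nat" where
  "opt_mi b = mi_of_list (opt_list b)"

lemma mi_length_opt_mi: "mi_length (opt_mi b) \<le> 1"
  unfolding opt_mi_def by (simp only: mi_length_mi_of_list length_opt_list)

lemma mi_deriv_opt_mi: "mi_deriv (opt_mi b) u = iterated_partial (opt_list b) u"
  unfolding mi_deriv_eq opt_mi_def by (cases b) (simp_all add: opt_list_def mi_list_Nil mi_list_single)

lemma jet_cov:
  fixes X :: "'w \<Rightarrow> real^'d::finite \<Rightarrow> real^'k::finite"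
  assumes M: "prob_space M" and X: "centered_gaussian_field M S X" and S: "open S"
    and C: "\<And>\<omega>. \<omega> \<in> space M \<Longrightarrow> class_C q S (X \<omega>)" and q: "1 \<le> q"
    and x: "x \<in> S" and y: "y \<in> S"
  shows "mi_deriv2 (opt_mi (fst s)) (opt_mi (fst s')) (cov_kernel M X) x y $ snd s $ snd s' =
    (\<integral>\<omega>. jet (X \<omega>) s x * jet (X \<omega>) s' y \<partial>M)"
  unfolding jet_def
  by (subst mi_deriv2_cov_kernel[OF M X S C x y])
    (use order_trans[OF mi_length_opt_mi q] in \<open>auto simp: mi_deriv_opt_mi\<close>)

lemma dilate_open: "R \<noteq> 0 \<Longrightarrow> open S \<Longrightarrow> open (dilate R (S :: 'a::real_normed_vector set))"
  by (rule open_scaling)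

lemma mem_dilate: "R \<noteq> 0 \<Longrightarrow> z \<in> dilate R S \<longleftrightarrow> (1 / R) *\<^sub>R z \<in> S"
proof -
  assume R: "R \<noteq> 0"
  show ?thesis
  proof
    assume "z \<in> dilate R S"
    then show "(1 / R) *\<^sub>R z \<in> S" using R by auto
  next
    assume "(1 / R) *\<^sub>R z \<in> S"
    then have "R *\<^sub>R ((1 / R) *\<^sub>R z) \<in> dilate R S" by (rule imageI)
    then show "z \<in> dilate R S" using R by simp
  qed
qed

lemma coord_cube_subset_cball: "0 \<le> \<rho> \<Longrightarrow> \<rho> \<le> 1 \<Longrightarrow> coord_cube (x :: real^'d::finite) \<rho> \<subseteq> cball x (real CARD('d))"
proof
  fix z assume \<rho>: "0 \<le> \<rho>" "\<rho> \<le> 1" and z: "z \<in> coord_cube x \<rho>"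
  have "norm (x - z) \<le> (\<Sum>j\<in>UNIV. \<bar>(x - z) $ j\<bar>)" by (rule norm_le_l1_cart)
  also have "\<dots> \<le> (\<Sum>j\<in>(UNIV::'d set). 1)"
  proof (rule sum_mono)
    fix j
    have "x $ j \<le> z $ j" "z $ j \<le> x $ j + \<rho>" using z by (auto simp: coord_cube_def)
    then show "\<bar>(x - z) $ j\<bar> \<le> 1" using \<rho> by (simp add: abs_le_iff)
  qed
  finally show "z \<in> cball x (real CARD('d))" by (simp add: dist_norm)
qed

lemma root_scale:
  fixes R T0 :: real
  assumes "1 \<le> T0" "T0 ^ k \<le> R" "0 < k"
  obtains T where "T0 \<le> T" "T ^ k = R"
proof
  have R: "0 \<le> R" using assms by (meson order_trans zero_le_one zero_le_power)
  show "root k R ^ k = R" using assms R by simp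
  have "root k (T0 ^ k) \<le> root k R" using assms by simp
  then show "T0 \<le> root k R" using assms by (simp add: real_root_power_cancel)
qed

lemma DC_obtain:
  fixes F :: "real \<Rightarrow> 'v \<Rightarrow> real^'d::finite \<Rightarrow> real^'k::finite"
  assumes "DC q s U \<R> N F"
  obtains g u :: "real^'d \<Rightarrow> real" and D :: real where "in_Lp s u" "\<And>z. g z \<le> u z" "\<And>z. g (- z) = g z"
    "\<And>z. g z \<le> D" "0 < D"
    "\<And>R x y \<alpha> \<beta>. R \<in> \<R> \<Longrightarrow> x \<in> dilate R U \<Longrightarrow> y \<in> dilate R U \<Longrightarrow> mi_length \<alpha> \<le> q \<Longrightarrow> mi_length \<beta> \<le> q \<Longrightarrow>
      norm (mi_deriv2 \<alpha> \<beta> (cov_kernel (N R) (F R)) x y) \<le> g (y - x)"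
proof -
  obtain w g where w: "w > 0" and g: "\<And>x. g (- x) = g x" "bounded (range g)"
    "in_Lp s (\<lambda>x::real^'d. SUP y\<in>cball 0 w. g (x + y))"
    "\<And>R x y \<alpha> \<beta>. R \<in> \<R> \<Longrightarrow> x \<in> dilate R U \<Longrightarrow> y \<in> dilate R U \<Longrightarrow> mi_length \<alpha> \<le> q \<Longrightarrow> mi_length \<beta> \<le> q \<Longrightarrow>
      norm (mi_deriv2 \<alpha> \<beta> (cov_kernel (N R) (F R)) x y) \<le> g (y - x)"
    using assms unfolding DC_def by metis
  obtain a where a: "\<And>z. norm (g z) \<le> a" using g(2) unfolding bounded_iff by auto
  show thesis
  \<comment> \<open>The summand 1 makes the uniform bound strictly positive, so that its square root
    can serve as the locale constant \<open>B\<close>.\<close>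
  proof (rule that[of "\<lambda>x. SUP y\<in>cball 0 w. g (x + y)" g "\<bar>a\<bar> + 1"])
    show "g z \<le> (SUP y\<in>cball 0 w. g (z + y))" for z by (rule le_local_sup[OF g(2) w])
    show "g z \<le> \<bar>a\<bar> + 1" for z using a[of z] by simp
  qed (use g in auto)
qed

text \<open>Common to both cases. The form \<kappa> is the covariance of the limiting jet restricted
  to \<open>J\<close>; its coercivity passes to the fields \<open>F R\<close> for large R by
  \<open>lim\<close>.\<close>

theorem hole_prob_bigo:
  fixes U \<Omega> A :: "(real^'d::finite) set" and \<R> :: "real set" and N :: "real \<Rightarrow> 'v measure"
    and F :: "real \<Rightarrow> 'v \<Rightarrow> real^'d \<Rightarrow> real^'k::finite" and \<iota> :: "'k \<Rightarrow> 'd"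
    and J :: "('d option \<times> 'k) set" and \<kappa> :: "'d option \<times> 'k \<Rightarrow> 'd option \<times> 'k \<Rightarrow> real"
  assumes U: "open U" and A: "A \<subseteq> \<Omega>" "\<Omega> \<subseteq> U" "A \<noteq> {}" "open A"
    and pos: "\<R> \<subseteq> {0<..}" and N: "\<And>R. R \<in> \<R> \<Longrightarrow> prob_space (N R)"
    and X: "\<And>R. R \<in> \<R> \<Longrightarrow> centered_gaussian_field (N R) (dilate R U) (F R)"
    and C: "\<And>R \<omega>. R \<in> \<R> \<Longrightarrow> \<omega> \<in> space (N R) \<Longrightarrow> class_C 2 (dilate R U) (F R \<omega>)"
    and DC: "DC 2 2 U \<R> N F"
    and \<kappa>: "\<And>s s'. \<kappa> s s' = \<kappa> s' s" "\<forall>a. (\<exists>s\<in>J. a s \<noteq> 0) \<longrightarrow> 0 < bilin J \<kappa> a a"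
    and lim: "\<And>\<delta>. 0 < \<delta> \<Longrightarrow> \<forall>\<^sub>F R in to_infinity_along \<R>. \<forall>x\<in>\<Omega>. \<forall>s\<in>J. \<forall>s'\<in>J.
      \<bar>(\<integral>\<omega>. jet (F R \<omega>) s (R *\<^sub>R x) * jet (F R \<omega>) s' (R *\<^sub>R x) \<partial>N R) - \<kappa> s s'\<bar> \<le> \<delta>"
    and \<iota>: "inj \<iota>"
    and rep: "\<And>R s. R \<in> \<R> \<Longrightarrow> fst s = None \<or> (\<exists>i. fst s = Some (\<iota> i)) \<Longrightarrow> \<exists>s'\<in>J. (\<forall>\<rho>. jet_target \<iota> \<rho> s = jet_target \<iota> \<rho> s') \<and>
      (\<forall>\<omega>\<in>space (N R). \<forall>y\<in>dilate R U. jet (F R \<omega>) s y = jet (F R \<omega>) s' y)"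
  shows "hole_prob N F U A \<in> O[to_infinity_along \<R>](\<lambda>R. R powr (- (real p * real CARD('d))))"
proof -
  have J: "finite J" by simp
  obtain g u and D :: real where u: "in_Lp 2 u" "\<And>z. g z \<le> u z" and ge: "\<And>z. g (- z) = g z" and gD: "\<And>z. g z \<le> D" and D: "0 < D"
    and cov: "\<And>R x y \<alpha> \<beta>. R \<in> \<R> \<Longrightarrow> x \<in> dilate R U \<Longrightarrow> y \<in> dilate R U \<Longrightarrow> mi_length \<alpha> \<le> 2 \<Longrightarrow> mi_length \<beta> \<le> 2 \<Longrightarrow>
      norm (mi_deriv2 \<alpha> \<beta> (cov_kernel (N R) (F R)) x y) \<le> g (y - x)"
    using DC_obtain[OF DC] by metis
  obtain l0 where l0: "l0 > 0" "\<And>a. l0 * (\<Sum>i\<in>J. (a i)\<^sup>2) \<le> bilin J \<kappa> a a"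
    using bilin_coercive[OF J \<kappa>] by blast
  define l where "l = l0 / 2"
  \<comment> \<open>Small enough that the perturbation costs at most half of the coercivity
    constant.\<close>
  define \<delta> where "\<delta> = l0 / 2 / (real (card J) + 1)"
  have l: "0 < l" and \<delta>: "0 < \<delta>" using l0 by (auto simp: l_def \<delta>_def)
  have l\<delta>: "l \<le> l0 - \<delta> * real (card J)"
  proof -
    have "\<delta> * real (card J) \<le> \<delta> * (real (card J) + 1)" using \<delta> by simp
    also have "\<dots> = l0 / 2"
      unfolding \<delta>_def by (rule nonzero_eq_divide_eq[THEN iffD1, OF _ refl]) linarith
    finally show ?thesis by (simp add: l_def)
  qed
  obtain a0 r0 where r0: "0 < r0" "ball a0 r0 \<subseteq> A" using A(3,4) openE by blast
  \<comment> \<open>The points are chosen in the ball of half the radius, so that the cubes at these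
    points still fit into the dilation of \<open>A\<close>.\<close>
  define ra where "ra = r0 / 2"
  have ra: "0 < ra" "ball a0 (2 * ra) \<subseteq> A" using r0 by (auto simp: ra_def)
  \<comment> \<open>Two requirements: h > card J, so that T^h trials outweigh a success probability
    of order T^(-card J), and h >= 3, so that a noise variance of order T^(-h) is small against
    T^(-2).\<close>
  define h where "h = card J + 3"
  \<comment> \<open>With T^(6h) = R this makes T^P equal to R^(pd), the target rate.\<close>
  define P where "P = 6 * h * (p * CARD('d))"
  define r where "r = h + P + 2 * CARD('k)"
  define m where "m = h + P"
  define c where "c = 1 / (12 * real CARD('k))"
  define B where "B = sqrt D"
  define e0 where "e0 = c / (1 + (real (card J))\<^sup>2 * D / sqrt l)"
  define e1 where "e1 = e0 / 2 * exp (- ((real (card J) / sqrt l + 1)\<^sup>2)) / 4"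
  define D3 where "D3 = real (card J) ^ 3 / l"
  define V where "V = unit_ball_vol (real CARD('d)) * ra ^ CARD('d)"
  define K where "K = (\<integral>z. (u z)\<^sup>2 \<partial>lebesgue)"
  \<comment> \<open>Each summand serves one requirement on T: 2 for rounding T^h down to an integer
    at a loss of at most half, \<open>D3\<close> for \<tau> <= 1, \<open>K / V\<close> for free
    volume when points are selected, and the last one for cubes of side at most 1 inside the larger
    ball.\<close>
  define T0 where "T0 = 2 + D3 + K / V + real CARD('d) / ra"
  define k1 where "k1 = normal_tail_const r * (2 * 2 ^ CARD('k) * (real CARD('k))\<^sup>2)"
  define k2 where "k2 = (real CARD('k) + 1) * B / c"
  define Cst where "Cst = k1 * k2 ^ (2 * r) + (real (card J) * normal_tail_const m * (4 * D3 / e0\<^sup>2) ^ m + fact P * (2 / e1 ^ card J) ^ P)"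
  have V: "0 < V" using ra by (simp add: V_def)
  have K: "0 \<le> K" by (simp add: K_def)
  have D3: "0 \<le> D3" using l by (simp add: D3_def)
  have c: "0 < c" "c \<le> 1"
  proof -
    have "1 \<le> real CARD('k)" by (simp add: Suc_le_eq)
    then have "12 * real CARD('k) \<ge> 1" by linarith
    then show "c \<le> 1" unfolding c_def by (subst divide_le_eq_1) linarith
  qed (simp add: c_def)
  have q0: "0 \<le> (real (card J))\<^sup>2 * D / sqrt l" using D l by simp
  have e0: "0 < e0" "e0 \<le> 1"
  proof -
    show "0 < e0" unfolding e0_def using c q0 by (intro divide_pos_pos) auto
    show "e0 \<le> 1" unfolding e0_def using c q0 by (subst divide_le_eq_1) auto
  qed
  have e1: "0 < e1" "e1 \<le> 1"
  proof -
    show "0 < e1" using e0 by (simp add: e1_def)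
    have "e0 / 2 * exp (- ((real (card J) / sqrt l + 1)\<^sup>2)) / 4 \<le> 1 / 2 * 1 / 4"
      using e0 by (intro divide_right_mono mult_mono) auto
    then show "e1 \<le> 1" by (simp add: e1_def)
  qed
  have T0: "2 \<le> T0" "D3 \<le> T0" "K / V \<le> T0 - 2" "real CARD('d) / ra \<le> T0"
    using D3 K V ra by (auto simp: T0_def)
  have main: "hole_prob N F U A R \<le> Cst * R powr (- (real p * real CARD('d)))"
    if R: "R \<in> \<R>" "T0 ^ (6 * h) \<le> R"
      and close: "\<forall>x\<in>\<Omega>. \<forall>s\<in>J. \<forall>s'\<in>J. \<bar>(\<integral>\<omega>. jet (F R \<omega>) s (R *\<^sub>R x) * jet (F R \<omega>) s' (R *\<^sub>R x) \<partial>N R) - \<kappa> s s'\<bar> \<le> \<delta>"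
    for R
  proof -
    have R0: "0 < R" using R pos by auto
    obtain T where T: "T0 \<le> T" "T ^ (6 * h) = R"
      by (rule root_scale[of T0 "6 * h" R]) (use R T0 in \<open>auto simp: h_def\<close>)
    have T1: "1 \<le> T" "2 \<le> T" using T T0 by auto
    have Th: "T \<le> T ^ h" using T1 power_increasing[of 1 h T] by (simp add: h_def)
    define n where "n = nat \<lfloor>T ^ h\<rfloor>"
    define \<rho> where "\<rho> = 1 / T"
    define \<theta> where "\<theta> = 1 / T ^ (2 * h)"
    define S where "S = dilate R U"
    have n: "real n \<le> T ^ h" "T ^ h / 2 \<le> real n"
    proof -
      have "real n = of_int \<lfloor>T ^ h\<rfloor>" using T1 by (simp add: n_def)
      then show "real n \<le> T ^ h" "T ^ h / 2 \<le> real n" using Th T1 by linarith+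
    qed
    have \<rho>: "0 < \<rho>" "\<rho> \<le> 1" using T1 by (auto simp: \<rho>_def)
    have \<theta>: "0 < \<theta>" using T1 by (simp add: \<theta>_def)
    have S: "open S" unfolding S_def using R0 U by (intro dilate_open) auto
    have RT: "T \<le> R" using T1 power_increasing[of 1 "6 * h" T] by (simp add: T(2)[symmetric] h_def)
    \<comment> \<open>At most T^h points, each forbidding a volume of at most K / \<theta>^2 = K
      T^(4h): the total K T^(5h) stays below V T^(6h) = V R, hence below the volume V R^d of the
      ball.\<close>
    have sel: "real n * ((\<integral>z. (u z)\<^sup>2 \<partial>lebesgue) / \<theta>\<^sup>2) < unit_ball_vol (real CARD('d)) * (R * ra) ^ CARD('d)"
    proof -
      have "real n * (K / \<theta>\<^sup>2) \<le> T ^ h * (K * T ^ (4 * h))"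
        using n K T1 by (intro mult_mono) (auto simp: \<theta>_def power_divide simp flip: power_mult)
      also have "\<dots> = K * T ^ (5 * h)" by (simp flip: power_add)
      also have "\<dots> < V * T * T ^ (5 * h)"
      proof (rule mult_strict_right_mono)
        have "K / V < T" using T0 T by linarith
        then show "K < V * T" using V by (simp add: field_simps)
      qed (use T1 in auto)
      also have "\<dots> \<le> V * T ^ h * T ^ (5 * h)" using V Th T1 by (intro mult_right_mono mult_left_mono) auto
      also have "\<dots> = V * R" unfolding T(2)[symmetric] by (simp add: mult.assoc flip: power_add)
      also have "\<dots> \<le> V * R ^ CARD('d)"
      proof (rule mult_left_mono)
        have "R ^ 1 \<le> R ^ CARD('d)" by (rule power_increasing) (use RT T1 in \<open>auto simp: Suc_le_eq\<close>)
        then show "R \<le> R ^ CARD('d)" by simp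
      qed (use V in auto)
      finally show ?thesis by (simp add: K_def V_def power_mult_distrib mult_ac)
    qed
    have "0 \<le> R * ra" using R0 ra by simp
    from select_decorrelated_points[OF u ge \<theta> this sel, of "R *\<^sub>R a0"]
    obtain x where x': "(\<forall>i<n. x i \<in> ball (R *\<^sub>R a0) (R * ra)) \<and> (\<forall>i<n. \<forall>j<n. i \<noteq> j \<longrightarrow> g (x j - x i) \<le> \<theta>)"
      by (elim exE)
    have x: "x i \<in> ball (R *\<^sub>R a0) (R * ra)" "j < n \<Longrightarrow> i \<noteq> j \<Longrightarrow> g (x j - x i) \<le> \<theta>" if "i < n" for i j
      using x' that by blast+
    have inA: "(1 / R) *\<^sub>R z \<in> A" if "z \<in> ball (R *\<^sub>R a0) (R * (2 * ra))" for z
    proof -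
      have "R * dist a0 ((1 / R) *\<^sub>R z) = norm (R *\<^sub>R (a0 - (1 / R) *\<^sub>R z))" using R0 by (simp add: dist_norm)
      also have "\<dots> = dist (R *\<^sub>R a0) z" using R0 by (simp add: dist_norm scaleR_diff_right)
      also have "\<dots> < R * (2 * ra)" using that by simp
      finally show ?thesis using R0 ra(2) by auto
    qed
    have inA1: "(1 / R) *\<^sub>R x i \<in> A" if "i < n" for i
      using x(1)[OF that] R0 ra by (intro inA) (auto intro: less_le_trans)
    have cubeA: "(1 / R) *\<^sub>R z \<in> A" if i: "i < n" and z: "z \<in> coord_cube (x i) \<rho>" for i z
    proof (rule inA)
      have "dist (x i) z \<le> real CARD('d)" using coord_cube_subset_cball[of \<rho> "x i"] \<rho> z by auto
      also have "\<dots> \<le> T0 * ra" using T0(4) ra by (simp add: field_simps)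
      also have "\<dots> \<le> R * ra" using T RT ra by (intro mult_right_mono) auto
      finally have "dist (x i) z \<le> R * ra" .
      moreover have "dist (R *\<^sub>R a0) (x i) < R * ra" using x(1)[OF i] by simp
      ultimately show "z \<in> ball (R *\<^sub>R a0) (R * (2 * ra))"
        using dist_triangle[of "R *\<^sub>R a0" z "x i"] by simp
    qed
    have AS: "z \<in> S" if "(1 / R) *\<^sub>R z \<in> A" for z
      using that A R0 by (auto simp: S_def mem_dilate[of R])
    have cube: "coord_cube (x i) \<rho> \<subseteq> S" if "i < n" for i using cubeA[OF that] AS by blast
    have xS: "x i \<in> S" if "i < n" for i using AS inA1[OF that] by blast
    note NR = N[OF R(1)] and XR = X[OF R(1), folded S_def] and CR = C[OF R(1), folded S_def]
    have covj: "\<bar>\<integral>\<omega>. jet (F R \<omega>) s y * jet (F R \<omega>) s' z \<partial>N R\<bar> \<le> g (z - y)" if "y \<in> S" "z \<in> S" for s s' y z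
    proof -
      have "\<bar>mi_deriv2 (opt_mi (fst s)) (opt_mi (fst s')) (cov_kernel (N R) (F R)) y z $ snd s $ snd s'\<bar>
        \<le> norm (mi_deriv2 (opt_mi (fst s)) (opt_mi (fst s')) (cov_kernel (N R) (F R)) y z)" by (rule norm_matrix_component)
      also have "\<dots> \<le> g (z - y)"
        using that mi_length_opt_mi[of "fst s"] mi_length_opt_mi[of "fst s'"] by (intro cov[OF R(1)]) (auto simp: S_def)
      also have "mi_deriv2 (opt_mi (fst s)) (opt_mi (fst s')) (cov_kernel (N R) (F R)) y z $ snd s $ snd s' =
          (\<integral>\<omega>. jet (F R \<omega>) s y * jet (F R \<omega>) s' z \<partial>N R)"
        by (rule jet_cov[OF NR XR S CR _ that]) auto
      finally show ?thesis .
    qed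
    interpret smooth_gaussian_field "N R" S "F R" B
    proof (rule smooth_gaussian_field.intro)
      show "0 < B" using D by (simp add: B_def)
      \<comment> \<open>The diagonal of the differentiated kernel bounds the second derivative in
        the chosen order, whichever of the two it is.\<close>
      have b: "\<forall>y\<in>S. \<forall>c. (\<integral>\<omega>. (iterated_partial (mi_list (mi_of_list [a, b])) (F R \<omega>) y $ c)\<^sup>2 \<partial>N R) \<le> B\<^sup>2" for a b
      proof (intro ballI allI)
        fix y c assume y: "y \<in> S"
        let ?\<alpha> = "mi_of_list [a, b] :: 'd \<Rightarrow> nat"
        have m2: "mi_length ?\<alpha> \<le> 2" unfolding mi_length_mi_of_list by simp
        have "(\<integral>\<omega>. (iterated_partial (mi_list ?\<alpha>) (F R \<omega>) y $ c)\<^sup>2 \<partial>N R) = mi_deriv2 ?\<alpha> ?\<alpha> (cov_kernel (N R) (F R)) y y $ c $ c"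
          by (subst mi_deriv2_cov_kernel[OF NR XR S CR y y m2 m2]) (simp_all add: mi_deriv_eq power2_eq_square)
        also have "\<dots> \<le> norm (mi_deriv2 ?\<alpha> ?\<alpha> (cov_kernel (N R) (F R)) y y)"
          by (rule order_trans[OF abs_ge_self norm_matrix_component])
        also have "\<dots> \<le> g (y - y)" using y m2 by (intro cov[OF R(1)]) (auto simp: S_def)
        also have "\<dots> \<le> B\<^sup>2" using gD[of 0] D by (simp add: B_def)
        finally show "(\<integral>\<omega>. (iterated_partial (mi_list ?\<alpha>) (F R \<omega>) y $ c)\<^sup>2 \<partial>N R) \<le> B\<^sup>2" .
      qed
      show "(\<forall>y\<in>S. \<forall>c. (\<integral>\<omega>. (iterated_partial [a, b] (F R \<omega>) y $ c)\<^sup>2 \<partial>N R) \<le> B\<^sup>2) \<or>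
        (\<forall>y\<in>S. \<forall>c. (\<integral>\<omega>. (iterated_partial [b, a] (F R \<omega>) y $ c)\<^sup>2 \<partial>N R) \<le> B\<^sup>2)" for a b
        using mi_list_pair[of a b]
      proof
        assume e: "mi_list (mi_of_list [a, b]) = [a, b]"
        show ?thesis by (rule disjI1) (rule b[of a b, unfolded e])
      next
        assume e: "mi_list (mi_of_list [a, b]) = [b, a]"
        show ?thesis by (rule disjI2) (rule b[of a b, unfolded e])
      qed
    qed (rule NR XR S CR; assumption)+
    have low: "l * (\<Sum>s\<in>J. (a s)\<^sup>2) \<le> bilin J (\<lambda>s s'. \<integral>\<omega>. jet (F R \<omega>) s (x i) * jet (F R \<omega>) s' (x i) \<partial>N R) a a" if i: "i < n" for i a
    proof -
      have "l * (\<Sum>s\<in>J. (a s)\<^sup>2) \<le> (l0 - \<delta> * real (card J)) * (\<Sum>s\<in>J. (a s)\<^sup>2)"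
        using l\<delta> by (intro mult_right_mono sum_nonneg) auto
      also have "\<dots> \<le> bilin J (\<lambda>s s'. \<integral>\<omega>. jet (F R \<omega>) s (x i) * jet (F R \<omega>) s' (x i) \<partial>N R) a a"
      proof (rule coercive_perturb[OF J l0(2) less_imp_le[OF \<delta>]])
        fix s s' assume s: "s \<in> J" "s' \<in> J"
        have "(1 / R) *\<^sub>R x i \<in> \<Omega>" using inA1[OF i] A by blast
        from bspec[OF bspec[OF bspec[OF close this] s(1)] s(2)]
        show "\<bar>(\<integral>\<omega>. jet (F R \<omega>) s (x i) * jet (F R \<omega>) s' (x i) \<partial>N R) - \<kappa> s s'\<bar> \<le> \<delta>" using R0 by simp
      qed
      finally show ?thesis .
    qed
    define \<tau> where "\<tau> = real n * real (card J) ^ 3 / l * \<theta>"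
    have \<tau>: "0 \<le> \<tau>" "\<tau> \<le> D3 / T ^ h" "\<tau> \<le> 1"
    proof -
      show "0 \<le> \<tau>" using l \<theta> by (simp add: \<tau>_def)
      have "\<tau> = real n * (D3 * \<theta>)" by (simp add: \<tau>_def D3_def)
      also have "\<dots> \<le> T ^ h * (D3 * \<theta>)" using n D3 \<theta> by (intro mult_right_mono) auto
      also have "\<dots> = D3 / T ^ h" 
      proof -
        have "T ^ (2 * h) = T ^ h * T ^ h" by (simp only: mult_2 power_add)
        then show ?thesis using T1 by (simp add: \<theta>_def)
      qed
      finally show t: "\<tau> \<le> D3 / T ^ h" .
      have "D3 \<le> T ^ h" using T0 T Th by linarith
      then have "D3 / T ^ h \<le> 1" using T1 by (simp add: divide_le_eq_1)
      with t show "\<tau> \<le> 1" by simp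
    qed
    have eps: "e0 / T = c * \<rho> / (1 + (real (card J))\<^sup>2 * D / sqrt l)" by (simp add: e0_def \<rho>_def)
    obtain E where E: "E \<in> sets (N R)" "{\<omega> \<in> space (N R). \<forall>i<n. \<forall>z\<in>coord_cube (x i) \<rho>. F R \<omega> z \<noteq> 0} \<subseteq> E"
      and EB: "measure (N R) E \<le> real n * (normal_tail_const r * (2 * 2 ^ CARD('k) * (real CARD('k))\<^sup>2) * (\<rho> * ((real CARD('k) + 1) * B / c)) ^ (2 * r))
      + (real (n * card J) * (normal_tail_const m * (\<tau> / (e0 / T / 2)\<^sup>2) ^ m)
         + (1 - (e0 / T / 2 * exp (- ((real (card J) / sqrt l + 1)\<^sup>2)) / 4) ^ card J) ^ n)"
    proof -
      have "\<exists>E\<in>sets (N R). {\<omega> \<in> space (N R). \<forall>i<n. \<forall>z\<in>coord_cube (x i) \<rho>. F R \<omega> z \<noteq> 0} \<subseteq> E \<and>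
        measure (N R) E \<le> real n * (normal_tail_const r * (2 * 2 ^ CARD('k) * (real CARD('k))\<^sup>2) * (\<rho> * ((real CARD('k) + 1) * B / c)) ^ (2 * r))
      + (real (n * card J) * (normal_tail_const m * (\<tau> / (e0 / T / 2)\<^sup>2) ^ m)
         + (1 - (e0 / T / 2 * exp (- ((real (card J) / sqrt l + 1)\<^sup>2)) / 4) ^ card J) ^ n)"
        unfolding c_def
      proof (rule hole_single_scale[OF \<iota> cube \<rho> _ l less_imp_le[OF D] low _ _ _ less_imp_le[OF \<theta>] \<tau>_def \<tau>(3) eps[unfolded c_def]])
        show "2 * CARD('k) \<le> r" by (simp add: r_def)
        show "\<bar>\<integral>\<omega>. jet (F R \<omega>) s (x i) * jet (F R \<omega>) s' (x i) \<partial>N R\<bar> \<le> D" if "i < n" for i s s'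
          by (rule order_trans[OF covj[OF xS[OF that] xS[OF that]] gD])
        show "\<bar>\<integral>\<omega>. jet (F R \<omega>) s (x i) * jet (F R \<omega>) s' (x i') \<partial>N R\<bar> \<le> \<theta>" if "i < n" "i' < n" "i \<noteq> i'" for i i' s s'
          by (rule order_trans[OF covj[OF xS[OF that(1)] xS[OF that(2)]] x(2)[OF that]])
        show "\<exists>s'\<in>J. (\<forall>\<rho>. jet_target \<iota> \<rho> s = jet_target \<iota> \<rho> s') \<and> (\<forall>\<omega>\<in>space (N R). \<forall>y\<in>S. jet (F R \<omega>) s y = jet (F R \<omega>) s' y)"
          if "fst s = None \<or> (\<exists>i. fst s = Some (\<iota> i))" for s
          using rep[OF R(1) that] unfolding S_def .
      qed
      then show thesis using that by blast
    qed
    let ?hole = "{\<omega> \<in> space (N R). dilate (1 / R) (zero_set (dilate R U) (F R \<omega>)) \<inter> A = {}}"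
    have sub: "?hole \<subseteq> E"
    proof
      fix \<omega> assume w: "\<omega> \<in> ?hole"
      have "F R \<omega> z \<noteq> 0" if "i < n" "z \<in> coord_cube (x i) \<rho>" for i z
      proof
        assume "F R \<omega> z = 0"
        then have "z \<in> zero_set (dilate R U) (F R \<omega>)" using cube[OF that(1)] that(2) by (auto simp: zero_set_def S_def)
        then have "(1 / R) *\<^sub>R z \<in> dilate (1 / R) (zero_set (dilate R U) (F R \<omega>))" by (rule imageI)
        then show False using cubeA[OF that] w by blast
      qed
      then show "\<omega> \<in> E" using E(2) w by blast
    qed
    \<comment> \<open>Measurability of the hole event is not assumed. Since \<open>measure\<close>
      is 0 on non-measurable sets, the inequality holds in either case.\<close>
    have "hole_prob N F U A R \<le> measure (N R) E"
    proof (cases "?hole \<in> sets (N R)")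
      case True
      interpret prob_space "N R" by (rule NR)
      show ?thesis unfolding hole_prob_def by (rule finite_measure_mono[OF sub E(1)])
    next
      case False
      then show ?thesis unfolding hole_prob_def by (simp add: measure_notin_sets)
    qed
    also note EB
    also have "real n * (normal_tail_const r * (2 * 2 ^ CARD('k) * (real CARD('k))\<^sup>2) * (\<rho> * ((real CARD('k) + 1) * B / c)) ^ (2 * r)) \<le> k1 * k2 ^ (2 * r) / T ^ P"
      unfolding k1_def[symmetric] k2_def[symmetric] \<rho>_def
      by (rule chaining_term_bound[OF T1(1) _ n(1)])
        (use normal_tail_const_pos[of r] c D in \<open>auto simp: k1_def k2_def B_def r_def\<close>)
    also have "real (n * card J) * (normal_tail_const m * (\<tau> / (e0 / T / 2)\<^sup>2) ^ m) \<le> real (card J) * normal_tail_const m * (4 * D3 / e0\<^sup>2) ^ m / T ^ P"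
      unfolding of_nat_mult
      by (rule noise_term_bound[OF T1(1) _ n(1) _ _ _ _ \<tau>(1,2) e0(1)])
        (use normal_tail_const_pos[of m] in \<open>auto simp: m_def h_def\<close>)
    also have "e0 / T / 2 * exp (- ((real (card J) / sqrt l + 1)\<^sup>2)) / 4 = e1 / T" by (simp add: e1_def)
    also have "(1 - (e1 / T) ^ card J) ^ n \<le> fact P * (2 / e1 ^ card J) ^ P / T ^ P"
      by (rule block_term_bound[OF T1(1) n(2) _ e1]) (simp add: h_def)
    also have "k1 * k2 ^ (2 * r) / T ^ P + (real (card J) * normal_tail_const m * (4 * D3 / e0\<^sup>2) ^ m / T ^ P + fact P * (2 / e1 ^ card J) ^ P / T ^ P) = Cst * (1 / T ^ P)"
      by (simp add: Cst_def add_divide_distrib)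
    also have "1 / T ^ P = R powr (- (real p * real CARD('d)))"
    proof -
      have "R powr (real (p * CARD('d))) = R ^ (p * CARD('d))" using R0 by (rule powr_realpow)
      also have "\<dots> = T ^ P" unfolding P_def T(2)[symmetric] by (simp only: power_mult)
      finally show ?thesis by (simp add: powr_minus inverse_eq_divide)
    qed
    finally show ?thesis by simp
  qed
  show ?thesis
  proof (rule bigoI[of _ Cst])
    have "\<forall>\<^sub>F R in to_infinity_along \<R>. R \<in> \<R> \<and> T0 ^ (6 * h) \<le> R"
      unfolding to_infinity_along_def eventually_inf_principal
      using eventually_ge_at_top[of "T0 ^ (6 * h)"] by eventually_elim simp
    with lim[OF \<delta>] show "\<forall>\<^sub>F R in to_infinity_along \<R>. norm (hole_prob N F U A R) \<le> Cst * norm (R powr (- (real p * real CARD('d))))"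
    proof eventually_elim
      case (elim R)
      then show ?case using main[of R] by (simp add: hole_prob_def)
    qed
  qed
qed

section \<open>Zero sets and critical points\<close>

lemma DC_mono: "q' \<le> q \<Longrightarrow> DC q s U \<R> N F \<Longrightarrow> DC q' s U \<R> N F"
  unfolding DC_def by (meson order_trans)

text \<open>A coefficient family on \<open>J\<close> is transported along \<phi> and extended by 0
  to \<open>I\<close>: a non-degenerate vector has non-degenerate subvectors.\<close>

lemma nondegenerate_reindex:
  assumes nd: "nondegenerate_vector M I Y" and \<phi>: "inj_on \<phi> J" "\<phi> ` J \<subseteq> I" and J: "finite J" and a: "\<exists>s\<in>J. a s \<noteq> 0"
  shows "0 < bilin J (\<lambda>s s'. covar M (Y (\<phi> s)) (Y (\<phi> s'))) a a"
proof -
  define a' where "a' i = (if i \<in> \<phi> ` J then a (inv_into J \<phi> i) else 0)" for i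
  have a': "a' (\<phi> s) = a s" if "s \<in> J" for s using that \<phi> by (simp add: a'_def)
  obtain s where s: "s \<in> J" "a s \<noteq> 0" using a by blast
  have ne: "\<exists>i\<in>I. a' i \<noteq> 0" by (rule bexI[of _ "\<phi> s"]) (use s a' \<phi>(2) in auto)
  with nd have p: "0 < (\<Sum>i\<in>I. \<Sum>j\<in>I. a' i * covar M (Y i) (Y j) * a' j)" unfolding nondegenerate_vector_def by blast
  \<comment> \<open>A sum over an infinite set is 0, which contradicts positivity.\<close>
  have I: "finite I"
  proof (rule ccontr)
    assume "infinite I"
    then show False using p by simp
  qed
  have "(\<Sum>i\<in>I. \<Sum>j\<in>I. a' i * covar M (Y i) (Y j) * a' j) = (\<Sum>i\<in>\<phi> ` J. \<Sum>j\<in>I. a' i * covar M (Y i) (Y j) * a' j)"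
    by (rule sum.mono_neutral_right) (use I \<phi> in \<open>auto simp: a'_def\<close>)
  also have "\<dots> = (\<Sum>i\<in>\<phi> ` J. \<Sum>j\<in>\<phi> ` J. a' i * covar M (Y i) (Y j) * a' j)"
    by (intro sum.cong refl sum.mono_neutral_right) (use I \<phi> in \<open>auto simp: a'_def\<close>)
  also have "\<dots> = bilin J (\<lambda>s s'. covar M (Y (\<phi> s)) (Y (\<phi> s'))) a a"
    unfolding bilin_def sum.reindex[OF \<phi>(1)] o_def by (simp add: a' cong: sum.cong)
  finally show ?thesis using p by simp
qed

lemma covar_cong:
  assumes Y: "\<And>\<omega>. \<omega> \<in> space M \<Longrightarrow> Y \<omega> = Y' \<omega>" and Z: "\<And>\<omega>. \<omega> \<in> space M \<Longrightarrow> Z \<omega> = Z' \<omega>"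
  shows "covar M Y Z = covar M Y' Z'"
proof -
  have "integral\<^sup>L M Y = integral\<^sup>L M Y'" "integral\<^sup>L M Z = integral\<^sup>L M Z'"
    by (rule Bochner_Integration.integral_cong[OF refl], rule Y Z, assumption)+
  then show ?thesis unfolding covar_def by (intro Bochner_Integration.integral_cong) (simp_all add: Y Z)
qed

lemma covar_centered:
  assumes "prob_space M" "centered_normal M Y" "centered_normal M Z"
  shows "covar M Y Z = (\<integral>\<omega>. Y \<omega> * Z \<omega> \<partial>M)"
  using assms by (simp add: covar_def centered_normal_mean)

lemma jet_normal:
  assumes M: "prob_space M" and X: "centered_gaussian_field M S X" and S: "open S"
    and C: "\<And>\<omega>. \<omega> \<in> space M \<Longrightarrow> class_C q S (X \<omega>)" and q: "1 \<le> q" and y: "y \<in> S"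
  shows "centered_normal M (\<lambda>\<omega>. jet (X \<omega>) s y)"
  unfolding jet_def
  by (rule gaussian_space_normal[OF gaussian_space_field_span[OF M X] iterated_partial_in_span[OF M X S C y]])
    (use order_trans[OF length_opt_list q] in auto)

text \<open>\<open>ScL\<close> for the compact set {0} compares the kernels at w = z = 0. The
  supremum over \<Omega> makes the estimate uniform in x, and matrix entries of the kernel
  derivatives are covariances of jets.\<close>

lemma ScL_jet_limit:
  fixes F :: "real \<Rightarrow> 'v \<Rightarrow> real^'d::finite \<Rightarrow> real^'k::finite" and J :: "('d option \<times> 'k) set"
  assumes ScL: "ScL q M f \<Omega> \<R> N F" and q: "1 \<le> q" and U: "open U" "\<Omega> \<subseteq> U" and pos: "\<R> \<subseteq> {0<..}"
    and M: "prob_space M" "centered_gaussian_field M UNIV f" "\<And>\<omega>. \<omega> \<in> space M \<Longrightarrow> class_C q UNIV (f \<omega>)"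
    and N: "\<And>R. R \<in> \<R> \<Longrightarrow> prob_space (N R)"
    and X: "\<And>R. R \<in> \<R> \<Longrightarrow> centered_gaussian_field (N R) (dilate R U) (F R)"
    and C: "\<And>R \<omega>. R \<in> \<R> \<Longrightarrow> \<omega> \<in> space (N R) \<Longrightarrow> class_C q (dilate R U) (F R \<omega>)"
    and \<delta>: "0 < \<delta>"
  shows "\<forall>\<^sub>F R in to_infinity_along \<R>. \<forall>x\<in>\<Omega>. \<forall>s\<in>J. \<forall>s'\<in>J.
      \<bar>(\<integral>\<omega>. jet (F R \<omega>) s (R *\<^sub>R x) * jet (F R \<omega>) s' (R *\<^sub>R x) \<partial>N R) - (\<integral>\<omega>. jet (f \<omega>) s 0 * jet (f \<omega>) s' 0 \<partial>M)\<bar> \<le> \<delta>"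
proof -
  let ?n = "\<lambda>R \<alpha> \<beta> x w z. ennreal (norm (mi_deriv2 \<alpha> \<beta> (cov_kernel (N R) (F R)) (R *\<^sub>R x + w) (R *\<^sub>R x + z)
                       - mi_deriv2 \<alpha> \<beta> (cov_kernel M f) w z))"
  have "((\<lambda>R. SUP \<alpha>\<in>{\<alpha>. mi_length \<alpha> \<le> q}. SUP \<beta>\<in>{\<beta>. mi_length \<beta> \<le> q}. SUP x\<in>\<Omega>. SUP w\<in>{0}. SUP z\<in>{0}. ?n R \<alpha> \<beta> x w z)
        \<longlongrightarrow> 0) (to_infinity_along \<R>)"
    using ScL unfolding ScL_def by (elim allE[of _ "{0}"]) simp
  then have ev: "\<forall>\<^sub>F R in to_infinity_along \<R>. (SUP \<alpha>\<in>{\<alpha>. mi_length \<alpha> \<le> q}. SUP \<beta>\<in>{\<beta>. mi_length \<beta> \<le> q}. SUP x\<in>\<Omega>. SUP w\<in>{0}. SUP z\<in>{0}. ?n R \<alpha> \<beta> x w z) < ennreal \<delta>"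
    by (rule order_tendstoD) (use \<delta> in simp)
  have evR: "\<forall>\<^sub>F R in to_infinity_along \<R>. R \<in> \<R>"
    unfolding to_infinity_along_def eventually_inf_principal by simp
  from ev evR show ?thesis
  proof eventually_elim
    case (elim R)
    have R0: "0 < R" using elim(2) pos by auto
    note NR = N[OF elim(2)] and XR = X[OF elim(2)] and CR = C[OF elim(2)]
    have S: "open (dilate R U)" using R0 U by (intro dilate_open) auto
    show ?case
    proof (intro ballI)
      fix x and s s' :: "'d option \<times> 'k" assume x: "x \<in> \<Omega>"
      let ?\<alpha> = "opt_mi (fst s)" and ?\<beta> = "opt_mi (fst s')"
      have Rx: "R *\<^sub>R x \<in> dilate R U" using x U by blast
      have \<alpha>: "?\<alpha> \<in> {\<alpha>. mi_length \<alpha> \<le> q}" "?\<beta> \<in> {\<beta>. mi_length \<beta> \<le> q}"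
        using order_trans[OF mi_length_opt_mi q] by auto
      have "?n R ?\<alpha> ?\<beta> x 0 0 \<le> (SUP \<alpha>\<in>{\<alpha>. mi_length \<alpha> \<le> q}. SUP \<beta>\<in>{\<beta>. mi_length \<beta> \<le> q}. SUP x\<in>\<Omega>. SUP w\<in>{0}. SUP z\<in>{0}. ?n R \<alpha> \<beta> x w z)"
        by (rule SUP_upper2[OF \<alpha>(1)], rule SUP_upper2[OF \<alpha>(2)], rule SUP_upper2[OF x]) simp
      then have "?n R ?\<alpha> ?\<beta> x 0 0 < ennreal \<delta>" using elim(1) by (rule le_less_trans)
      then have n: "norm (mi_deriv2 ?\<alpha> ?\<beta> (cov_kernel (N R) (F R)) (R *\<^sub>R x) (R *\<^sub>R x) - mi_deriv2 ?\<alpha> ?\<beta> (cov_kernel M f) 0 0) < \<delta>"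
        using \<delta> by (simp add: ennreal_less_iff)
      have 1: "mi_deriv2 ?\<alpha> ?\<beta> (cov_kernel (N R) (F R)) (R *\<^sub>R x) (R *\<^sub>R x) $ snd s $ snd s' =
          (\<integral>\<omega>. jet (F R \<omega>) s (R *\<^sub>R x) * jet (F R \<omega>) s' (R *\<^sub>R x) \<partial>N R)"
        by (rule jet_cov[OF NR XR S CR q Rx Rx])
      have 2: "mi_deriv2 ?\<alpha> ?\<beta> (cov_kernel M f) 0 0 $ snd s $ snd s' = (\<integral>\<omega>. jet (f \<omega>) s 0 * jet (f \<omega>) s' 0 \<partial>M)"
        by (rule jet_cov[OF M(1,2) open_UNIV M(3) q]) auto
      have "\<bar>(mi_deriv2 ?\<alpha> ?\<beta> (cov_kernel (N R) (F R)) (R *\<^sub>R x) (R *\<^sub>R x) - mi_deriv2 ?\<alpha> ?\<beta> (cov_kernel M f) 0 0) $ snd s $ snd s'\<bar> \<le> \<delta>"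
        by (rule order_trans[OF norm_matrix_component less_imp_le[OF n]])
      then show "\<bar>(\<integral>\<omega>. jet (F R \<omega>) s (R *\<^sub>R x) * jet (F R \<omega>) s' (R *\<^sub>R x) \<partial>N R) - (\<integral>\<omega>. jet (f \<omega>) s 0 * jet (f \<omega>) s' 0 \<partial>M)\<bar> \<le> \<delta>"
        by (simp add: 1 2)
    qed
  qed
qed

section \<open>Gradients and symmetry of the Hessian\<close>

lemma gderiv_axis:
  fixes u :: "real^'d::finite \<Rightarrow> real"
  assumes "GDERIV u (x + a *\<^sub>R axis j 1) :> v"
  shows "((\<lambda>t. u (x + t *\<^sub>R axis j 1)) has_real_derivative v $ j) (at a)"
proof -
  have l: "((\<lambda>t. x + t *\<^sub>R axis j (1::real)) has_derivative (\<lambda>t. t *\<^sub>R axis j 1)) (at a)"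
    by (auto intro!: derivative_eq_intros)
  have "(u has_derivative (\<lambda>h. h \<bullet> v)) (at (x + a *\<^sub>R axis j 1))" using assms by (simp add: gderiv_def)
  from diff_chain_at[OF l this] have "((\<lambda>t. u (x + t *\<^sub>R axis j 1)) has_derivative (\<lambda>t. t *\<^sub>R axis j 1 \<bullet> v)) (at a)"
    by (simp add: o_def)
  then show ?thesis by (simp add: has_field_derivative_def inner_axis' mult_commute_abs)
qed

lemma partial_deriv_gradient:
  fixes u :: "real^'d::finite \<Rightarrow> real"
  assumes "GDERIV u x :> v"
  shows "partial_deriv j u x = v $ j"
  unfolding partial_deriv_def
  using gderiv_axis[of u x 0 j v] assms by (intro vector_derivative_at) (simp add: has_real_derivative_iff_has_vector_derivative)

text \<open>The mean value theorem, used first in direction a for the difference of \<open>u\<close>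
  over the shift in direction b and then in direction b for the a-component of the gradient.\<close>

lemma gradient_double_difference:
  fixes u :: "real^'d::finite \<Rightarrow> real"
  assumes t: "0 < t" and G: "\<And>y. y \<in> S \<Longrightarrow> GDERIV u y :> v y" and C: "class_C 1 S v"
    and sq: "\<And>\<sigma> \<tau>. \<sigma> \<in> {0..t} \<Longrightarrow> \<tau> \<in> {0..t} \<Longrightarrow> x + \<sigma> *\<^sub>R axis a 1 + \<tau> *\<^sub>R axis b 1 \<in> S"
  shows "\<exists>\<sigma>\<in>{0..t}. \<exists>\<tau>\<in>{0..t}. u (x + t *\<^sub>R axis a 1 + t *\<^sub>R axis b 1) - u (x + t *\<^sub>R axis a 1) - u (x + t *\<^sub>R axis b 1) + u x
    = t * (t * iterated_partial [b] v (x + \<sigma> *\<^sub>R axis a 1 + \<tau> *\<^sub>R axis b 1) $ a)"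
proof -
  define \<psi> where "\<psi> s = u ((x + t *\<^sub>R axis b 1) + s *\<^sub>R axis a 1) - u (x + s *\<^sub>R axis a 1)" for s
  have "\<exists>\<sigma>. 0 < \<sigma> \<and> \<sigma> < t \<and> \<psi> t - \<psi> 0 = (t - 0) * (v ((x + t *\<^sub>R axis b 1) + \<sigma> *\<^sub>R axis a 1) $ a - v (x + \<sigma> *\<^sub>R axis a 1) $ a)"
  proof (rule MVT2[OF t])
    fix s assume "0 \<le> s" "s \<le> t"
    then show "(\<psi> has_real_derivative v ((x + t *\<^sub>R axis b 1) + s *\<^sub>R axis a 1) $ a - v (x + s *\<^sub>R axis a 1) $ a) (at s)"
      unfolding \<psi>_def using sq[of s t] sq[of s 0] t
      by (intro DERIV_diff gderiv_axis G) (auto simp: add_ac)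
  qed
  then obtain \<sigma> where \<sigma>: "0 < \<sigma>" "\<sigma> < t" "\<psi> t - \<psi> 0 = t * (v ((x + t *\<^sub>R axis b 1) + \<sigma> *\<^sub>R axis a 1) $ a - v (x + \<sigma> *\<^sub>R axis a 1) $ a)"
    by auto
  let ?y = "x + \<sigma> *\<^sub>R axis a 1"
  have "\<exists>\<tau>. 0 < \<tau> \<and> \<tau> < t \<and> iterated_partial [] v (?y + t *\<^sub>R axis b 1) $ a - iterated_partial [] v (?y + 0 *\<^sub>R axis b 1) $ a =
    (t - 0) * iterated_partial [b] v (?y + \<tau> *\<^sub>R axis b 1) $ a"
  proof (rule MVT2[OF t])
    fix s assume "0 \<le> s" "s \<le> t"
    then show "((\<lambda>s. iterated_partial [] v (?y + s *\<^sub>R axis b 1) $ a) has_real_derivative iterated_partial [b] v (?y + s *\<^sub>R axis b 1) $ a) (at s)"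
      using \<sigma> by (intro class_C_deriv[OF C] sq) auto
  qed
  then obtain \<tau> where \<tau>: "0 < \<tau>" "\<tau> < t" "v (?y + t *\<^sub>R axis b 1) $ a - v ?y $ a = t * iterated_partial [b] v (?y + \<tau> *\<^sub>R axis b 1) $ a"
    by auto
  have sw: "(x + t *\<^sub>R axis b 1) + \<sigma> *\<^sub>R axis a 1 = ?y + t *\<^sub>R axis b 1" by (simp add: add_ac)
  have "\<psi> t - \<psi> 0 = t * (t * iterated_partial [b] v (?y + \<tau> *\<^sub>R axis b 1) $ a)"
    using \<sigma>(3) \<tau>(3) unfolding sw by simp
  moreover have "\<psi> t - \<psi> 0 = u (x + t *\<^sub>R axis a 1 + t *\<^sub>R axis b 1) - u (x + t *\<^sub>R axis a 1) - u (x + t *\<^sub>R axis b 1) + u x"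
    by (simp add: \<psi>_def add_ac)
  ultimately show ?thesis using \<sigma> \<tau>
    by (intro bexI[of _ \<sigma>] bexI[of _ \<tau>]) auto
qed

text \<open>Schwarz's theorem: the double difference does not see the order of the directions, yet
  the two orders evaluate it by the two mixed derivatives at points near \<open>x\<close>;
  continuity then forces these to agree at \<open>x\<close>.\<close>

lemma hessian_symmetric:
  fixes u :: "real^'d::finite \<Rightarrow> real"
  assumes S: "open S" and x: "x \<in> S" and G: "\<And>y. y \<in> S \<Longrightarrow> GDERIV u y :> v y" and C: "class_C 1 S v"
  shows "iterated_partial [a] v x $ b = iterated_partial [b] v x $ a"
proof (rule ccontr)
  let ?P = "\<lambda>y. iterated_partial [b] v y $ a" and ?Q = "\<lambda>y. iterated_partial [a] v y $ b"
  assume ne: "?Q x \<noteq> ?P x"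
  \<comment> \<open>Half of the supposed gap: two errors below \<open>e\<close> cannot bridge
    it.\<close>
  define e where "e = \<bar>?Q x - ?P x\<bar> / 2"
  have e: "0 < e" using ne by (simp add: e_def)
  have cont: "isCont (\<lambda>y. iterated_partial [i] v y $ j) x" for i j
  proof -
    have "continuous_on S (iterated_partial [i] v)" using C by (simp add: class_C_def del: iterated_partial.simps)
    then have "isCont (iterated_partial [i] v) x" using S x continuous_on_eq_continuous_at by blast
    then show ?thesis by (intro isCont_vec_nth)
  qed
  have near: "\<exists>d>0. \<forall>y. dist y x < d \<longrightarrow> dist (iterated_partial [i] v y $ j) (iterated_partial [i] v x $ j) < e" for i j
    using cont[of i j] e unfolding continuous_at_eps_delta by blast
  obtain d1 where d1: "d1 > 0" "\<forall>y. dist y x < d1 \<longrightarrow> dist (?P y) (?P x) < e" using near by blast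
  obtain d2 where d2: "d2 > 0" "\<forall>y. dist y x < d2 \<longrightarrow> dist (?Q y) (?Q x) < e" using near by blast
  obtain d3 where d3: "d3 > 0" "ball x d3 \<subseteq> S" using S x openE by blast
  define t where "t = min d1 (min d2 d3) / 3"
  have t: "0 < t" "2 * t < d1" "2 * t < d2" "2 * t < d3" using d1 d2 d3 by (auto simp: t_def)
  have dist: "dist (x + \<sigma> *\<^sub>R axis i 1 + \<tau> *\<^sub>R axis j 1) x \<le> 2 * t" if "\<sigma> \<in> {0..t}" "\<tau> \<in> {0..t}" for \<sigma> \<tau> i j
  proof -
    have "dist (x + \<sigma> *\<^sub>R axis i 1 + \<tau> *\<^sub>R axis j 1) x = norm (\<sigma> *\<^sub>R axis i 1 + \<tau> *\<^sub>R axis j (1::real))"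
      by (simp add: dist_norm add.assoc)
    also have "\<dots> \<le> norm (\<sigma> *\<^sub>R axis i (1::real)) + norm (\<tau> *\<^sub>R axis j (1::real))" by (rule norm_triangle_ineq)
    also have "\<dots> \<le> 2 * t" using that by simp
    finally show ?thesis .
  qed
  have sq: "x + \<sigma> *\<^sub>R axis i 1 + \<tau> *\<^sub>R axis j 1 \<in> S" if "\<sigma> \<in> {0..t}" "\<tau> \<in> {0..t}" for \<sigma> \<tau> i j
    using dist[OF that, of i j] t d3(2) by (auto simp: subset_iff dist_commute)
  obtain \<sigma> \<tau> where 1: "\<sigma> \<in> {0..t}" "\<tau> \<in> {0..t}"
    "u (x + t *\<^sub>R axis a 1 + t *\<^sub>R axis b 1) - u (x + t *\<^sub>R axis a 1) - u (x + t *\<^sub>R axis b 1) + u x = t * (t * ?P (x + \<sigma> *\<^sub>R axis a 1 + \<tau> *\<^sub>R axis b 1))"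
    using gradient_double_difference[OF t(1) G C sq, of a b] by blast
  obtain \<sigma>' \<tau>' where 2: "\<sigma>' \<in> {0..t}" "\<tau>' \<in> {0..t}"
    "u (x + t *\<^sub>R axis b 1 + t *\<^sub>R axis a 1) - u (x + t *\<^sub>R axis b 1) - u (x + t *\<^sub>R axis a 1) + u x = t * (t * ?Q (x + \<sigma>' *\<^sub>R axis b 1 + \<tau>' *\<^sub>R axis a 1))"
    using gradient_double_difference[OF t(1) G C sq, of b a] by blast
  have sw: "x + t *\<^sub>R axis b 1 + t *\<^sub>R axis a 1 = x + t *\<^sub>R axis a 1 + t *\<^sub>R axis b 1" by (simp add: add_ac)
  have "t * (t * ?P (x + \<sigma> *\<^sub>R axis a 1 + \<tau> *\<^sub>R axis b 1)) = t * (t * ?Q (x + \<sigma>' *\<^sub>R axis b 1 + \<tau>' *\<^sub>R axis a 1))"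
    using 1(3) 2(3) unfolding sw by linarith
  then have "?P (x + \<sigma> *\<^sub>R axis a 1 + \<tau> *\<^sub>R axis b 1) = ?Q (x + \<sigma>' *\<^sub>R axis b 1 + \<tau>' *\<^sub>R axis a 1)" using t by simp
  moreover have "dist (?P (x + \<sigma> *\<^sub>R axis a 1 + \<tau> *\<^sub>R axis b 1)) (?P x) < e"
    using d1(2) dist[OF 1(1,2), of a b] t by (meson le_less_trans)
  moreover have "dist (?Q (x + \<sigma>' *\<^sub>R axis b 1 + \<tau>' *\<^sub>R axis a 1)) (?Q x) < e"
    using d2(2) dist[OF 2(1,2), of b a] t by (meson le_less_trans)
  ultimately have "\<bar>?Q x - ?P x\<bar> < 2 * e" unfolding dist_real_def by linarith
  then show False by (simp add: e_def)
qed

section \<open>The two cases\<close>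

lemma hole_prob_zero_set:
  fixes U \<Omega> A :: "(real^'d::finite) set" and \<R> :: "real set" and M :: "'w measure" and N :: "real \<Rightarrow> 'v measure"
    and f :: "'w \<Rightarrow> real^'d \<Rightarrow> real^'k::finite" and F :: "real \<Rightarrow> 'v \<Rightarrow> real^'d \<Rightarrow> real^'k"
  assumes U: "open U" "\<Omega> \<subseteq> U" and A: "A \<subseteq> \<Omega>" "A \<noteq> {}" "open A"
    and pos: "\<R> \<subseteq> {0<..}" and q: "2 \<le> q" and prob: "prob_space M" "\<And>R. R \<in> \<R> \<Longrightarrow> prob_space (N R)"
    and k: "CARD('k) \<le> CARD('d)" and f: "centered_gaussian_field M UNIV f"
    and F: "\<And>R. R \<in> \<R> \<Longrightarrow> centered_gaussian_field (N R) (dilate R U) (F R)"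
    and Reg: "Reg q M f U \<R> N F" and ScL: "ScL q M f \<Omega> \<R> N F" and DC: "DC q 2 U \<R> N F" and ND: "ND q M f"
  shows "hole_prob N F U A \<in> O[to_infinity_along \<R>](\<lambda>R. R powr (- (real p * real CARD('d))))"
proof -
  obtain \<iota> :: "'k \<Rightarrow> 'd" where \<iota>: "inj \<iota>"
    using card_le_inj[of "UNIV :: 'k set" "UNIV :: 'd set"] k by auto
  have Cf: "class_C q UNIV (f \<omega>)" if "\<omega> \<in> space M" for \<omega> using Reg that by (simp add: Reg_def)
  have CF: "class_C q (dilate R U) (F R \<omega>)" if "R \<in> \<R>" "\<omega> \<in> space (N R)" for R \<omega>
    using Reg that by (simp add: Reg_def)
  have q1: "1 \<le> q" using q by simp
  define c0 where "c0 s s' = (\<integral>\<omega>. jet (f \<omega>) s 0 * jet (f \<omega>) s' 0 \<partial>M)" for s s' :: "'d option \<times> 'k"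
  define \<phi> where "\<phi> s = (0::nat, opt_mi (fst s), snd s)" for s :: "'d option \<times> 'k"
  let ?I = "{(i, \<alpha>, c::'k). i < 1 \<and> mi_length \<alpha> < q + 1}" and ?Y = "\<lambda>(i::nat, \<alpha>, c) \<omega>. mi_deriv \<alpha> (f \<omega>) 0 $ c"
  have nd: "nondegenerate_vector M ?I ?Y"
  proof -
    have "(\<forall>i<1. 0 < (\<lambda>_::nat. q + 1) i) \<and> (\<Sum>i<1. (\<lambda>_::nat. q + 1) i) = q + 1 \<and> inj_on (\<lambda>_::nat. 0 :: real^'d) {..<1}"
      by (simp add: inj_on_def)
    with ND[unfolded ND_def, rule_format, of 1 "\<lambda>_. q + 1" "\<lambda>_. 0"] show ?thesis by simp
  qed
  have mi_inj: "b = b'" if "opt_mi b = opt_mi b'" for b b' :: "'d option"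
  proof -
    have "mi_list (opt_mi b) = mi_list (opt_mi b')" using that by simp
    then show ?thesis unfolding opt_mi_def
      by (cases b; cases b') (simp_all add: opt_list_def mi_list_Nil mi_list_single)
  qed
  have \<phi>: "inj_on \<phi> UNIV" "\<phi> ` UNIV \<subseteq> ?I"
  proof -
    show "inj_on \<phi> UNIV" using mi_inj by (auto simp: inj_on_def \<phi>_def prod_eq_iff)
    have "mi_length (opt_mi b) < q + 1" for b :: "'d option" using mi_length_opt_mi[of b] q by linarith
    then show "\<phi> ` UNIV \<subseteq> ?I" by (auto simp: \<phi>_def)
  qed
  have Y: "?Y (\<phi> s) = (\<lambda>\<omega>. jet (f \<omega>) s 0)" for s by (simp add: \<phi>_def jet_def mi_deriv_opt_mi)
  have cv: "covar M (?Y (\<phi> s)) (?Y (\<phi> s')) = c0 s s'" for s s'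
    unfolding Y c0_def by (intro covar_centered prob jet_normal[OF prob(1) f open_UNIV Cf q1]) auto
  show ?thesis
  proof (rule hole_prob_bigo[where J=UNIV and \<kappa>=c0 and \<iota>=\<iota>])
    show "\<forall>a. (\<exists>s\<in>UNIV. a s \<noteq> 0) \<longrightarrow> 0 < bilin UNIV c0 a a"
      using nondegenerate_reindex[OF nd \<phi>] unfolding cv by simp
    show "c0 s s' = c0 s' s" for s s' by (simp add: c0_def mult.commute)
    show "\<forall>\<^sub>F R in to_infinity_along \<R>. \<forall>x\<in>\<Omega>. \<forall>s\<in>UNIV. \<forall>s'\<in>UNIV.
      \<bar>(\<integral>\<omega>. jet (F R \<omega>) s (R *\<^sub>R x) * jet (F R \<omega>) s' (R *\<^sub>R x) \<partial>N R) - c0 s s'\<bar> \<le> \<delta>" if "0 < \<delta>" for \<delta>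
      unfolding c0_def by (rule ScL_jet_limit[OF ScL q1 U pos prob(1) f Cf prob(2) F CF that])
    show "DC 2 2 U \<R> N F" by (rule DC_mono[OF q DC])
    show "class_C 2 (dilate R U) (F R \<omega>)" if "R \<in> \<R>" "\<omega> \<in> space (N R)" for R \<omega>
      by (rule class_C_mono[OF q CF[OF that]])
  qed (use U A pos prob F \<iota> in auto)
qed

text \<open>The jet of the gradient consists of derivatives of \<open>h\<close> of order 1 and 2, to
  which \<open>grad_ND\<close> at the origin with multiplicity q + 1 applies. The Hessian is
  symmetric, so non-degeneracy can hold only after one of each pair of equal entries is
  removed.\<close>

lemma hole_prob_critical_points:
  fixes U \<Omega> A :: "(real^'d::finite) set" and \<R> :: "real set" and M :: "'w measure" and N :: "real \<Rightarrow> 'v measure"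
    and h :: "'w \<Rightarrow> real^'d \<Rightarrow> real" and H :: "real \<Rightarrow> 'v \<Rightarrow> real^'d \<Rightarrow> real"
    and g :: "'w \<Rightarrow> real^'d \<Rightarrow> real^'d" and G :: "real \<Rightarrow> 'v \<Rightarrow> real^'d \<Rightarrow> real^'d"
  assumes U: "open U" "\<Omega> \<subseteq> U" and A: "A \<subseteq> \<Omega>" "A \<noteq> {}" "open A"
    and pos: "\<R> \<subseteq> {0<..}" and q: "2 \<le> q" and prob: "prob_space M" "\<And>R. R \<in> \<R> \<Longrightarrow> prob_space (N R)"
    and h: "\<And>\<omega> x. \<omega> \<in> space M \<Longrightarrow> GDERIV (h \<omega>) x :> g \<omega> x"
    and H: "\<And>R \<omega> x. R \<in> \<R> \<Longrightarrow> \<omega> \<in> space (N R) \<Longrightarrow> x \<in> dilate R U \<Longrightarrow> GDERIV (H R \<omega>) x :> G R \<omega> x"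
    and g: "centered_gaussian_field M UNIV g"
    and G: "\<And>R. R \<in> \<R> \<Longrightarrow> centered_gaussian_field (N R) (dilate R U) (G R)"
    and Reg: "Reg q M g U \<R> N G" and ScL: "ScL q M g \<Omega> \<R> N G" and DC: "DC q 2 U \<R> N G" and ND: "grad_ND q M h"
  shows "hole_prob N G U A \<in> O[to_infinity_along \<R>](\<lambda>R. R powr (- (real p * real CARD('d))))"
proof -
  have Cg: "class_C q UNIV (g \<omega>)" if "\<omega> \<in> space M" for \<omega> using Reg that by (simp add: Reg_def)
  have CG: "class_C q (dilate R U) (G R \<omega>)" if "R \<in> \<R>" "\<omega> \<in> space (N R)" for R \<omega>
    using Reg that by (simp add: Reg_def)
  have q1: "1 \<le> q" using q by simp
  define c0 where "c0 s s' = (\<integral>\<omega>. jet (g \<omega>) s 0 * jet (g \<omega>) s' 0 \<partial>M)" for s s' :: "'d option \<times> 'd"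
  \<comment> \<open>The directions in which \<open>h\<close> is differentiated to obtain the jet
    entry \<open>s\<close> of its gradient.\<close>
  define jl where "jl s = (case fst s of None \<Rightarrow> [snd s] | Some a \<Rightarrow> [a, snd s])" for s :: "'d option \<times> 'd"
  \<comment> \<open>Of the two indices describing the same second derivative, the one that agrees
    with the order chosen by \<open>mi_list\<close> is kept.\<close>
  define J where "J = {s. mi_list (mi_of_list (jl s)) = jl s}"
  define \<phi> where "\<phi> s = (0::nat, mi_of_list (jl s))" for s
  let ?I = "{(i, \<alpha>::'d \<Rightarrow> nat). i < 1 \<and> 0 < mi_length \<alpha> \<and> mi_length \<alpha> \<le> q + 1}" and ?Y = "\<lambda>(i::nat, \<alpha>) \<omega>. mi_deriv \<alpha> (h \<omega>) 0"
  have nd: "nondegenerate_vector M ?I ?Y"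
  proof -
    have "(\<forall>i<1. 0 < (\<lambda>_::nat. q + 1) i) \<and> (\<Sum>i<1. (\<lambda>_::nat. q + 1) i) = q + 1 \<and> inj_on (\<lambda>_::nat. 0 :: real^'d) {..<1}"
      by (simp add: inj_on_def)
    with ND[unfolded grad_ND_def, rule_format, of 1 "\<lambda>_. q + 1" "\<lambda>_. 0"] show ?thesis by simp
  qed
  have jl_inj: "s = s'" if "jl s = jl s'" for s s'
    using that by (cases "fst s"; cases "fst s'") (simp_all add: jl_def prod_eq_iff)
  have \<phi>: "inj_on \<phi> J" "\<phi> ` J \<subseteq> ?I"
  proof -
    show "inj_on \<phi> J"
    proof (rule inj_onI)
      fix s s' assume s: "s \<in> J" "s' \<in> J" and "\<phi> s = \<phi> s'"
      then have "mi_of_list (jl s) = mi_of_list (jl s')" by (simp add: \<phi>_def)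
      then have "mi_list (mi_of_list (jl s)) = mi_list (mi_of_list (jl s'))" by (rule arg_cong)
      then have "jl s = jl s'" using s by (simp only: J_def mem_Collect_eq)
      then show "s = s'" by (rule jl_inj)
    qed
    have "0 < length (jl s) \<and> length (jl s) \<le> q + 1" for s using q by (auto simp: jl_def split: option.split)
    then have "0 < mi_length (mi_of_list (jl s)) \<and> mi_length (mi_of_list (jl s)) \<le> q + 1" for s
      unfolding mi_length_mi_of_list .
    then show "\<phi> ` J \<subseteq> ?I" unfolding \<phi>_def by blast
  qed
  have Y: "?Y (\<phi> s) \<omega> = jet (g \<omega>) s 0" if "s \<in> J" "\<omega> \<in> space M" for s \<omega>
  proof -
    have p1: "partial_deriv c (h \<omega>) = (\<lambda>x. g \<omega> x $ c)" for c
      using partial_deriv_gradient[OF h[OF that(2)]] by (intro ext)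
    have p2: "partial_deriv a (\<lambda>x. g \<omega> x $ c) 0 = iterated_partial [a] (g \<omega>) 0 $ c" for a c
    proof -
      have "((\<lambda>t. iterated_partial [] (g \<omega>) (0 + t *\<^sub>R axis a 1) $ c) has_real_derivative
        iterated_partial [a] (g \<omega>) (0 + 0 *\<^sub>R axis a 1) $ c) (at 0)"
        by (rule class_C_deriv[OF Cg[OF that(2)]]) (use q in auto)
      then show ?thesis unfolding partial_deriv_def[of a "\<lambda>x. g \<omega> x $ c"]
        by (intro vector_derivative_at) (simp add: has_real_derivative_iff_has_vector_derivative)
    qed
    have "?Y (\<phi> s) \<omega> = iterated_partial (jl s) (h \<omega>) 0" using that(1) by (simp add: \<phi>_def J_def mi_deriv_eq)
    also have "\<dots> = jet (g \<omega>) s 0"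
      by (cases "fst s") (simp_all add: jl_def jet_def opt_list_def p1 p2[simplified])
    finally show ?thesis .
  qed
  have cv: "covar M (?Y (\<phi> s)) (?Y (\<phi> s')) = c0 s s'" if "s \<in> J" "s' \<in> J" for s s'
  proof -
    have "covar M (?Y (\<phi> s)) (?Y (\<phi> s')) = covar M (\<lambda>\<omega>. jet (g \<omega>) s 0) (\<lambda>\<omega>. jet (g \<omega>) s' 0)"
      by (intro covar_cong Y that)
    also have "\<dots> = c0 s s'"
      unfolding c0_def by (intro covar_centered prob jet_normal[OF prob(1) g open_UNIV Cg q1]) auto
    finally show ?thesis .
  qed
  show ?thesis
  proof (rule hole_prob_bigo[where J=J and \<kappa>=c0 and \<iota>="\<lambda>i. i"])
    show "\<forall>a. (\<exists>s\<in>J. a s \<noteq> 0) \<longrightarrow> 0 < bilin J c0 a a"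
    proof (intro allI impI)
      fix a :: "'d option \<times> 'd \<Rightarrow> real" assume "\<exists>s\<in>J. a s \<noteq> 0"
      then have "0 < bilin J (\<lambda>s s'. covar M (?Y (\<phi> s)) (?Y (\<phi> s'))) a a"
        by (intro nondegenerate_reindex[OF nd \<phi>]) auto
      also have "\<dots> = bilin J c0 a a" unfolding bilin_def using cv by (intro sum.cong refl) simp
      finally show "0 < bilin J c0 a a" .
    qed
    show "c0 s s' = c0 s' s" for s s' by (simp add: c0_def mult.commute)
    show "\<forall>\<^sub>F R in to_infinity_along \<R>. \<forall>x\<in>\<Omega>. \<forall>s\<in>J. \<forall>s'\<in>J.
      \<bar>(\<integral>\<omega>. jet (G R \<omega>) s (R *\<^sub>R x) * jet (G R \<omega>) s' (R *\<^sub>R x) \<partial>N R) - c0 s s'\<bar> \<le> \<delta>" if "0 < \<delta>" for \<delta>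
      unfolding c0_def by (rule ScL_jet_limit[OF ScL q1 U pos prob(1) g Cg prob(2) G CG that])
    show "DC 2 2 U \<R> N G" by (rule DC_mono[OF q DC])
    show "class_C 2 (dilate R U) (G R \<omega>)" if "R \<in> \<R>" "\<omega> \<in> space (N R)" for R \<omega>
      by (rule class_C_mono[OF q CG[OF that]])
    \<comment> \<open>An index outside \<open>J\<close> is replaced by its transpose: the target is
      the identity matrix, which is symmetric, and so is the Hessian.\<close>
    show "\<exists>s'\<in>J. (\<forall>\<rho>. jet_target (\<lambda>i. i) \<rho> s = jet_target (\<lambda>i. i) \<rho> s') \<and>
      (\<forall>\<omega>\<in>space (N R). \<forall>y\<in>dilate R U. jet (G R \<omega>) s y = jet (G R \<omega>) s' y)" if R: "R \<in> \<R>" for R s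
    proof (cases "s \<in> J")
      case False
      obtain a b where s: "s = (Some a, b)"
        using False by (cases s; cases "fst s") (auto simp: J_def jl_def mi_list_single)
      have "mi_list (mi_of_list [a, b]) = [b, a]"
        using False mi_list_pair[of a b] by (auto simp: J_def jl_def s)
      moreover have "mi_of_list [b, a] = mi_of_list [a, b]" by (auto simp: mi_of_list_def)
      ultimately have J: "(Some b, a) \<in> J" by (simp add: J_def jl_def)
      show ?thesis
      proof (intro bexI[OF _ J] conjI allI ballI)
        show "jet_target (\<lambda>i. i) \<rho> s = jet_target (\<lambda>i. i) \<rho> (Some b, a)" for \<rho>
          by (simp add: s jet_target_def)
        fix \<omega> y assume \<omega>: "\<omega> \<in> space (N R)" and y: "y \<in> dilate R U"
        have "open (dilate R U)" using R pos U(1) by (intro dilate_open) auto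
        from hessian_symmetric[OF this y H[OF R \<omega>] class_C_mono[OF q1 CG[OF R \<omega>]]]
        show "jet (G R \<omega>) s y = jet (G R \<omega>) (Some b, a) y" unfolding jet_def s opt_list_def by simp
      qed
    qed blast
  qed (use U A pos prob G in \<open>auto intro: inj_onI\<close>)
qed

theorem corollary1p12:
  fixes U \<Omega> A :: "(real^'d::finite) set" and \<R> :: "real set" and p :: nat
    and M :: "'w measure" and N :: "real \<Rightarrow> 'v measure"
    and f :: "'w \<Rightarrow> real^'d \<Rightarrow> real^'k::finite" and F :: "real \<Rightarrow> 'v \<Rightarrow> real^'d \<Rightarrow> real^'k"
    and h :: "'w \<Rightarrow> real^'d \<Rightarrow> real" and H :: "real \<Rightarrow> 'v \<Rightarrow> real^'d \<Rightarrow> real"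
    and g :: "'w \<Rightarrow> real^'d \<Rightarrow> real^'d" and G :: "real \<Rightarrow> 'v \<Rightarrow> real^'d \<Rightarrow> real^'d"
  assumes U: "convex U" "open U"
    and Omega: "\<Omega> \<subseteq> U" "\<Omega> \<noteq> {}" "open \<Omega>"
    and margin: "0 < (INF x\<in>\<Omega>. INF y\<in>-U. ennreal (norm (y - x)))"
    and A: "A \<subseteq> \<Omega>" "A \<noteq> {}" "open A"
    and scales: "\<R> \<subseteq> {0<..}" "\<not> bounded \<R>"
    and p: "p \<ge> 1"
    and prob: "prob_space M" "\<And>R. R \<in> \<R> \<Longrightarrow> prob_space (N R)"
  shows
    "(\<comment> \<open>case (Z)\<close>
      CARD('k) \<le> CARD('d) \<and>
      centered_gaussian_field M UNIV f \<and> stationary_field M f \<and>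
      (\<forall>R\<in>\<R>. centered_gaussian_field (N R) (dilate R U) (F R)) \<and>
      Reg (4*p - 1) M f U \<R> N F \<and>
      ScL (4*p - 1) M f \<Omega> \<R> N F \<and>
      DC (4*p - 1) 2 U \<R> N F \<and>
      ND (4*p - 1) M f
      \<longrightarrow> hole_prob N F U A \<in> O[to_infinity_along \<R>](\<lambda>R. R powr (- (real p * real CARD('d)))))
     \<and>
     (\<comment> \<open>case (C): the fields are the gradients of \<^term>\<open>h\<close> and \<^term>\<open>H R\<close>\<close>
      centered_gaussian_field M UNIV h \<and> stationary_field M h \<and>
      (\<forall>R\<in>\<R>. centered_gaussian_field (N R) (dilate R U) (H R)) \<and>
      (\<forall>\<omega>\<in>space M. \<forall>x. GDERIV (h \<omega>) x :> g \<omega> x) \<and>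
      (\<forall>R\<in>\<R>. \<forall>\<omega>\<in>space (N R). \<forall>x\<in>dilate R U. GDERIV (H R \<omega>) x :> G R \<omega> x) \<and>
      centered_gaussian_field M UNIV g \<and> stationary_field M g \<and>
      (\<forall>R\<in>\<R>. centered_gaussian_field (N R) (dilate R U) (G R)) \<and>
      Reg (4*p - 1) M g U \<R> N G \<and>
      ScL (4*p - 1) M g \<Omega> \<R> N G \<and>
      DC (4*p - 1) 2 U \<R> N G \<and>
      grad_ND (4*p - 1) M h
      \<longrightarrow> hole_prob N G U A \<in> O[to_infinity_along \<R>](\<lambda>R. R powr (- (real p * real CARD('d)))))"
proof -
  have q: "2 \<le> 4 * p - 1" using p by simp
  show ?thesis
  proof (intro conjI impI; elim conjE)
    assume "CARD('k) \<le> CARD('d)" "centered_gaussian_field M UNIV f"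
      "\<forall>R\<in>\<R>. centered_gaussian_field (N R) (dilate R U) (F R)"
      "Reg (4*p - 1) M f U \<R> N F" "ScL (4*p - 1) M f \<Omega> \<R> N F" "DC (4*p - 1) 2 U \<R> N F" "ND (4*p - 1) M f"
    then show "hole_prob N F U A \<in> O[to_infinity_along \<R>](\<lambda>R. R powr (- (real p * real CARD('d))))"
      by (intro hole_prob_zero_set[OF U(2) Omega(1) A scales(1) q prob]) auto
  next
    assume "\<forall>\<omega>\<in>space M. \<forall>x. GDERIV (h \<omega>) x :> g \<omega> x"
      "\<forall>R\<in>\<R>. \<forall>\<omega>\<in>space (N R). \<forall>x\<in>dilate R U. GDERIV (H R \<omega>) x :> G R \<omega> x"
      "centered_gaussian_field M UNIV g" "\<forall>R\<in>\<R>. centered_gaussian_field (N R) (dilate R U) (G R)"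
      "Reg (4*p - 1) M g U \<R> N G" "ScL (4*p - 1) M g \<Omega> \<R> N G" "DC (4*p - 1) 2 U \<R> N G" "grad_ND (4*p - 1) M h"
    then show "hole_prob N G U A \<in> O[to_infinity_along \<R>](\<lambda>R. R powr (- (real p * real CARD('d))))"
      by (intro hole_prob_critical_points[where h=h and g=g and H=H and G=G, OF U(2) Omega(1) A scales(1) q prob]) auto
  qed
qed

end
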